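(* There exists $\delta>0$ such that, for every real-valued $f\in L^2(\mathbb{S}^1)$ with $\|f-\mathbf{1}\|_{L^2(\mathbb{S}^1)}<\delta$, we have $\Psi(f)\geq 0$, where $\mathbf{1}$ denotes the constant function equal to $1$ on $\mathbb{S}^1$.
   Context: $(\mathbb{S}^1,\sigma)$ is the unit circle in $\mathbb{R}^2$ equipped with its arc length measure $\sigma$ (total mass $2\pi$). Let $d\Sigma_{\vec\omega}=\delta(\omega_1+\omega_2+\omega_3+\omega_4+\omega_5+\omega_6)\,d\sigma_{\omega_1}\cdots d\sigma_{\omega_6}$, where $\delta$ is the two-dimensional Dirac measure; this is a measure on $(\mathbb{S}^1)^6$ supported on $\{\omega_1+\cdots+\omega_6=0\}$. Explicitly, $$\int_{(\mathbb{S}^1)^6} F\,d\Sigma_{\vec\omega}=\int_{(\mathbb{S}^1)^4}\ \sum_{(\omega_5,\omega_6)} F(\omega_1,\dots,\omega_6)\,\frac{2}{|y|\sqrt{4-|y|^2}}\,d\sigma_{\omega_1}d\sigma_{\omega_2}d\sigma_{\omega_3}d\sigma_{\omega_4},$$ where $y=-(\omega_1+\omega_2+\omega_3+\omega_4)$, the inner sum runs over the two ordered pairs $(\omega_5,\omega_6)\in(\mathbb{S}^1)^2$ with $\omega_5+\omega_6=y$ when $0<|y|<2$, and the integrand is $0$ when $|y|>2$ (the remaining values of $y$ form a null set). The functional $\Psi$ is $$\Psi(f) := \int_{(\mathbb{S}^1)^6} \big(f(\omega_1)f(\omega_2)f(\omega_3) - f(\omega_4)f(\omega_5)f(\omega_6)\big)^2\,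 \big( |\omega_4 + \omega_5 + \omega_6|^2 -1 \big)\,d\Sigma_{\vec{\omega}},$$ which is well defined (finite) for real-valued $f\in L^2(\mathbb{S}^1)$. *)

theory Defs
  imports "HOL-Analysis.Analysis"
begin

text \<open>
  The plane is identified with \<^typ>\<open>complex\<close>, whose norm is the Euclidean one, and the unit circle
  is \<^term>\<open>sphere (0::complex) 1\<close>. Arc length is the image of Lebesgue measure
  on $[0,2\pi)$ under $t \mapsto (\cos t, \sin t)$. The underlying space is the circle itself
  (not the plane), so that a function on the circle is represented by any
  \<^typ>\<open>complex \<Rightarrow> real\<close>; its values off the circle never matter.
\<close>

definition circle_measure :: "complex measure" where
  "circle_measure =
     distr (restrict_space lborel {0..<2 * pi}) (restrict_space borel (sphere 0 1)) cis"

definition L2_circle :: "(complex \<Rightarrow> real) set" where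
  "L2_circle = {f. f \<in> borel_measurable circle_measure \<and> integrable circle_measure (\<lambda>w. (f w)\<^sup>2)}"

definition L2_circle_norm :: "(complex \<Rightarrow> real) \<Rightarrow> real" where
  "L2_circle_norm f = sqrt (\<integral>w. (f w)\<^sup>2 \<partial>circle_measure)"

type_synonym complex4 = "complex \<times> complex \<times> complex \<times> complex"
type_synonym complex6 = "complex \<times> complex \<times> complex \<times> complex \<times> complex \<times> complex"

definition circle4 :: "complex4 measure" where
  "circle4 = circle_measure \<Otimes>\<^sub>M circle_measure \<Otimes>\<^sub>M circle_measure \<Otimes>\<^sub>M circle_measure"

definition circle6 :: "complex6 measure" where
  "circle6 = circle_measure \<Otimes>\<^sub>M circle_measure \<Otimes>\<^sub>M circle4"

text \<open>
  For $0 < |y| < 2$ there are exactly two ordered pairs of unit vectors with sum $y$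
  (lemma \<open>circle_pairs_eq\<close> below), and each contributes $2/(|y|\sqrt{4-|y|^2})$ to the density at
  $y$ of the convolution of arc length with itself. The values $|y| \in \{0, 2\}$ form a null set and
  are given weight $0$.
\<close>

definition circle_pairs :: "complex \<Rightarrow> (complex \<times> complex) set" where
  "circle_pairs y = {(u, v). u \<in> sphere 0 1 \<and> v \<in> sphere 0 1 \<and> u + v = y}"

definition pair_weight :: "complex \<Rightarrow> real" where
  "pair_weight y =
     (if 0 < norm y \<and> norm y < 2 then 2 / (norm y * sqrt (4 - (norm y)\<^sup>2)) else 0)"

text \<open>
  The measure $\delta(\omega_1+\cdots+\omega_6)\,d\sigma_{\omega_1}\cdots d\sigma_{\omega_6}$.
  That the set function below is countably additive, so that \<^const>\<open>measure_of\<close> does not collapse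
  to the zero measure, is \<open>emeasure_delta6\<close>; the resulting formulas for integrals
  are \<open>nn_integral_delta6\<close> and \<open>integral_delta6\<close>.
\<close>

definition delta6 :: "complex6 measure" where
  "delta6 = measure_of (space circle6) (sets circle6)
     (\<lambda>A. \<integral>\<^sup>+ (w1, w2, w3, w4).
        (let y = - (w1 + w2 + w3 + w4)
         in (\<Sum>(w5, w6)\<in>circle_pairs y.
               indicator A (w1, w2, w3, w4, w5, w6) * ennreal (pair_weight y)))
        \<partial>circle4)"

definition Psi :: "(complex \<Rightarrow> real) \<Rightarrow> real" where
  "Psi f = (\<integral>(w1, w2, w3, w4, w5, w6).
     (f w1 * f w2 * f w3 - f w4 * f w5 * f w6)\<^sup>2 * ((norm (w4 + w5 + w6))\<^sup>2 - 1) \<partial>delta6)"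


subsection \<open>The measure on the six-fold product is the intended one\<close>

lemma space_circle_measure [simp]: "space circle_measure = sphere 0 1"
  by (simp add: circle_measure_def space_restrict_space)

lemma sets_circle_measure [simp, measurable_cong]:
  "sets circle_measure = sets (restrict_space borel (sphere 0 1))"
  by (simp add: circle_measure_def)

lemma cis_measurable_circle:
  "cis \<in> measurable (restrict_space lborel {0..<2 * pi}) (restrict_space borel (sphere 0 1))"
proof (rule measurable_restrict_space2)
  show "cis \<in> space (restrict_space lborel {0..<2 * pi}) \<rightarrow> sphere 0 1" by auto
  have "cis \<in> borel_measurable borel"
    by (intro borel_measurable_continuous_onI continuous_intros)
  then show "cis \<in> borel_measurable (restrict_space lborel {0..<2 * pi})"
    by (intro measurable_restrict_space1) simp
qed

lemma emeasure_circle_measure_space: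
  "emeasure circle_measure (space circle_measure) = ennreal (2 * pi)"
proof -
  have "cis -` sphere 0 1 \<inter> {0..<2 * pi} = {0..<2 * pi}" by auto
  then have "emeasure circle_measure (sphere 0 1)
      = emeasure (restrict_space lborel {0..<2 * pi}) {0..<2 * pi}"
    unfolding circle_measure_def
    by (subst emeasure_distr[OF cis_measurable_circle])
       (auto simp: sets_restrict_space space_restrict_space)
  also have "\<dots> = ennreal (2 * pi)"
    by (subst emeasure_restrict_space) auto
  finally show ?thesis by simp
qed

lemma circle_measurable_id: "(\<lambda>w. w) \<in> borel_measurable circle_measure"
proof -
  have "(\<lambda>w. w) \<in> borel_measurable (restrict_space borel (sphere (0::complex) 1))"
    by (intro measurable_restrict_space1) simp
  then show ?thesis
    by (simp cong: measurable_cong_sets)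
qed

lemma measurable_into_circle:
  assumes "g \<in> borel_measurable M" "\<And>x. x \<in> space M \<Longrightarrow> norm (g x) = 1"
  shows "g \<in> measurable M circle_measure"
proof -
  have "g \<in> measurable M (restrict_space borel (sphere 0 1))"
    using assms by (intro measurable_restrict_space2) auto
  then show ?thesis by (simp cong: measurable_cong_sets)
qed

definition first_pt :: "complex \<Rightarrow> complex" where
  "first_pt y = (if 0 < norm y \<and> norm y < 2
     then y / 2 + \<i> * sgn y * of_real (sqrt (1 - (norm y)\<^sup>2 / 4)) else 1)"

definition second_pt :: "complex \<Rightarrow> complex" where
  "second_pt y = (if 0 < norm y \<and> norm y < 2 then y - first_pt y else 1)"

lemma circle_pairs_eq:
  assumes y: "0 < norm y" "norm y < 2"
  shows "circle_pairs y = {(first_pt y, second_pt y), (second_pt y, first_pt y)}"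
    and "first_pt y \<noteq> second_pt y"
    and "norm (first_pt y) = 1" and "norm (second_pt y) = 1"
proof -
  define r where "r = norm y"
  define s where "s = sqrt (1 - r\<^sup>2 / 4)"
  have r: "0 < r" "r < 2" using y by (auto simp: r_def)
  have "r\<^sup>2 < 2\<^sup>2" using r by (intro power_strict_mono) auto
  then have s2: "s\<^sup>2 = 1 - r\<^sup>2 / 4" and s0: "s > 0" by (auto simp: s_def)
  define e where "e = sgn y"
  have e: "norm e = 1" using y by (auto simp: e_def norm_sgn)
  have ye: "y = e * of_real r"
    using y by (auto simp: e_def r_def sgn_div_norm scaleR_conv_of_real)
  have e0: "e \<noteq> 0" using e by auto
  have fp: "first_pt y = e * Complex (r / 2) s"
  proof -
    have "first_pt y = y / 2 + \<i> * e * of_real s"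
      using y by (simp add: first_pt_def e_def s_def r_def)
    then show ?thesis by (simp add: ye Complex_eq algebra_simps)
  qed
  have sp: "second_pt y = e * Complex (r / 2) (- s)"
    using y unfolding second_pt_def fp by (simp add: ye Complex_eq algebra_simps)
  have nc: "norm (Complex (r / 2) s) = 1" "norm (Complex (r / 2) (- s)) = 1"
    using s2 by (auto simp: cmod_def power_divide)
  show n1: "norm (first_pt y) = 1" and n2: "norm (second_pt y) = 1"
    by (auto simp: fp sp norm_mult e nc)
  show "first_pt y \<noteq> second_pt y" using e0 s0 by (auto simp: fp sp)
  have sum: "first_pt y + second_pt y = y" using y by (simp add: second_pt_def)
  show "circle_pairs y = {(first_pt y, second_pt y), (second_pt y, first_pt y)}"
  proof (intro equalityI subsetI)
    fix p assume "p \<in> circle_pairs y"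
    then obtain u v where p: "p = (u, v)" and uv: "norm u = 1" "norm v = 1" "u + v = y"
      by (auto simp: circle_pairs_def)
    define a where "a = u / e"
    define b where "b = v / e"
    have na: "norm a = 1" "norm b = 1" using uv e by (auto simp: a_def b_def norm_divide)
    have ab: "a + b = of_real r"
      using uv(3) e0 unfolding a_def b_def by (simp add: ye add_divide_distrib[symmetric])
    have b: "b = Complex (r - Re a) (- Im a)"
      using ab by (auto simp: complex_eq_iff)
    have 1: "(Re a)\<^sup>2 + (Im a)\<^sup>2 = 1" using na(1) by (simp add: cmod_def)
    have 2: "(r - Re a)\<^sup>2 + (Im a)\<^sup>2 = 1" using na(2) by (simp add: cmod_def b)
    have "r * (r - 2 * Re a) = 0" using 1 2 by (simp add: power2_eq_square algebra_simps)
    then have ra: "Re a = r / 2" using r by simp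
    have "(Im a)\<^sup>2 = s\<^sup>2" using 1 s2 by (simp add: ra power_divide)
    then have "Im a = s \<or> Im a = - s" by (simp add: power2_eq_iff)
    then have "(a = Complex (r / 2) s \<and> b = Complex (r / 2) (- s))
        \<or> (a = Complex (r / 2) (- s) \<and> b = Complex (r / 2) s)"
      using ra b by (auto simp: complex_eq_iff)
    moreover have "u = e * a" "v = e * b" using e0 by (auto simp: a_def b_def)
    ultimately show "p \<in> {(first_pt y, second_pt y), (second_pt y, first_pt y)}"
      unfolding p fp sp by auto
  next
    fix p assume "p \<in> {(first_pt y, second_pt y), (second_pt y, first_pt y)}"
    then show "p \<in> circle_pairs y"
      using n1 n2 sum by (auto simp: circle_pairs_def add.commute)
  qed
qed

lemma norm_pt [simp]: "norm (first_pt y) = 1" "norm (second_pt y) = 1"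
  using circle_pairs_eq(3,4)[of y] by (auto simp: first_pt_def second_pt_def)

lemma pt_measurable [measurable]:
  "first_pt \<in> borel_measurable borel" "second_pt \<in> borel_measurable borel"
proof -
  have [measurable]: "(sgn :: complex \<Rightarrow> complex) \<in> borel_measurable borel"
    unfolding sgn_div_norm by measurable
  show [measurable]: "first_pt \<in> borel_measurable borel"
    unfolding first_pt_def by measurable
  show "second_pt \<in> borel_measurable borel"
    unfolding second_pt_def by measurable
qed

lemma pair_weight_measurable [measurable]: "pair_weight \<in> borel_measurable borel"
  unfolding pair_weight_def by measurable

lemma pair_weight_nonneg [simp]: "0 \<le> pair_weight y"
proof -
  have "(norm y)\<^sup>2 \<le> 2\<^sup>2" if "norm y < 2" using that by (intro power_mono) auto
  then show ?thesis by (auto simp: pair_weight_def)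
qed

definition neg_sum4 :: "complex4 \<Rightarrow> complex" where
  "neg_sum4 = (\<lambda>(w1, w2, w3, w4). - (w1 + w2 + w3 + w4))"

definition lift1 :: "complex4 \<Rightarrow> complex6" where
  "lift1 = (\<lambda>(w1, w2, w3, w4). (w1, w2, w3, w4,
     first_pt (- (w1 + w2 + w3 + w4)), second_pt (- (w1 + w2 + w3 + w4))))"

definition lift2 :: "complex4 \<Rightarrow> complex6" where
  "lift2 = (\<lambda>(w1, w2, w3, w4). (w1, w2, w3, w4,
     second_pt (- (w1 + w2 + w3 + w4)), first_pt (- (w1 + w2 + w3 + w4))))"

lemma coord4_measurable:
  shows "(\<lambda>x. fst x) \<in> measurable circle4 circle_measure"
    and "(\<lambda>x. fst (snd x)) \<in> measurable circle4 circle_measure"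
    and "(\<lambda>x. fst (snd (snd x))) \<in> measurable circle4 circle_measure"
    and "(\<lambda>x. snd (snd (snd x))) \<in> measurable circle4 circle_measure"
  unfolding circle4_def by measurable

lemma neg_sum4_measurable [measurable]: "neg_sum4 \<in> borel_measurable circle4"
proof -
  note [measurable] = coord4_measurable[THEN measurable_compose, OF circle_measurable_id]
  have "neg_sum4 = (\<lambda>x. - (fst x + fst (snd x) + fst (snd (snd x)) + snd (snd (snd x))))"
    by (auto simp: neg_sum4_def fun_eq_iff)
  also have "\<dots> \<in> borel_measurable circle4" by measurable
  finally show ?thesis .
qed

lemma lift_measurable [measurable]:
  "lift1 \<in> measurable circle4 circle6" "lift2 \<in> measurable circle4 circle6"
proof -
  note [measurable] = coord4_measurable
  have [measurable]: "(\<lambda>x. first_pt (neg_sum4 x)) \<in> measurable circle4 circle_measure"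
    "(\<lambda>x. second_pt (neg_sum4 x)) \<in> measurable circle4 circle_measure"
    by (intro measurable_into_circle; simp)+
  have "lift1 = (\<lambda>x. (fst x, fst (snd x), fst (snd (snd x)), snd (snd (snd x)),
      first_pt (neg_sum4 x), second_pt (neg_sum4 x)))"
    by (auto simp: lift1_def neg_sum4_def fun_eq_iff)
  also have "\<dots> \<in> measurable circle4 circle6"
    unfolding circle6_def by (subst (2) circle4_def) measurable
  finally show "lift1 \<in> measurable circle4 circle6" .
  have "lift2 = (\<lambda>x. (fst x, fst (snd x), fst (snd (snd x)), snd (snd (snd x)),
      second_pt (neg_sum4 x), first_pt (neg_sum4 x)))"
    by (auto simp: lift2_def neg_sum4_def fun_eq_iff)
  also have "\<dots> \<in> measurable circle4 circle6"
    unfolding circle6_def by (subst (2) circle4_def) measurable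
  finally show "lift2 \<in> measurable circle4 circle6" .
qed

lemma sum_circle_pairs:
  fixes G :: "complex \<times> complex \<Rightarrow> 'a::semiring_0" and g :: "real \<Rightarrow> 'a"
  assumes g0: "g 0 = 0"
  shows "(\<Sum>p\<in>circle_pairs y. G p * g (pair_weight y)) =
    (G (first_pt y, second_pt y) + G (second_pt y, first_pt y)) * g (pair_weight y)"
proof (cases "0 < norm y \<and> norm y < 2")
  case True
  then show ?thesis
    using circle_pairs_eq(2)[of y] by (simp add: circle_pairs_eq(1) distrib_right)
next
  case False
  then have "pair_weight y = 0" by (auto simp: pair_weight_def)
  then show ?thesis by (simp add: g0)
qed

lemma sum_circle_pairs_ennreal:
  fixes F :: "complex6 \<Rightarrow> ennreal"
  shows "(case x of (w1, w2, w3, w4) \<Rightarrow> let y = - (w1 + w2 + w3 + w4) in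
      \<Sum>(w5, w6)\<in>circle_pairs y. F (w1, w2, w3, w4, w5, w6) * ennreal (pair_weight y))
    = (F (lift1 x) + F (lift2 x)) * ennreal (pair_weight (neg_sum4 x))"
  using sum_circle_pairs[of ennreal "\<lambda>p. F (fst x, fst (snd x), fst (snd (snd x)), snd (snd (snd x)), p)"
      "neg_sum4 x"]
  by (auto simp: Let_def lift1_def lift2_def neg_sum4_def case_prod_unfold)

lemma sum_circle_pairs_real:
  fixes F :: "complex6 \<Rightarrow> real"
  shows "(case x of (w1, w2, w3, w4) \<Rightarrow> let y = - (w1 + w2 + w3 + w4) in
      \<Sum>(w5, w6)\<in>circle_pairs y. F (w1, w2, w3, w4, w5, w6) * pair_weight y)
    = (F (lift1 x) + F (lift2 x)) * pair_weight (neg_sum4 x)"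
  using sum_circle_pairs[of "\<lambda>t. t" "\<lambda>p. F (fst x, fst (snd x), fst (snd (snd x)), snd (snd (snd x)), p)"
      "neg_sum4 x"]
  by (auto simp: Let_def lift1_def lift2_def neg_sum4_def case_prod_unfold)

lemma space_delta6 [simp]: "space delta6 = space circle6"
  unfolding delta6_def by (rule space_measure_of) (rule sets.space_closed)

lemma sets_delta6 [simp, measurable_cong]: "sets delta6 = sets circle6"
  unfolding delta6_def by simp

lemma emeasure_delta6:
  assumes A: "A \<in> sets circle6"
  shows "emeasure delta6 A = (\<integral>\<^sup>+ (w1, w2, w3, w4).
        (let y = - (w1 + w2 + w3 + w4)
         in (\<Sum>(w5, w6)\<in>circle_pairs y.
               indicator A (w1, w2, w3, w4, w5, w6) * ennreal (pair_weight y)))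
        \<partial>circle4)"
proof (rule emeasure_measure_of[OF delta6_def])
  let ?m = "\<lambda>A. \<integral>\<^sup>+ x. (indicator A (lift1 x) + indicator A (lift2 x))
      * ennreal (pair_weight (neg_sum4 x)) \<partial>circle4"
  show "sets circle6 \<subseteq> Pow (space circle6)" by (rule sets.space_closed)
  show "A \<in> sets delta6" using A by simp
  show "positive (sets delta6) (\<lambda>A. \<integral>\<^sup>+ (w1, w2, w3, w4).
        (let y = - (w1 + w2 + w3 + w4)
         in (\<Sum>(w5, w6)\<in>circle_pairs y.
               indicator A (w1, w2, w3, w4, w5, w6) * ennreal (pair_weight y)))
        \<partial>circle4)"
    unfolding sum_circle_pairs_ennreal by (simp add: positive_def)
  show "countably_additive (sets delta6) (\<lambda>A. \<integral>\<^sup>+ (w1, w2, w3, w4).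
        (let y = - (w1 + w2 + w3 + w4)
         in (\<Sum>(w5, w6)\<in>circle_pairs y.
               indicator A (w1, w2, w3, w4, w5, w6) * ennreal (pair_weight y)))
        \<partial>circle4)"
    unfolding sum_circle_pairs_ennreal sets_delta6
  proof (rule countably_additiveI)
    fix B :: "nat \<Rightarrow> complex6 set"
    assume B: "range B \<subseteq> sets circle6" "disjoint_family B"
    have [measurable]: "B i \<in> sets circle6" for i using B(1) by auto
    have "(\<Sum>i. ?m (B i)) = (\<integral>\<^sup>+ x. (\<Sum>i. (indicator (B i) (lift1 x) + indicator (B i) (lift2 x))
        * ennreal (pair_weight (neg_sum4 x))) \<partial>circle4)"
      by (intro nn_integral_suminf[symmetric]) measurable
    also have "\<dots> = ?m (\<Union>i. B i)"
      by (simp add: suminf_add[symmetric] suminf_indicator[OF B(2)])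
    finally show "(\<Sum>i. ?m (B i)) = ?m (\<Union>i. B i)" .
  qed
qed

lemma nn_integral_delta6_lift:
  assumes "F \<in> borel_measurable circle6"
  shows "(\<integral>\<^sup>+ x. F x \<partial>delta6) =
    (\<integral>\<^sup>+ x. (F (lift1 x) + F (lift2 x)) * ennreal (pair_weight (neg_sum4 x)) \<partial>circle4)"
  using assms
proof (induction rule: borel_measurable_induct)
  case (cong f g)
  have "(\<integral>\<^sup>+ x. g x \<partial>delta6) = (\<integral>\<^sup>+ x. f x \<partial>delta6)"
    using cong(3) by (intro nn_integral_cong) auto
  moreover have "f (lift1 x) = g (lift1 x)" "f (lift2 x) = g (lift2 x)" if "x \<in> space circle4" for x
    using cong(3) lift_measurable[THEN measurable_space] that by auto
  ultimately show ?case using cong(4) by (simp cong: nn_integral_cong)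
next
  case (set A)
  then show ?case
    using emeasure_delta6[OF set, unfolded sum_circle_pairs_ennreal] by simp
next
  case (mult u c)
  have [measurable]: "u \<in> borel_measurable circle6" by fact
  have [measurable]: "u \<in> borel_measurable delta6" by measurable
  have "(\<integral>\<^sup>+ x. c * u x \<partial>delta6) = c * (\<integral>\<^sup>+ x. u x \<partial>delta6)"
    by (rule nn_integral_cmult) measurable
  also have "\<dots> = (\<integral>\<^sup>+ x. c * ((u (lift1 x) + u (lift2 x)) * ennreal (pair_weight (neg_sum4 x))) \<partial>circle4)"
    unfolding mult.IH by (rule nn_integral_cmult[symmetric]) measurable
  finally show ?case by (simp add: algebra_simps)
next
  case (add u v)
  have [measurable]: "u \<in> borel_measurable circle6" "v \<in> borel_measurable circle6" by fact+
  have "(\<integral>\<^sup>+ x. v x + u x \<partial>delta6) = (\<integral>\<^sup>+ x. v x \<partial>delta6) + (\<integral>\<^sup>+ x. u x \<partial>delta6)"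
    by (rule nn_integral_add) measurable
  also have "\<dots> = (\<integral>\<^sup>+ x. (v (lift1 x) + v (lift2 x)) * ennreal (pair_weight (neg_sum4 x))
      + (u (lift1 x) + u (lift2 x)) * ennreal (pair_weight (neg_sum4 x)) \<partial>circle4)"
    unfolding add.IH by (rule nn_integral_add[symmetric]) measurable
  finally show ?case by (simp add: algebra_simps)
next
  case (seq U)
  have [measurable]: "\<And>i. U i \<in> borel_measurable circle6" by fact
  have m: "U i x \<le> U j x" if "i \<le> j" for i j x
    using incseqD[OF seq(3) that] by (rule le_funD)
  have "(\<integral>\<^sup>+ x. Sup (range U) x \<partial>delta6) = (\<integral>\<^sup>+ x. (SUP i. U i x) \<partial>delta6)"
    by (simp add: image_comp)
  also have "\<dots> = (SUP i. \<integral>\<^sup>+ x. U i x \<partial>delta6)"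
    by (rule nn_integral_monotone_convergence_SUP[OF seq(3)]) measurable
  also have "\<dots> = (SUP i. \<integral>\<^sup>+ x. (U i (lift1 x) + U i (lift2 x)) * ennreal (pair_weight (neg_sum4 x)) \<partial>circle4)"
    by (simp add: seq.IH)
  also have "\<dots> = (\<integral>\<^sup>+ x. (SUP i. (U i (lift1 x) + U i (lift2 x)) * ennreal (pair_weight (neg_sum4 x))) \<partial>circle4)"
    by (rule nn_integral_monotone_convergence_SUP[symmetric])
       (auto simp: incseq_def le_fun_def intro!: mult_right_mono add_mono m)
  also have "\<dots> = (\<integral>\<^sup>+ x. ((SUP i. U i (lift1 x)) + (SUP i. U i (lift2 x))) * ennreal (pair_weight (neg_sum4 x)) \<partial>circle4)"
    by (intro nn_integral_cong)
       (auto simp: SUP_mult_right_ennreal[symmetric] ennreal_SUP_add[symmetric] incseq_def m)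
  finally show ?case by (simp add: image_comp)
qed

lemma nn_integral_delta6:
  assumes "F \<in> borel_measurable circle6"
  shows "(\<integral>\<^sup>+ x. F x \<partial>delta6) = (\<integral>\<^sup>+ (w1, w2, w3, w4).
        (let y = - (w1 + w2 + w3 + w4)
         in (\<Sum>(w5, w6)\<in>circle_pairs y. F (w1, w2, w3, w4, w5, w6) * ennreal (pair_weight y)))
        \<partial>circle4)"
  unfolding sum_circle_pairs_ennreal by (rule nn_integral_delta6_lift[OF assms])

lemma integral_delta6:
  fixes F :: "complex6 \<Rightarrow> real"
  assumes F: "integrable delta6 F"
  shows "(\<integral> x. F x \<partial>delta6) = (\<integral> (w1, w2, w3, w4).
        (let y = - (w1 + w2 + w3 + w4)
         in (\<Sum>(w5, w6)\<in>circle_pairs y. F (w1, w2, w3, w4, w5, w6) * pair_weight y))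
        \<partial>circle4)"
proof -
  let ?T = "\<lambda>(G :: complex6 \<Rightarrow> real) x. (G (lift1 x) + G (lift2 x)) * pair_weight (neg_sum4 x)"
  have nonneg: "integrable circle4 (?T G) \<and> (\<integral> x. G x \<partial>delta6) = (\<integral> x. ?T G x \<partial>circle4)"
    if G: "integrable delta6 G" and pos: "\<And>x. 0 \<le> G x" for G
  proof -
    have [measurable]: "G \<in> borel_measurable circle6"
      using borel_measurable_integrable[OF G] by (simp cong: measurable_cong_sets)
    have "ennreal (\<integral> x. G x \<partial>delta6) = (\<integral>\<^sup>+ x. ennreal (G x) \<partial>delta6)"
      by (rule nn_integral_eq_integral[symmetric]) (use G pos in auto)
    also have "\<dots> = (\<integral>\<^sup>+ x. ennreal (?T G x) \<partial>circle4)"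
      by (subst nn_integral_delta6_lift) (auto simp: ennreal_mult pos ennreal_plus)
    finally have e: "(\<integral>\<^sup>+ x. ennreal (?T G x) \<partial>circle4) = ennreal (\<integral> x. G x \<partial>delta6)" ..
    have "has_bochner_integral circle4 (?T G) (\<integral> x. G x \<partial>delta6)"
      by (rule has_bochner_integral_nn_integral) (use e pos in auto)
    then show ?thesis by (auto simp: has_bochner_integral_iff)
  qed
  let ?P = "\<lambda>x. max 0 (F x)" and ?N = "\<lambda>x. max 0 (- F x)"
  have P: "integrable delta6 ?P" and N: "integrable delta6 ?N" using F by auto
  have "(\<integral> x. F x \<partial>delta6) = (\<integral> x. ?P x - ?N x \<partial>delta6)"
    by (intro Bochner_Integration.integral_cong) auto
  also have "\<dots> = (\<integral> x. ?T ?P x \<partial>circle4) - (\<integral> x. ?T ?N x \<partial>circle4)"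
    using P N nonneg[OF P] nonneg[OF N] by simp
  also have "\<dots> = (\<integral> x. ?T ?P x - ?T ?N x \<partial>circle4)"
    using nonneg[OF P] nonneg[OF N] by (intro Bochner_Integration.integral_diff[symmetric]) auto
  also have "\<dots> = (\<integral> x. ?T F x \<partial>circle4)"
    by (intro Bochner_Integration.integral_cong refl) (auto simp: max_def algebra_simps)
  finally show ?thesis unfolding sum_circle_pairs_real .
qed

end

theory Submission
  imports Defs "HOL-Complex_Analysis.Great_Picard"
begin

text \<open>
  Since $\Psi$ is homogeneous, one may normalise $f = 1 + g$ with $\int g = 0$. The quadratic part of
  $\Psi$ at $1$ is $\int (g_1+g_2+g_3-g_4-g_5-g_6)^2 (|\omega_4+\omega_5+\omega_6|^2-1)\,d\Sigma$.
  The measure $\Sigma$ is invariant under all permutations of the six points, and averaging the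
  integrand over the ten splittings into two triples yields pointwise
  $\frac45 |\sum_j g_j \omega_j|^2$ on $\sum_j \omega_j = 0$. So the quadratic form is nonnegative
  although its weight changes sign.

  It is coercive on functions of mean zero. Averaging $\sum_j g_j\omega_j$ over a cut-off part of the
  configurations through $\omega_1$ expresses $g$ as an equicontinuous function plus an error bounded
  by the form, so by Arzela-Ascoli a failure of coercivity would produce a continuous $g$ of mean zero
  and positive norm with $\sum_j g_j\omega_j = 0$ on all configurations; the configurations
  $(\alpha,-\alpha,\beta,\beta,-\beta,-\beta)$ with $\cos\alpha = -2\cos\beta$, rotated,
  force such a $g$ to be constant.

  The remaining terms are of higher order in $\|g\|_2$, because the factor $|x|^2-1$ compensates the
  singularity of $\sigma*\sigma*\sigma$ at $|x|=1$, whence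
  $\int a_1^2 b_2^2 c_3^2 \left||x|^2-1\right| d\Sigma \le C \|a\|_2^2\|b\|_2^2\|c\|_2^2$.
\<close>

subsection \<open>Arc length and polar coordinates\<close>

text \<open>The moment sum_j g_j omega_j of a constant g vanishes on sum_j omega_j = 0, so the
  quadratic form can only be coercive once the mean has been scaled out.

  The factor 4/5 is 8/10. Symmetrised over its two triples, a weight is 2 plus the inner products of
  the pairs inside the triples. Each pair lies inside a triple in 4 of the ten splittings and the
  fifteen inner products add up to -3, so the ten weights add up to 20 - 12 = 8. Hence they cannot
  all be small at one configuration. This turns the weighted bound into a bound for the marginals of
  Sigma, although the triple convolution of sigma is unbounded, and so makes unweighted integrals of
  squares available.

  The average needs a cut-off because the density of the determined pair blows up where
  |omega_5+omega_6| is 0 or 2, and there the pair does not depend continuously on the other points.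
  The truncated kernel is continuous on a compact torus.

  Since the weight W changes sign, the higher-order part is measured in L^2 of |W| dSigma. Its
  product with the linear part is split with a small parameter, and coercivity pays for the
  resulting loss.\<close>

lemma cis_measurable_circle_measure [measurable]: "cis \<in> borel \<rightarrow>\<^sub>M circle_measure"
  by (intro measurable_into_circle borel_measurable_continuous_onI continuous_intros) simp

lemma nn_integral_circle:
  assumes [measurable]: "f \<in> borel_measurable circle_measure"
  shows "(\<integral>\<^sup>+w. f w \<partial>circle_measure) = (\<integral>\<^sup>+t. f (cis t) * indicator {0..<2 * pi} t \<partial>lborel)"
proof -
  have m: "f \<in> borel_measurable (restrict_space borel (sphere 0 1))"
    using assms by (simp cong: measurable_cong_sets)
  show ?thesis
    unfolding circle_measure_def
    by (subst nn_integral_distr[OF cis_measurable_circle])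
       (use m in \<open>auto simp: nn_integral_restrict_space\<close>)
qed

lemma finite_measure_circle: "finite_measure circle_measure"
  by (rule finite_measureI) (simp add: emeasure_circle_measure_space[simplified])

lemma circle_mult_measurable:
  "norm a = 1 \<Longrightarrow> (\<lambda>w. a * w) \<in> circle_measure \<rightarrow>\<^sub>M circle_measure"
  using circle_measurable_id
  by (intro measurable_into_circle borel_measurable_times) (auto simp: norm_mult)

text \<open>A rotation by \<open>cis c\<close> shifts the parameter interval to
  \<open>{c..<c + 2 * pi}\<close>. The part beyond \<open>2 * pi\<close> is moved back to
  \<open>{0..<c}\<close> by periodicity.\<close>

lemma nn_integral_circle_rotate:
  assumes f [measurable]: "f \<in> borel_measurable circle_measure" and a: "norm a = 1"
  shows "(\<integral>\<^sup>+w. f (a * w) \<partial>circle_measure) = (\<integral>\<^sup>+w. f w \<partial>circle_measure)"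
proof -
  obtain c where c: "0 \<le> c" "c < 2 * pi" and ac: "a = cis c"
    using complex_split_polar[of a] a by (metis Arg2pi cis_conv_exp is_Arg_def mult_1 of_real_1)
  have [measurable]: "(\<lambda>w. f (a * w)) \<in> borel_measurable circle_measure"
    using measurable_compose[OF circle_mult_measurable[OF a] f] .
  let ?g = "\<lambda>t. f (cis t)"
  have "(\<integral>\<^sup>+w. f (a * w) \<partial>circle_measure) = (\<integral>\<^sup>+t. ?g (c + t) * indicator {0..<2 * pi} t \<partial>lborel)"
    by (subst nn_integral_circle) (use \<open>(\<lambda>w. f (a * w)) \<in> borel_measurable circle_measure\<close> in \<open>simp_all add: ac cis_mult\<close>)
  also have "\<dots> = (\<integral>\<^sup>+t. ?g t * indicator {c..<c + 2 * pi} t \<partial>lborel)"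
    by (subst (2) nn_integral_real_affine[where c=1 and t=c])
       (auto intro!: nn_integral_cong split: split_indicator)
  also have "\<dots> = (\<integral>\<^sup>+t. ?g t * indicator {c..<2 * pi} t + ?g t * indicator {2 * pi..<2 * pi + c} t \<partial>lborel)"
    using c by (intro nn_integral_cong) (auto split: split_indicator)
  also have "\<dots> = (\<integral>\<^sup>+t. ?g t * indicator {c..<2 * pi} t \<partial>lborel)
      + (\<integral>\<^sup>+t. ?g t * indicator {2 * pi..<2 * pi + c} t \<partial>lborel)"
    by (rule nn_integral_add) measurable
  also have "(\<integral>\<^sup>+t. ?g t * indicator {2 * pi..<2 * pi + c} t \<partial>lborel)
      = (\<integral>\<^sup>+t. ?g (2 * pi + t) * indicator {2 * pi..<2 * pi + c} (2 * pi + t) \<partial>lborel)"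
    by (subst nn_integral_real_affine[where c=1 and t="2 * pi"]) auto
  also have "\<dots> = (\<integral>\<^sup>+t. ?g t * indicator {0..<c} t \<partial>lborel)"
    by (intro nn_integral_cong) (auto split: split_indicator simp: cis_mult[symmetric])
  also have "(\<integral>\<^sup>+t. ?g t * indicator {c..<2 * pi} t \<partial>lborel) + \<dots>
      = (\<integral>\<^sup>+t. ?g t * indicator {c..<2 * pi} t + ?g t * indicator {0..<c} t \<partial>lborel)"
    by (rule nn_integral_add[symmetric]) measurable
  also have "\<dots> = (\<integral>\<^sup>+t. ?g t * indicator {0..<2 * pi} t \<partial>lborel)"
    using c by (intro nn_integral_cong) (auto split: split_indicator)
  also have "\<dots> = (\<integral>\<^sup>+w. f w \<partial>circle_measure)"
    by (simp add: nn_integral_circle)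
  finally show ?thesis .
qed

text \<open>The freedom in \<open>a\<close> serves symmetry: \<open>a = - pi\<close> pairs opposite
  angles, \<open>a = - (pi/2)\<close> separates the two half planes.\<close>

lemma nn_integral_circle_shift:
  assumes f [measurable]: "f \<in> borel_measurable circle_measure"
  shows "(\<integral>\<^sup>+w. f w \<partial>circle_measure) = (\<integral>\<^sup>+t. f (cis t) * indicator {a..<a + 2 * pi} t \<partial>lborel)"
proof -
  have [measurable]: "(\<lambda>w. f (cis a * w)) \<in> borel_measurable circle_measure"
    using measurable_compose[OF circle_mult_measurable f] by simp
  have "(\<integral>\<^sup>+w. f w \<partial>circle_measure) = (\<integral>\<^sup>+w. f (cis a * w) \<partial>circle_measure)"
    by (rule nn_integral_circle_rotate[symmetric]) auto
  also have "\<dots> = (\<integral>\<^sup>+t. f (cis (a + t)) * indicator {0..<2 * pi} t \<partial>lborel)"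
    by (simp add: nn_integral_circle cis_mult)
  also have "\<dots> = (\<integral>\<^sup>+t. f (cis t) * indicator {a..<a + 2 * pi} t \<partial>lborel)"
    by (subst (2) nn_integral_real_affine[where c=1 and t=a])
       (auto intro!: nn_integral_cong split: split_indicator)
  finally show ?thesis .
qed

lemma nn_integral_incseq_sets:
  fixes f :: "'a \<Rightarrow> ennreal"
  assumes [measurable]: "f \<in> borel_measurable M" and A: "\<And>n. A n \<in> sets M" "incseq A"
  shows "(SUP n. \<integral>\<^sup>+x. f x * indicator (A n) x \<partial>M) = (\<integral>\<^sup>+x. f x * indicator (\<Union>n. A n) x \<partial>M)"
proof -
  have "(SUP n. emeasure (density M f) (A n)) = emeasure (density M f) (\<Union>n. A n)"
    using A by (intro SUP_emeasure_incseq) auto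
  moreover have "(\<Union>n. A n) \<in> sets M" using A by auto
  ultimately show ?thesis using A by (simp add: emeasure_density)
qed

text \<open>The substitution s = tan t. It is carried out on [-n, n], whose image under arctan keeps
  cos away from 0, and monotone convergence extends it to the line.\<close>

lemma nn_integral_arctan:
  assumes [measurable]: "F \<in> borel_measurable borel"
  shows "(\<integral>\<^sup>+s. ennreal (1 / (1 + s\<^sup>2)) * F (arctan s) \<partial>lborel)
    = (\<integral>\<^sup>+t. F t * indicator {-(pi/2)<..<pi/2} t \<partial>lborel)"
proof -
  have [measurable]: "arctan \<in> borel_measurable borel"
    by (intro borel_measurable_continuous_onI continuous_intros)
  let ?f = "\<lambda>s. ennreal (1 / (1 + s\<^sup>2)) * F (arctan s)"
  have step: "(\<integral>\<^sup>+s. ?f s * indicator {- real n..real n} s \<partial>lborel)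
      = (\<integral>\<^sup>+t. F t * indicator {- arctan (real n)..arctan (real n)} t \<partial>lborel)" (is "?L = ?R")
    if n: "n > 0" for n
  proof -
    have cos0: "cos t \<noteq> 0" if "t \<in> {- arctan (real n)..arctan (real n)}" for t
    proof -
      have "- (pi/2) < t" "t < pi / 2" using that arctan_bounded[of "real n"] by auto
      then show ?thesis using cos_gt_zero_pi by force
    qed
    have inv: "arctan (tan t) = t" if "t \<in> {- arctan (real n)..arctan (real n)}" for t
    proof -
      have "- (pi/2) < t" "t < pi / 2" using that arctan_bounded[of "real n"] by auto
      then show ?thesis by (simp add: arctan_tan)
    qed
    have "?L = (\<integral>\<^sup>+s. ?f s * indicator {tan (- arctan (real n))..tan (arctan (real n))} s \<partial>lborel)"
      by (simp add: tan_arctan)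
    also have "\<dots> = (\<integral>\<^sup>+t. ?f (tan t) * ennreal (inverse ((cos t)\<^sup>2)) * indicator {- arctan (real n)..arctan (real n)} t \<partial>lborel)"
    proof (rule nn_integral_substitution_aux)
      show "continuous_on {- arctan (real n)..arctan (real n)} (\<lambda>t. inverse ((cos t)\<^sup>2))"
        using cos0 by (intro continuous_intros) auto
      show "- arctan (real n) < arctan (real n)" using n by simp
    qed (use cos0 in \<open>auto intro: DERIV_tan\<close>)
    also have "\<dots> = ?R"
    proof (intro nn_integral_cong)
      fix t :: real
      show "?f (tan t) * ennreal (inverse ((cos t)\<^sup>2)) * indicator {- arctan (real n)..arctan (real n)} t
        = F t * indicator {- arctan (real n)..arctan (real n)} t"
      proof (cases "t \<in> {- arctan (real n)..arctan (real n)}")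
        case True
        have e: "1 + (tan t)\<^sup>2 = inverse ((cos t)\<^sup>2)"
          using tan_sec[OF cos0[OF True]] by (simp add: power_inverse)
        have "ennreal (1 / (1 + (tan t)\<^sup>2)) * ennreal (inverse ((cos t)\<^sup>2)) = ennreal 1"
          unfolding e using cos0[OF True] by (subst ennreal_mult[symmetric]) auto
        then show ?thesis using inv[OF True] True
          by (simp add: mult.commute mult.left_commute)
      qed auto
    qed
    finally show ?thesis .
  qed
  have U1: "(\<Union>n. {- real (Suc n)..real (Suc n)}) = UNIV"
  proof -
    have "\<exists>n. x \<in> {- real (Suc n)..real (Suc n)}" for x :: real
      using real_arch_simple[of "\<bar>x\<bar>"] by (auto simp: abs_le_iff) (smt (verit) of_nat_Suc)
    then show ?thesis by blast
  qed
  have U2: "(\<Union>n. {- arctan (real (Suc n))..arctan (real (Suc n))}) = {-(pi/2)<..<pi/2}"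
  proof (intro equalityI subsetI)
    fix x assume "x \<in> (\<Union>n. {- arctan (real (Suc n))..arctan (real (Suc n))})"
    then show "x \<in> {-(pi/2)<..<pi/2}" 
      using arctan_bounded by (auto simp: field_simps) (smt (verit, best))+
  next
    fix x assume x: "x \<in> {-(pi/2)<..<pi/2}"
    obtain n where n: "tan x \<in> {- real (Suc n)..real (Suc n)}" using U1 by blast
    have "arctan (tan x) = x" using x by (intro arctan_tan) auto
    then have "x \<in> {- arctan (real (Suc n))..arctan (real (Suc n))}"
      using n arctan_le_iff[of "tan x" "real (Suc n)"] arctan_le_iff[of "- real (Suc n)" "tan x"]
      unfolding arctan_minus by auto
    then show "x \<in> (\<Union>n. {- arctan (real (Suc n))..arctan (real (Suc n))})" by blast
  qed
  have "(\<integral>\<^sup>+s. ?f s \<partial>lborel) = (\<integral>\<^sup>+s. ?f s * indicator (\<Union>n. {- real (Suc n)..real (Suc n)}) s \<partial>lborel)"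
    unfolding U1 by simp
  also have "\<dots> = (SUP n. \<integral>\<^sup>+s. ?f s * indicator {- real (Suc n)..real (Suc n)} s \<partial>lborel)"
    by (intro nn_integral_incseq_sets[symmetric]) (auto simp: incseq_def)
  also have "\<dots> = (SUP n. \<integral>\<^sup>+t. F t * indicator {- arctan (real (Suc n))..arctan (real (Suc n))} t \<partial>lborel)"
    by (subst step) auto
  also have "\<dots> = (\<integral>\<^sup>+t. F t * indicator (\<Union>n. {- arctan (real (Suc n))..arctan (real (Suc n))}) t \<partial>lborel)"
    by (intro nn_integral_incseq_sets) (auto simp: incseq_def arctan_le_iff intro: order_trans[rotated])
  finally show ?thesis unfolding U2 .
qed

section \<open>Polar coordinates in the plane\<close>

lemma Complex_measurable [measurable]:
  assumes [measurable]: "f \<in> borel_measurable M" "g \<in> borel_measurable M"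
  shows "(\<lambda>x. Complex (f x) (g x)) \<in> borel_measurable M"
  unfolding Complex_eq by measurable

lemma lborel_complex_eq: "lborel = distr (lborel \<Otimes>\<^sub>M lborel) borel (\<lambda>(x, y). Complex x y)"
proof (rule lborel_eqI)
  fix l u :: complex
  assume le: "\<And>b. b \<in> Basis \<Longrightarrow> l \<bullet> b \<le> u \<bullet> b"
  have lu: "Re l \<le> Re u" "Im l \<le> Im u"
    using le[of 1] le[of \<i>] by (auto simp: Basis_complex_def)
  have m: "(\<lambda>(x, y). Complex x y) \<in> (lborel \<Otimes>\<^sub>M lborel) \<rightarrow>\<^sub>M borel" by measurable
  have "(\<lambda>(x, y). Complex x y) -` box l u \<inter> space (lborel \<Otimes>\<^sub>M lborel)
      = {Re l<..<Re u} \<times> {Im l<..<Im u}"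
    by (auto simp: box_def Basis_complex_def space_pair_measure)
  then show "emeasure (distr (lborel \<Otimes>\<^sub>M lborel) borel (\<lambda>(x, y). Complex x y)) (box l u)
      = ennreal (\<Prod>b\<in>Basis. (u - l) \<bullet> b)"
    using lu m by (simp add: emeasure_distr lborel.emeasure_pair_measure_Times Basis_complex_def ennreal_mult)
qed simp

lemma nn_integral_lborel_complex:
  assumes [measurable]: "H \<in> borel_measurable borel"
  shows "(\<integral>\<^sup>+z. H z \<partial>lborel) = (\<integral>\<^sup>+x. \<integral>\<^sup>+y. H (Complex x y) \<partial>lborel \<partial>lborel)"
proof -
  have "(\<integral>\<^sup>+z. H z \<partial>lborel) = (\<integral>\<^sup>+p. H (case p of (x, y) \<Rightarrow> Complex x y) \<partial>(lborel \<Otimes>\<^sub>M lborel))"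
    by (subst lborel_complex_eq, subst nn_integral_distr) (auto simp: case_prod_beta)
  also have "\<dots> = (\<integral>\<^sup>+x. \<integral>\<^sup>+y. H (Complex x y) \<partial>lborel \<partial>lborel)"
    by (subst lborel.nn_integral_fst[symmetric]) auto
  finally show ?thesis .
qed

text \<open>Polar coordinates from one-dimensional substitutions only: for fixed x > 0 the slope s =
  y / x replaces y, the integrations are exchanged, x is rescaled to the radius, and s becomes the
  angle arctan s.\<close>

lemma nn_integral_right_half_plane:
  assumes [measurable]: "H \<in> borel_measurable borel"
  shows "(\<integral>\<^sup>+x. (\<integral>\<^sup>+y. H (Complex x y) \<partial>lborel) * indicator {0<..} x \<partial>lborel)
    = (\<integral>\<^sup>+t. (\<integral>\<^sup>+r. ennreal r * H (of_real r * cis t) * indicator {0<..} r \<partial>lborel)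
        * indicator {-(pi/2)<..<pi/2} t \<partial>lborel)"
proof -
  define T where "T = (\<lambda>t. \<integral>\<^sup>+r. ennreal r * H (of_real r * cis t) * indicator {0<..} r \<partial>lborel)"
  have [measurable]: "cis \<in> borel_measurable borel"
    by (intro borel_measurable_continuous_onI continuous_intros)
  have [measurable]: "T \<in> borel_measurable borel" unfolding T_def by measurable
  have "(\<integral>\<^sup>+x. (\<integral>\<^sup>+y. H (Complex x y) \<partial>lborel) * indicator {0<..} x \<partial>lborel)
    = (\<integral>\<^sup>+x. (\<integral>\<^sup>+s. ennreal x * H (Complex x (x * s)) * indicator {0<..} x \<partial>lborel) \<partial>lborel)"
  proof (intro nn_integral_cong)
    fix x :: real
    show "(\<integral>\<^sup>+y. H (Complex x y) \<partial>lborel) * indicator {0<..} x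
      = (\<integral>\<^sup>+s. ennreal x * H (Complex x (x * s)) * indicator {0<..} x \<partial>lborel)"
    proof (cases "x > 0")
      case True
      then show ?thesis
        by (subst nn_integral_real_affine[where c=x and t=0]) (auto simp: nn_integral_cmult)
    qed auto
  qed
  also have "\<dots> = (\<integral>\<^sup>+s. (\<integral>\<^sup>+x. ennreal x * H (Complex x (x * s)) * indicator {0<..} x \<partial>lborel) \<partial>lborel)"
    by (rule lborel_pair.Fubini') measurable
  also have "\<dots> = (\<integral>\<^sup>+s. ennreal (1 / (1 + s\<^sup>2)) * T (arctan s) \<partial>lborel)"
  proof (intro nn_integral_cong)
    fix s :: real
    \<comment> \<open>This is cos (arctan s), so that x = c r. One factor c comes from dx and one
      from the factor x of the integrand; their product is the density required by
      \<open>nn_integral_arctan\<close>.\<close>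
    define c where "c = 1 / sqrt (1 + s\<^sup>2)"
    have c: "c > 0" "c * c = 1 / (1 + s\<^sup>2)" 
      by (auto simp: c_def field_simps add_pos_nonneg)
    have cs: "cis (arctan s) = Complex c (c * s)"
      by (simp add: complex_eq_iff cos_arctan sin_arctan c_def)
    have "(\<integral>\<^sup>+x. ennreal x * H (Complex x (x * s)) * indicator {0<..} x \<partial>lborel)
      = ennreal c * (\<integral>\<^sup>+r. ennreal (c * r) * H (Complex (c * r) (c * r * s)) * indicator {0<..} (c * r) \<partial>lborel)"
      using c by (subst nn_integral_real_affine[where c=c and t=0]) auto
    also have "\<dots> = ennreal c * (\<integral>\<^sup>+r. ennreal c * (ennreal r * H (of_real r * cis (arctan s)) * indicator {0<..} r) \<partial>lborel)"
    proof (rule arg_cong[where f="\<lambda>X. ennreal c * X"], rule nn_integral_cong)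
      fix r :: real
      have "Complex (c * r) (c * r * s) = of_real r * cis (arctan s)"
        by (simp add: cs complex_eq_iff)
      then show "ennreal (c * r) * H (Complex (c * r) (c * r * s)) * indicator {0<..} (c * r)
        = ennreal c * (ennreal r * H (of_real r * cis (arctan s)) * indicator {0<..} r)"
        using c by (auto split: split_indicator simp: zero_less_mult_iff ennreal_mult mult.assoc)
    qed
    also have "\<dots> = ennreal (c * c) * T (arctan s)"
      using c(1) by (subst nn_integral_cmult) (simp_all add: T_def ennreal_mult mult.assoc)
    finally show "(\<integral>\<^sup>+x. ennreal x * H (Complex x (x * s)) * indicator {0<..} x \<partial>lborel)
      = ennreal (1 / (1 + s\<^sup>2)) * T (arctan s)" unfolding c(2) .
  qed
  also have "\<dots> = (\<integral>\<^sup>+t. T t * indicator {-(pi/2)<..<pi/2} t \<partial>lborel)"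
    by (rule nn_integral_arctan) measurable
  finally show ?thesis unfolding T_def .
qed

text \<open>The left half plane is the point reflection of the right one, which adds pi to the
  angle. The vertical axis and the two angles bounding the half planes are null sets.\<close>

lemma nn_integral_polar:
  fixes H :: "complex \<Rightarrow> ennreal"
  assumes H [measurable]: "H \<in> borel_measurable borel"
  shows "(\<integral>\<^sup>+z. H z \<partial>lborel)
    = (\<integral>\<^sup>+u. (\<integral>\<^sup>+r. ennreal r * H (of_real r * u) * indicator {0<..} r \<partial>lborel) \<partial>circle_measure)"
proof -
  define T where "T = (\<lambda>u. \<integral>\<^sup>+r. ennreal r * H (of_real r * u) * indicator {0<..} r \<partial>lborel)"
  have T_borel: "T \<in> borel_measurable borel" unfolding T_def by measurable
  have [measurable]: "cis \<in> borel_measurable borel"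
    by (intro borel_measurable_continuous_onI continuous_intros)
  note [measurable] = T_borel
  have T_meas: "T \<in> borel_measurable circle_measure"
    using measurable_compose[OF circle_measurable_id T_borel] by simp
  let ?h = "\<lambda>x. \<integral>\<^sup>+y. H (Complex x y) \<partial>lborel"
  have "(\<integral>\<^sup>+z. H z \<partial>lborel) = (\<integral>\<^sup>+x. ?h x \<partial>lborel)"
    by (rule nn_integral_lborel_complex) fact
  also have "\<dots> = (\<integral>\<^sup>+x. ?h x * indicator {0<..} x + ?h x * indicator {..<0} x \<partial>lborel)"
    using AE_lborel_singleton[of 0]
    by (intro nn_integral_cong_AE, eventually_elim) (auto split: split_indicator)
  also have "\<dots> = (\<integral>\<^sup>+x. ?h x * indicator {0<..} x \<partial>lborel) + (\<integral>\<^sup>+x. ?h x * indicator {..<0} x \<partial>lborel)"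
    by (rule nn_integral_add) measurable
  also have "(\<integral>\<^sup>+x. ?h x * indicator {..<0} x \<partial>lborel)
      = (\<integral>\<^sup>+x. (\<integral>\<^sup>+y. H (- Complex x y) \<partial>lborel) * indicator {0<..} x \<partial>lborel)"
  proof -
    have neg: "(\<integral>\<^sup>+y. H (Complex (- x) y) \<partial>lborel) = (\<integral>\<^sup>+y. H (- Complex x y) \<partial>lborel)" for x
    proof -
      have "(\<integral>\<^sup>+y. H (Complex (- x) y) \<partial>lborel) = (\<integral>\<^sup>+y. H (Complex (- x) (- y)) \<partial>lborel)"
        by (subst nn_integral_real_affine[where c="-1" and t=0]) auto
      moreover have "Complex (- x) (- y) = - Complex x y" for y by (simp add: complex_eq_iff)
      ultimately show ?thesis by simp
    qed
    have "(\<integral>\<^sup>+x. ?h x * indicator {..<0} x \<partial>lborel) = (\<integral>\<^sup>+x. ?h (- x) * indicator {..<0} (- x) \<partial>lborel)"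
      by (subst nn_integral_real_affine[where c="-1" and t=0]) auto
    also have "\<dots> = (\<integral>\<^sup>+x. (\<integral>\<^sup>+y. H (- Complex x y) \<partial>lborel) * indicator {0<..} x \<partial>lborel)"
      unfolding neg by (intro nn_integral_cong) (auto split: split_indicator)
    finally show ?thesis .
  qed
  also have "\<dots> = (\<integral>\<^sup>+t. T (- cis t) * indicator {-(pi/2)<..<pi/2} t \<partial>lborel)"
    by (subst nn_integral_right_half_plane) (auto simp: T_def)
  also have "\<dots> = (\<integral>\<^sup>+t. T (cis t) * indicator {pi/2<..<3*pi/2} t \<partial>lborel)"
    by (subst (2) nn_integral_real_affine[where c=1 and t=pi])
       (auto intro!: nn_integral_cong split: split_indicator simp: cis_mult[symmetric])
  also have "(\<integral>\<^sup>+x. ?h x * indicator {0<..} x \<partial>lborel)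
      = (\<integral>\<^sup>+t. T (cis t) * indicator {-(pi/2)<..<pi/2} t \<partial>lborel)"
    unfolding T_def by (rule nn_integral_right_half_plane) fact
  also have "\<dots> + (\<integral>\<^sup>+t. T (cis t) * indicator {pi/2<..<3*pi/2} t \<partial>lborel)
     = (\<integral>\<^sup>+t. T (cis t) * indicator {-(pi/2)<..<pi/2} t + T (cis t) * indicator {pi/2<..<3*pi/2} t \<partial>lborel)"
    by (rule nn_integral_add[symmetric]) measurable
  also have "\<dots> = (\<integral>\<^sup>+t. T (cis t) * indicator {-(pi/2)..<-(pi/2) + 2*pi} t \<partial>lborel)"
    using AE_lborel_singleton[of "pi/2"] AE_lborel_singleton[of "-(pi/2)"]
    by (intro nn_integral_cong_AE, eventually_elim) (auto split: split_indicator)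
  also have "\<dots> = (\<integral>\<^sup>+u. T u \<partial>circle_measure)"
    by (rule nn_integral_circle_shift[symmetric]) (rule T_meas)
  finally show ?thesis unfolding T_def .
qed

subsection \<open>The convolution of arc length with itself\<close>

interpretation circle: finite_measure circle_measure
  by (rule finite_measure_circle)

interpretation circle_pair: pair_sigma_finite circle_measure circle_measure ..

interpretation lborel_circle: pair_sigma_finite "lborel :: real measure" circle_measure ..

lemma borel_measurable_circleI:
  "f \<in> M \<rightarrow>\<^sub>M circle_measure \<Longrightarrow> f \<in> borel_measurable M"
  by (erule measurable_compose[OF _ circle_measurable_id])

lemma circle_times_measurable:
  assumes a: "a \<in> N \<rightarrow>\<^sub>M circle_measure" and b: "b \<in> N \<rightarrow>\<^sub>M circle_measure"
  shows "(\<lambda>p. a p * b p) \<in> N \<rightarrow>\<^sub>M circle_measure"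
proof (rule measurable_into_circle)
  show "(\<lambda>p. a p * b p) \<in> borel_measurable N"
    by (intro borel_measurable_times borel_measurable_circleI a b)
  show "norm (a x * b x) = 1" if "x \<in> space N" for x
    using measurable_space[OF a that] measurable_space[OF b that] by (simp add: norm_mult)
qed

lemma pts_measurable_circle [measurable]:
  "first_pt \<in> borel \<rightarrow>\<^sub>M circle_measure" "second_pt \<in> borel \<rightarrow>\<^sub>M circle_measure"
  by (intro measurable_into_circle; simp)+

text \<open>Passage from angle to length: if two unit vectors enclose the angle pi - s, their sum
  has length r = 2 sin (s/2). Then dr = cos (s/2) ds with cos (s/2) = sqrt (4 - r^2) / 2.\<close>

lemma nn_integral_two_sin:
  fixes K :: "real \<Rightarrow> ennreal"
  assumes [measurable]: "K \<in> borel_measurable borel"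
  shows "(\<integral>\<^sup>+s. K (2 * sin (s / 2)) * indicator {0..pi} s \<partial>lborel)
    = (\<integral>\<^sup>+r. K r * ennreal (2 / sqrt (4 - r\<^sup>2)) * indicator {0..2} r \<partial>lborel)"
proof -
  let ?f = "\<lambda>r. K r * ennreal (2 / sqrt (4 - r\<^sup>2))"
  have "(\<integral>\<^sup>+r. ?f r * indicator {0..2} r \<partial>lborel)
      = (\<integral>\<^sup>+r. ?f r * indicator {2 * sin (0 / 2)..2 * sin (pi / 2)} r \<partial>lborel)"
    by simp
  also have "\<dots> = (\<integral>\<^sup>+s. ?f (2 * sin (s / 2)) * ennreal (cos (s / 2)) * indicator {0..pi} s \<partial>lborel)"
  proof (rule nn_integral_substitution_aux)
    show "cos (s / 2) \<ge> 0" if "s \<in> {0..pi}" for s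
      using that by (intro cos_ge_zero) (auto simp: field_simps)
    show "((\<lambda>s. 2 * sin (s / 2)) has_real_derivative cos (s / 2)) (at s)" for s
      by (auto intro!: derivative_eq_intros)
    show "continuous_on {0..pi} (\<lambda>s. cos (s / 2))" by (intro continuous_intros) auto
  qed auto
  also have "\<dots> = (\<integral>\<^sup>+s. K (2 * sin (s / 2)) * indicator {0..pi} s \<partial>lborel)"
    using AE_lborel_singleton[of pi]
  proof (intro nn_integral_cong_AE, eventually_elim)
    fix s :: real assume "s \<noteq> pi"
    show "?f (2 * sin (s / 2)) * ennreal (cos (s / 2)) * indicator {0..pi} s
       = K (2 * sin (s / 2)) * indicator {0..pi} s"
    proof (cases "s \<in> {0..pi}")
      case True
      then have c: "cos (s / 2) > 0" using \<open>s \<noteq> pi\<close>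
        by (intro cos_gt_zero_pi) auto
      have "4 - (2 * sin (s / 2))\<^sup>2 = (2 * cos (s / 2))\<^sup>2"
        by (simp add: power_mult_distrib cos_squared_eq)
      then have "2 / sqrt (4 - (2 * sin (s / 2))\<^sup>2) = 1 / cos (s / 2)"
        using c by (simp add: real_sqrt_mult)
      moreover have "ennreal (1 / cos (s / 2)) * ennreal (cos (s / 2)) = 1"
        using c by (subst ennreal_mult[symmetric]) auto
      ultimately show ?thesis using True by (simp add: mult.assoc)
    qed auto
  qed
  finally show ?thesis ..
qed

text \<open>\<open>u\<close> is the direction of the bisector: the two points lie at the angle (pi -
  s)/2 on either side of it.\<close>

lemma pts_of_two_sin:
  assumes u: "norm u = 1" and s: "0 < s" "s < pi"
  shows "first_pt (of_real (2 * sin (s / 2)) * u) = u * cis ((pi - s) / 2)"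
    and "second_pt (of_real (2 * sin (s / 2)) * u) = u * cis (- (pi - s) / 2)"
proof -
  let ?y = "of_real (2 * sin (s / 2)) * u :: complex"
  have sn: "sin (s / 2) > 0" using s by (intro sin_gt_zero) auto
  have cs: "cos (s / 2) > 0" using s by (intro cos_gt_zero_pi) auto
  have "sin (s / 2) < 1"
    using sin_cos_squared_add[of "s/2"] cs sn by (smt (verit) power2_eq_1_iff power_one zero_less_power one_le_power)
  then have ny: "norm ?y = 2 * sin (s / 2)" "0 < norm ?y" "norm ?y < 2"
    using sn u by (auto simp: norm_mult)
  have "sgn ?y = u" using ny u sn by (simp add: sgn_div_norm scaleR_conv_of_real)
  moreover have "sqrt (1 - (norm ?y)\<^sup>2 / 4) = cos (s / 2)"
    unfolding ny(1) using cs by (simp add: power_mult_distrib cos_squared_eq[symmetric])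
  ultimately have f: "first_pt ?y = u * Complex (sin (s / 2)) (cos (s / 2))"
    using ny(2,3) by (simp add: first_pt_def Complex_eq algebra_simps)
  have c1: "cis ((pi - s) / 2) = Complex (sin (s / 2)) (cos (s / 2))"
    by (simp add: complex_eq_iff diff_divide_distrib cos_diff sin_diff)
  have c2: "cis (- (pi - s) / 2) = Complex (sin (s / 2)) (- cos (s / 2))"
    using c1 by (metis complex_cnj cis_cnj minus_divide_left)
  show "first_pt ?y = u * cis ((pi - s) / 2)" using f c1 by simp
  show "second_pt ?y = u * cis (- (pi - s) / 2)"
  proof -
    have "second_pt ?y = ?y - u * Complex (sin (s / 2)) (cos (s / 2))"
      using ny(2,3) by (simp only: second_pt_def f if_True simp_thms)
    also have "\<dots> = u * Complex (sin (s / 2)) (- cos (s / 2))"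
      by (simp add: Complex_eq algebra_simps)
    finally show ?thesis unfolding c2 .
  qed
qed

text \<open>Disintegration of a pair of points over its sum, which is where
  \<open>pair_weight\<close> comes from. Writing v = u cis t and rotating by cis (- t / 2) makes u
  the direction of the sum; the angle t becomes the length of the sum, and direction and length are
  polar coordinates of y. The Jacobian r of the polar coordinates cancels the factor 1 / |y| of
  \<open>pair_weight\<close>.\<close>

lemma nn_integral_circle_circle:
  fixes G :: "complex \<times> complex \<Rightarrow> ennreal"
  assumes G [measurable]: "G \<in> borel_measurable (circle_measure \<Otimes>\<^sub>M circle_measure)"
  shows "(\<integral>\<^sup>+u. \<integral>\<^sup>+v. G (u, v) \<partial>circle_measure \<partial>circle_measure)
    = (\<integral>\<^sup>+y. (G (first_pt y, second_pt y) + G (second_pt y, first_pt y)) * ennreal (pair_weight y) \<partial>lborel)"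
proof -
  define G' where "G' y = G (first_pt y, second_pt y) + G (second_pt y, first_pt y)" for y
  have G'_borel [measurable]: "G' \<in> borel_measurable borel" unfolding G'_def by measurable
  define M where "M t = (\<integral>\<^sup>+u. G (u * cis (- t / 2), u * cis (t / 2)) \<partial>circle_measure)" for t
  define L where "L r = (\<integral>\<^sup>+u. G' (of_real r * u) \<partial>circle_measure)" for r :: real
  have snd_borel: "(\<lambda>p. snd p) \<in> borel_measurable (N \<Otimes>\<^sub>M circle_measure)"
    and fst_borel: "(\<lambda>p. fst p) \<in> borel_measurable (circle_measure \<Otimes>\<^sub>M N)" for N :: "'b measure"
    by (intro borel_measurable_circleI measurable_snd measurable_fst)+
  have [measurable]: "(\<lambda>p. snd p) \<in> borel_measurable (lborel \<Otimes>\<^sub>M circle_measure)"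
     "(\<lambda>p. snd p) \<in> borel_measurable (borel \<Otimes>\<^sub>M circle_measure)" for N :: "'b measure"
    by (rule snd_borel)+
  have cisb [measurable]: "cis \<in> borel_measurable borel"
    by (intro borel_measurable_continuous_onI continuous_intros)
  note pairC = circle_times_measurable
  have G1: "(\<lambda>p. G (a p, b p)) \<in> borel_measurable N"
    if "a \<in> N \<rightarrow>\<^sub>M circle_measure" "b \<in> N \<rightarrow>\<^sub>M circle_measure" for a b and N :: "'d measure"
    using measurable_compose[OF measurable_Pair[OF that] G] .
  have [measurable]: "M \<in> borel_measurable borel"
    unfolding M_def
    by (intro circle.borel_measurable_nn_integral)
       (unfold case_prod_beta, intro G1 pairC measurable_snd measurable_compose[OF _ cis_measurable_circle_measure], measurable)
  have [measurable]: "L \<in> borel_measurable borel"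
    unfolding L_def by measurable
  have "(\<integral>\<^sup>+u. \<integral>\<^sup>+v. G (u, v) \<partial>circle_measure \<partial>circle_measure)
      = (\<integral>\<^sup>+u. \<integral>\<^sup>+r. G (u, u * r) \<partial>circle_measure \<partial>circle_measure)"
  proof (rule nn_integral_cong)
    fix u assume "u \<in> space circle_measure"
    then show "(\<integral>\<^sup>+v. G (u, v) \<partial>circle_measure) = (\<integral>\<^sup>+r. G (u, u * r) \<partial>circle_measure)"
      by (intro nn_integral_circle_rotate[of "\<lambda>v. G (u, v)" u, symmetric] G1 measurable_const) simp_all
  qed
  also have "\<dots> = (\<integral>\<^sup>+r. \<integral>\<^sup>+u. G (u, u * r) \<partial>circle_measure \<partial>circle_measure)"
    by (rule circle_pair.Fubini')
       (unfold case_prod_beta, intro G1 pairC measurable_snd measurable_fst)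
  also have "\<dots> = (\<integral>\<^sup>+t. (\<integral>\<^sup>+u. G (u, u * cis t) \<partial>circle_measure) * indicator {-pi..<-pi + 2 * pi} t \<partial>lborel)"
    by (intro nn_integral_circle_shift circle.borel_measurable_nn_integral)
       (unfold case_prod_beta, intro G1 pairC measurable_snd measurable_fst)
  also have "\<dots> = (\<integral>\<^sup>+t. M t * indicator {-pi..<-pi + 2 * pi} t \<partial>lborel)"
  proof (rule nn_integral_cong)
    fix t :: real
    have "(\<integral>\<^sup>+u. G (u, u * cis t) \<partial>circle_measure)
        = (\<integral>\<^sup>+u. G (cis (- t / 2) * u, cis (- t / 2) * u * cis t) \<partial>circle_measure)"
      by (rule nn_integral_circle_rotate[of "\<lambda>u. G (u, u * cis t)", symmetric])
        ((intro G1 pairC measurable_const)?; simp)+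
    also have "\<dots> = M t"
    proof -
      have "cis (- t / 2) * cis t = cis (t / 2)" by (simp add: cis_mult)
      then have "cis (- t / 2) * u * cis t = u * cis (t / 2)" for u
        by (metis mult.assoc mult.commute)
      then show ?thesis unfolding M_def by (simp only: mult.commute[of "cis (- t / 2)"])
    qed
    finally show "(\<integral>\<^sup>+u. G (u, u * cis t) \<partial>circle_measure) * indicator {-pi..<-pi + 2 * pi} t
      = M t * indicator {-pi..<-pi + 2 * pi} t" by simp
  qed
  \<comment> \<open>The two signs of t give the two orders of the same unordered pair, hence the two
    summands of \<open>G'\<close>. With s = pi - |t| the sum has length 2 sin (s/2).\<close>
  also have "\<dots> = (\<integral>\<^sup>+t. M t * indicator {0..pi} t + M t * indicator {-pi..0} t \<partial>lborel)"
    using AE_lborel_singleton[of 0] AE_lborel_singleton[of pi]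
    by (intro nn_integral_cong_AE, eventually_elim) (auto split: split_indicator)
  also have "\<dots> = (\<integral>\<^sup>+t. M t * indicator {0..pi} t \<partial>lborel) + (\<integral>\<^sup>+t. M t * indicator {-pi..0} t \<partial>lborel)"
    by (rule nn_integral_add) measurable
  also have "(\<integral>\<^sup>+t. M t * indicator {0..pi} t \<partial>lborel) = (\<integral>\<^sup>+s. M (pi - s) * indicator {0..pi} s \<partial>lborel)"
    by (subst nn_integral_real_affine[where c="-1" and t=pi])
       (auto intro!: nn_integral_cong split: split_indicator)
  also have "(\<integral>\<^sup>+t. M t * indicator {-pi..0} t \<partial>lborel) = (\<integral>\<^sup>+s. M (- (pi - s)) * indicator {0..pi} s \<partial>lborel)"
    by (subst nn_integral_real_affine[where c=1 and t="-pi"])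
       (auto intro!: nn_integral_cong split: split_indicator)
  also have "(\<integral>\<^sup>+s. M (pi - s) * indicator {0..pi} s \<partial>lborel) + \<dots>
      = (\<integral>\<^sup>+s. M (pi - s) * indicator {0..pi} s + M (- (pi - s)) * indicator {0..pi} s \<partial>lborel)"
    by (rule nn_integral_add[symmetric]) measurable
  also have "\<dots> = (\<integral>\<^sup>+s. L (2 * sin (s / 2)) * indicator {0..pi} s \<partial>lborel)"
    using AE_lborel_singleton[of 0] AE_lborel_singleton[of pi]
  proof (intro nn_integral_cong_AE, eventually_elim)
    fix s :: real assume ne: "s \<noteq> 0" "s \<noteq> pi"
    show "M (pi - s) * indicator {0..pi} s + M (- (pi - s)) * indicator {0..pi} s
        = L (2 * sin (s / 2)) * indicator {0..pi} s"
    proof (cases "s \<in> {0..pi}")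
      case True
      then have s: "0 < s" "s < pi" using ne by auto
      have "L (2 * sin (s / 2)) = (\<integral>\<^sup>+u. G (u * cis ((pi - s) / 2), u * cis (- (pi - s) / 2))
          + G (u * cis (- (pi - s) / 2), u * cis ((pi - s) / 2)) \<partial>circle_measure)"
        unfolding L_def G'_def by (intro nn_integral_cong) (use s in \<open>simp add: pts_of_two_sin del: of_real_mult\<close>)
      also have "\<dots> = M (- (pi - s)) + M (pi - s)"
        unfolding M_def minus_minus by (intro nn_integral_add G1 pairC measurable_const) simp_all
      finally show ?thesis using True by (simp add: add.commute)
    qed auto
  qed
  also have "\<dots> = (\<integral>\<^sup>+r. L r * ennreal (2 / sqrt (4 - r\<^sup>2)) * indicator {0..2} r \<partial>lborel)"
    by (rule nn_integral_two_sin) measurable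
  also have "\<dots> = (\<integral>\<^sup>+r. (\<integral>\<^sup>+u. ennreal r * (G' (of_real r * u) * ennreal (pair_weight (of_real r * u))) * indicator {0<..} r \<partial>circle_measure) \<partial>lborel)"
    using AE_lborel_singleton[of 0] AE_lborel_singleton[of 2]
  proof (intro nn_integral_cong_AE, eventually_elim)
    fix r :: real assume ne: "r \<noteq> 0" "r \<noteq> 2"
    have w: "pair_weight (of_real r * u) = (if 0 < r \<and> r < 2 then 2 / (r * sqrt (4 - r\<^sup>2)) else 0)"
      if "u \<in> space circle_measure" "r > 0" for u
      using that by (simp add: pair_weight_def norm_mult)
    have "(\<integral>\<^sup>+u. ennreal r * (G' (of_real r * u) * ennreal (pair_weight (of_real r * u))) * indicator {0<..} r \<partial>circle_measure)
      = (\<integral>\<^sup>+u. G' (of_real r * u) * (ennreal (2 / sqrt (4 - r\<^sup>2)) * indicator {0..2} r) \<partial>circle_measure)"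
    proof (rule nn_integral_cong)
      fix u assume u: "u \<in> space circle_measure"
      show "ennreal r * (G' (of_real r * u) * ennreal (pair_weight (of_real r * u))) * indicator {0<..} r
        = G' (of_real r * u) * (ennreal (2 / sqrt (4 - r\<^sup>2)) * indicator {0..2} r)"
      proof (cases "0 < r \<and> r < 2")
        case True
        then have "ennreal r * ennreal (pair_weight (of_real r * u)) = ennreal (2 / sqrt (4 - r\<^sup>2))"
          using w[OF u] pair_weight_nonneg[of "of_real r * u"]
          by (subst ennreal_mult[symmetric]) (auto simp del: pair_weight_nonneg)
        then show ?thesis using True by (simp only: mult.left_commute[of "ennreal r"]) simp
      next
        case False
        then show ?thesis using ne w[OF u] by (auto split: split_indicator)
      qed
    qed
    also have "\<dots> = L r * (ennreal (2 / sqrt (4 - r\<^sup>2)) * indicator {0..2} r)"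
      unfolding L_def
      by (intro nn_integral_multc measurable_compose[OF _ G'_borel] borel_measurable_times
          borel_measurable_const circle_measurable_id)
    finally show "L r * ennreal (2 / sqrt (4 - r\<^sup>2)) * indicator {0..2} r =
      (\<integral>\<^sup>+u. ennreal r * (G' (of_real r * u) * ennreal (pair_weight (of_real r * u))) * indicator {0<..} r \<partial>circle_measure)"
      by (simp add: mult.assoc)
  qed
  also have "\<dots> = (\<integral>\<^sup>+u. (\<integral>\<^sup>+r. ennreal r * (G' (of_real r * u) * ennreal (pair_weight (of_real r * u))) * indicator {0<..} r \<partial>lborel) \<partial>circle_measure)"
    by (rule lborel_circle.Fubini'[symmetric]) measurable
  also have "\<dots> = (\<integral>\<^sup>+y. G' y * ennreal (pair_weight y) \<partial>lborel)"
    by (rule nn_integral_polar[symmetric]) measurable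
  finally show ?thesis unfolding G'_def .
qed

subsection \<open>Permutation invariance\<close>

interpretation circle3: pair_sigma_finite circle_measure "circle_measure \<Otimes>\<^sub>M circle_measure" ..

interpretation circle4: pair_sigma_finite circle_measure
  "circle_measure \<Otimes>\<^sub>M circle_measure \<Otimes>\<^sub>M circle_measure" ..

lemma circle6_eq: "circle6 = circle_measure \<Otimes>\<^sub>M circle_measure \<Otimes>\<^sub>M circle_measure
    \<Otimes>\<^sub>M circle_measure \<Otimes>\<^sub>M circle_measure \<Otimes>\<^sub>M circle_measure"
  unfolding circle6_def circle4_def ..

lemma nn_integral_circle4:
  assumes "H \<in> borel_measurable circle4"
  shows "(\<integral>\<^sup>+x. H x \<partial>circle4) = (\<integral>\<^sup>+w1. \<integral>\<^sup>+w2. \<integral>\<^sup>+w3. \<integral>\<^sup>+w4. H (w1, w2, w3, w4)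
    \<partial>circle_measure \<partial>circle_measure \<partial>circle_measure \<partial>circle_measure)"
proof -
  have [measurable]: "H \<in> borel_measurable
      (circle_measure \<Otimes>\<^sub>M circle_measure \<Otimes>\<^sub>M circle_measure \<Otimes>\<^sub>M circle_measure)"
    using assms unfolding circle4_def .
  have "(\<integral>\<^sup>+x. H x \<partial>circle4) = (\<integral>\<^sup>+w1. \<integral>\<^sup>+p. H (w1, p)
      \<partial>(circle_measure \<Otimes>\<^sub>M circle_measure \<Otimes>\<^sub>M circle_measure) \<partial>circle_measure)"
    unfolding circle4_def by (rule circle3.nn_integral_fst[symmetric]) measurable
  also have "\<dots> = (\<integral>\<^sup>+w1. \<integral>\<^sup>+w2. \<integral>\<^sup>+p. H (w1, w2, p)
      \<partial>(circle_measure \<Otimes>\<^sub>M circle_measure) \<partial>circle_measure \<partial>circle_measure)"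
    by (intro nn_integral_cong circle_pair.nn_integral_fst[symmetric]) measurable
  also have "\<dots> = (\<integral>\<^sup>+w1. \<integral>\<^sup>+w2. \<integral>\<^sup>+w3. \<integral>\<^sup>+w4. H (w1, w2, w3, w4)
    \<partial>circle_measure \<partial>circle_measure \<partial>circle_measure \<partial>circle_measure)"
    by (intro nn_integral_cong circle.nn_integral_fst[symmetric]) measurable
  finally show ?thesis .
qed

lemma nn_integral_circle4_swap:
  assumes "H \<in> borel_measurable circle4"
  shows "(\<integral>\<^sup>+(w1, w2, w3, w4). H (w2, w1, w3, w4) \<partial>circle4) = (\<integral>\<^sup>+x. H x \<partial>circle4)"
    and "(\<integral>\<^sup>+(w1, w2, w3, w4). H (w1, w3, w2, w4) \<partial>circle4) = (\<integral>\<^sup>+x. H x \<partial>circle4)"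
    and "(\<integral>\<^sup>+(w1, w2, w3, w4). H (w1, w2, w4, w3) \<partial>circle4) = (\<integral>\<^sup>+x. H x \<partial>circle4)"
proof -
  have [measurable]: "H \<in> borel_measurable
      (circle_measure \<Otimes>\<^sub>M circle_measure \<Otimes>\<^sub>M circle_measure \<Otimes>\<^sub>M circle_measure)"
    using assms unfolding circle4_def .
  have m: "(\<lambda>(w1, w2, w3, w4). H (w2, w1, w3, w4)) \<in> borel_measurable circle4"
    "(\<lambda>(w1, w2, w3, w4). H (w1, w3, w2, w4)) \<in> borel_measurable circle4"
    "(\<lambda>(w1, w2, w3, w4). H (w1, w2, w4, w3)) \<in> borel_measurable circle4"
    unfolding circle4_def by measurable
  show "(\<integral>\<^sup>+(w1, w2, w3, w4). H (w2, w1, w3, w4) \<partial>circle4) = (\<integral>\<^sup>+x. H x \<partial>circle4)"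
    by (simp add: nn_integral_circle4[OF m(1)] nn_integral_circle4[OF assms])
       (rule circle_pair.Fubini', measurable)
  show "(\<integral>\<^sup>+(w1, w2, w3, w4). H (w1, w3, w2, w4) \<partial>circle4) = (\<integral>\<^sup>+x. H x \<partial>circle4)"
    by (simp add: nn_integral_circle4[OF m(2)] nn_integral_circle4[OF assms])
       (rule nn_integral_cong, rule circle_pair.Fubini', measurable)
  show "(\<integral>\<^sup>+(w1, w2, w3, w4). H (w1, w2, w4, w3) \<partial>circle4) = (\<integral>\<^sup>+x. H x \<partial>circle4)"
    by (simp add: nn_integral_circle4[OF m(3)] nn_integral_circle4[OF assms])
       (rule nn_integral_cong, rule nn_integral_cong, rule circle_pair.Fubini', measurable)
qed

definition delta6_invariant :: "(complex6 \<Rightarrow> complex6) \<Rightarrow> bool" where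
  "delta6_invariant \<tau> \<longleftrightarrow> \<tau> \<in> circle6 \<rightarrow>\<^sub>M circle6 \<and>
    (\<forall>F \<in> borel_measurable circle6. (\<integral>\<^sup>+x. F (\<tau> x) \<partial>delta6) = (\<integral>\<^sup>+x. F x \<partial>delta6 :: ennreal))"

lemma delta6_invariant_comp:
  assumes "delta6_invariant \<tau>" "delta6_invariant \<rho>"
  shows "delta6_invariant (\<lambda>x. \<tau> (\<rho> x))"
  unfolding delta6_invariant_def
proof (intro conjI ballI)
  show "(\<lambda>x. \<tau> (\<rho> x)) \<in> circle6 \<rightarrow>\<^sub>M circle6"
    using assms by (auto simp: delta6_invariant_def intro: measurable_compose)
  fix F :: "complex6 \<Rightarrow> ennreal" assume F: "F \<in> borel_measurable circle6"
  then have "(\<lambda>x. F (\<tau> x)) \<in> borel_measurable circle6"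
    using assms by (auto simp: delta6_invariant_def intro: measurable_compose)
  then have "(\<integral>\<^sup>+x. F (\<tau> (\<rho> x)) \<partial>delta6) = (\<integral>\<^sup>+x. F (\<tau> x) \<partial>delta6)"
    using assms(2) unfolding delta6_invariant_def
    by (auto dest: bspec[where x="\<lambda>x. F (\<tau> x)"])
  also have "\<dots> = (\<integral>\<^sup>+x. F x \<partial>delta6)"
    using assms(1) F unfolding delta6_invariant_def by blast
  finally show "(\<integral>\<^sup>+x. F (\<tau> (\<rho> x)) \<partial>delta6) = (\<integral>\<^sup>+x. F x \<partial>delta6)" .
qed

text \<open>Together these generate all permutations of the six points: three adjacent swaps of the
  four free points, the exchange of the two determined points, and one double transposition carrying
  free points to determined ones.\<close>

definition swap12 :: "complex6 \<Rightarrow> complex6" where "swap12 = (\<lambda>(a, b, c, d, e, f). (b, a, c, d, e, f))"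
definition swap23 :: "complex6 \<Rightarrow> complex6" where "swap23 = (\<lambda>(a, b, c, d, e, f). (a, c, b, d, e, f))"
definition swap34 :: "complex6 \<Rightarrow> complex6" where "swap34 = (\<lambda>(a, b, c, d, e, f). (a, b, d, c, e, f))"
definition swap56 :: "complex6 \<Rightarrow> complex6" where "swap56 = (\<lambda>(a, b, c, d, e, f). (a, b, c, d, f, e))"
definition swap3546 :: "complex6 \<Rightarrow> complex6" where "swap3546 = (\<lambda>(a, b, c, d, e, f). (a, b, e, f, c, d))"

lemma swaps_measurable:
  "swap12 \<in> circle6 \<rightarrow>\<^sub>M circle6" "swap23 \<in> circle6 \<rightarrow>\<^sub>M circle6" "swap34 \<in> circle6 \<rightarrow>\<^sub>M circle6"
  "swap56 \<in> circle6 \<rightarrow>\<^sub>M circle6" "swap3546 \<in> circle6 \<rightarrow>\<^sub>M circle6"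
  unfolding swap12_def swap23_def swap34_def swap56_def swap3546_def circle6_eq by measurable

lemma lift_integrand_measurable:
  fixes F :: "complex6 \<Rightarrow> ennreal"
  assumes "F \<in> borel_measurable circle6"
  shows "(\<lambda>x. (F (lift1 x) + F (lift2 x)) * ennreal (pair_weight (neg_sum4 x))) \<in> borel_measurable circle4"
  using assms by measurable

lemma lift_eq:
  "lift1 (a, b, c, d) = (a, b, c, d, first_pt (neg_sum4 (a, b, c, d)), second_pt (neg_sum4 (a, b, c, d)))"
  "lift2 (a, b, c, d) = (a, b, c, d, second_pt (neg_sum4 (a, b, c, d)), first_pt (neg_sum4 (a, b, c, d)))"
  by (simp_all add: lift1_def lift2_def neg_sum4_def)

text \<open>A permutation of the free points preserves their sum and therefore the determined pair.
  Exchanging the determined points exchanges \<open>lift1\<close> and \<open>lift2\<close>, which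
  enter the integral symmetrically.\<close>

lemma delta6_invariant_swap12: "delta6_invariant swap12"
  and delta6_invariant_swap23: "delta6_invariant swap23"
  and delta6_invariant_swap34: "delta6_invariant swap34"
  and delta6_invariant_swap56: "delta6_invariant swap56"
proof -
  have *: "delta6_invariant \<tau>"
    if \<tau>: "\<tau> \<in> circle6 \<rightarrow>\<^sub>M circle6"
    and \<rho>: "\<And>H. H \<in> borel_measurable circle4 \<Longrightarrow> (\<integral>\<^sup>+x. H (\<rho> x) \<partial>circle4) = (\<integral>\<^sup>+x. H x \<partial>circle4 :: ennreal)"
    and l: "\<And>x. (\<tau> (lift1 x), \<tau> (lift2 x)) = (lift1 (\<rho> x), lift2 (\<rho> x))
       \<or> (\<tau> (lift1 x), \<tau> (lift2 x)) = (lift2 (\<rho> x), lift1 (\<rho> x))"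
      "\<And>x. neg_sum4 (\<rho> x) = neg_sum4 x" for \<tau> \<rho>
    unfolding delta6_invariant_def
  proof (intro conjI ballI \<tau>)
    fix F :: "complex6 \<Rightarrow> ennreal" assume F: "F \<in> borel_measurable circle6"
    let ?H = "\<lambda>x. (F (lift1 x) + F (lift2 x)) * ennreal (pair_weight (neg_sum4 x))"
    have "(\<integral>\<^sup>+x. F (\<tau> x) \<partial>delta6) = (\<integral>\<^sup>+x. (F (\<tau> (lift1 x)) + F (\<tau> (lift2 x)))
        * ennreal (pair_weight (neg_sum4 x)) \<partial>circle4)"
      by (rule nn_integral_delta6_lift) (rule measurable_compose[OF \<tau> F])
    also have "\<dots> = (\<integral>\<^sup>+x. ?H (\<rho> x) \<partial>circle4)"
    proof (rule nn_integral_cong)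
      fix x
      show "(F (\<tau> (lift1 x)) + F (\<tau> (lift2 x))) * ennreal (pair_weight (neg_sum4 x)) = ?H (\<rho> x)"
        using l(1)[of x] l(2)[of x] by (auto simp: add.commute)
    qed
    also have "\<dots> = (\<integral>\<^sup>+x. ?H x \<partial>circle4)"
      by (rule \<rho>[OF lift_integrand_measurable[OF F]])
    also have "\<dots> = (\<integral>\<^sup>+x. F x \<partial>delta6)"
      by (rule nn_integral_delta6_lift[symmetric, OF F])
    finally show "(\<integral>\<^sup>+x. F (\<tau> x) \<partial>delta6) = (\<integral>\<^sup>+x. F x \<partial>delta6)" .
  qed
  have perm: "neg_sum4 (b, a, c, d) = neg_sum4 (a, b, c, d)" "neg_sum4 (a, c, b, d) = neg_sum4 (a, b, c, d)"
    "neg_sum4 (a, b, d, c) = neg_sum4 (a, b, c, d)" for a b c d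
    by (simp_all add: neg_sum4_def algebra_simps)
  show "delta6_invariant swap12"
  proof (rule *[where \<rho>="\<lambda>(a, b, c, d). (b, a, c, d)"])
    show "(\<integral>\<^sup>+x. H (case x of (a, b, c, d) \<Rightarrow> (b, a, c, d)) \<partial>circle4) = (\<integral>\<^sup>+x. H x \<partial>circle4)"
      if "H \<in> borel_measurable circle4" for H :: "complex4 \<Rightarrow> ennreal"
      using nn_integral_circle4_swap(1)[OF that] by (simp add: case_prod_beta')
  qed (rule swaps_measurable, auto simp: lift_eq perm swap12_def split: prod.split)
  show "delta6_invariant swap23"
  proof (rule *[where \<rho>="\<lambda>(a, b, c, d). (a, c, b, d)"])
    show "(\<integral>\<^sup>+x. H (case x of (a, b, c, d) \<Rightarrow> (a, c, b, d)) \<partial>circle4) = (\<integral>\<^sup>+x. H x \<partial>circle4)"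
      if "H \<in> borel_measurable circle4" for H :: "complex4 \<Rightarrow> ennreal"
      using nn_integral_circle4_swap(2)[OF that] by (simp add: case_prod_beta')
  qed (rule swaps_measurable, auto simp: lift_eq perm swap23_def split: prod.split)
  show "delta6_invariant swap34"
  proof (rule *[where \<rho>="\<lambda>(a, b, c, d). (a, b, d, c)"])
    show "(\<integral>\<^sup>+x. H (case x of (a, b, c, d) \<Rightarrow> (a, b, d, c)) \<partial>circle4) = (\<integral>\<^sup>+x. H x \<partial>circle4)"
      if "H \<in> borel_measurable circle4" for H :: "complex4 \<Rightarrow> ennreal"
      using nn_integral_circle4_swap(3)[OF that] by (simp add: case_prod_beta')
  qed (rule swaps_measurable, auto simp: lift_eq perm swap34_def split: prod.split)
  show "delta6_invariant swap56"
    by (rule *[where \<rho>="\<lambda>x. x"]) (rule swaps_measurable, auto simp: lift_eq swap56_def split: prod.split)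
qed

lemma nn_integral_lborel_reflect:
  fixes H :: "complex \<Rightarrow> ennreal"
  assumes [measurable]: "H \<in> borel_measurable borel"
  shows "(\<integral>\<^sup>+y. H (c - y) \<partial>lborel) = (\<integral>\<^sup>+y. H y \<partial>lborel)"
proof -
  have "(lborel :: complex measure) = distr lborel borel (\<lambda>y. c - y)"
    using lborel_affine[of "-1" c] by (simp add: density_1)
  then have "(\<integral>\<^sup>+y. H y \<partial>lborel) = (\<integral>\<^sup>+y. H y \<partial>distr lborel borel (\<lambda>y. c - y))" by simp
  also have "\<dots> = (\<integral>\<^sup>+y. H (c - y) \<partial>lborel)" by (rule nn_integral_distr) measurable
  finally show ?thesis ..
qed

lemma pts_add: "pair_weight y \<noteq> 0 \<Longrightarrow> first_pt y + second_pt y = y"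
  by (auto simp: pair_weight_def second_pt_def split: if_splits)

text \<open>Disintegrating the pairs \<open>(3, 4)\<close> and \<open>(5, 6)\<close> over their sums turns this exchange into a
  reflection of the plane; it is the only symmetry mixing the parameters with the determined pair.\<close>

lemma delta6_invariant_swap3546: "delta6_invariant swap3546"
  unfolding delta6_invariant_def
proof (intro conjI ballI swaps_measurable)
  have key: "(\<integral>\<^sup>+x. F x \<partial>delta6) = (\<integral>\<^sup>+w1. \<integral>\<^sup>+w2. \<integral>\<^sup>+y.
      (F (w1, w2, first_pt y, second_pt y, first_pt (- (w1 + w2) - y), second_pt (- (w1 + w2) - y))
      + F (w1, w2, first_pt y, second_pt y, second_pt (- (w1 + w2) - y), first_pt (- (w1 + w2) - y))
      + F (w1, w2, second_pt y, first_pt y, first_pt (- (w1 + w2) - y), second_pt (- (w1 + w2) - y))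
      + F (w1, w2, second_pt y, first_pt y, second_pt (- (w1 + w2) - y), first_pt (- (w1 + w2) - y)))
      * ennreal (pair_weight (- (w1 + w2) - y)) * ennreal (pair_weight y)
      \<partial>lborel \<partial>circle_measure \<partial>circle_measure)"
    if F: "F \<in> borel_measurable circle6" for F :: "complex6 \<Rightarrow> ennreal"
  proof -
    let ?H = "\<lambda>x. (F (lift1 x) + F (lift2 x)) * ennreal (pair_weight (neg_sum4 x))"
    have [measurable]: "?H \<in> borel_measurable
        (circle_measure \<Otimes>\<^sub>M circle_measure \<Otimes>\<^sub>M circle_measure \<Otimes>\<^sub>M circle_measure)"
      using lift_integrand_measurable[OF F] unfolding circle4_def .
    have "(\<integral>\<^sup>+x. F x \<partial>delta6) = (\<integral>\<^sup>+x. ?H x \<partial>circle4)"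
      by (rule nn_integral_delta6_lift[OF F])
    also have "\<dots> = (\<integral>\<^sup>+w1. \<integral>\<^sup>+w2. \<integral>\<^sup>+w3. \<integral>\<^sup>+w4. ?H (w1, w2, w3, w4)
        \<partial>circle_measure \<partial>circle_measure \<partial>circle_measure \<partial>circle_measure)"
      by (rule nn_integral_circle4[OF lift_integrand_measurable[OF F]])
    also have "\<dots> = (\<integral>\<^sup>+w1. \<integral>\<^sup>+w2. \<integral>\<^sup>+y. (?H (w1, w2, first_pt y, second_pt y)
        + ?H (w1, w2, second_pt y, first_pt y)) * ennreal (pair_weight y)
        \<partial>lborel \<partial>circle_measure \<partial>circle_measure)"
    proof (rule nn_integral_cong, rule nn_integral_cong)
      fix w1 w2 assume [measurable]: "w1 \<in> space circle_measure" "w2 \<in> space circle_measure"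
      show "(\<integral>\<^sup>+w3. \<integral>\<^sup>+w4. ?H (w1, w2, w3, w4) \<partial>circle_measure \<partial>circle_measure)
        = (\<integral>\<^sup>+y. (?H (w1, w2, first_pt y, second_pt y)
        + ?H (w1, w2, second_pt y, first_pt y)) * ennreal (pair_weight y) \<partial>lborel)"
        by (rule nn_integral_circle_circle[of "\<lambda>p. ?H (w1, w2, p)"])
           (rule measurable_compose[OF _ \<open>?H \<in> _\<close>], measurable)
    qed
    also have "\<dots> = (\<integral>\<^sup>+w1. \<integral>\<^sup>+w2. \<integral>\<^sup>+y.
      (F (w1, w2, first_pt y, second_pt y, first_pt (- (w1 + w2) - y), second_pt (- (w1 + w2) - y))
      + F (w1, w2, first_pt y, second_pt y, second_pt (- (w1 + w2) - y), first_pt (- (w1 + w2) - y))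
      + F (w1, w2, second_pt y, first_pt y, first_pt (- (w1 + w2) - y), second_pt (- (w1 + w2) - y))
      + F (w1, w2, second_pt y, first_pt y, second_pt (- (w1 + w2) - y), first_pt (- (w1 + w2) - y)))
      * ennreal (pair_weight (- (w1 + w2) - y)) * ennreal (pair_weight y)
      \<partial>lborel \<partial>circle_measure \<partial>circle_measure)"
    proof (rule nn_integral_cong, rule nn_integral_cong, rule nn_integral_cong)
      fix w1 w2 y
      show "(?H (w1, w2, first_pt y, second_pt y) + ?H (w1, w2, second_pt y, first_pt y)) * ennreal (pair_weight y)
       = (F (w1, w2, first_pt y, second_pt y, first_pt (- (w1 + w2) - y), second_pt (- (w1 + w2) - y))
      + F (w1, w2, first_pt y, second_pt y, second_pt (- (w1 + w2) - y), first_pt (- (w1 + w2) - y))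
      + F (w1, w2, second_pt y, first_pt y, first_pt (- (w1 + w2) - y), second_pt (- (w1 + w2) - y))
      + F (w1, w2, second_pt y, first_pt y, second_pt (- (w1 + w2) - y), first_pt (- (w1 + w2) - y)))
      * ennreal (pair_weight (- (w1 + w2) - y)) * ennreal (pair_weight y)"
      proof (cases "pair_weight y = 0")
        case False
        have e: "- (w1 + w2 + first_pt y + second_pt y) = - (w1 + w2) - y"
          "- (w1 + w2 + second_pt y + first_pt y) = - (w1 + w2) - y"
          using pts_add[OF False] by (simp_all add: algebra_simps)
        show ?thesis
          unfolding lift1_def lift2_def neg_sum4_def prod.case e by (simp only: distrib_right add.assoc)
      qed simp
    qed
    finally show ?thesis .
  qed
  fix F :: "complex6 \<Rightarrow> ennreal" assume F: "F \<in> borel_measurable circle6"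
  have [measurable]: "F \<in> borel_measurable (circle_measure \<Otimes>\<^sub>M circle_measure \<Otimes>\<^sub>M circle_measure
    \<Otimes>\<^sub>M circle_measure \<Otimes>\<^sub>M circle_measure \<Otimes>\<^sub>M circle_measure)"
    using F unfolding circle6_eq .
  show "(\<integral>\<^sup>+x. F (swap3546 x) \<partial>delta6) = (\<integral>\<^sup>+x. F x \<partial>delta6)"
    unfolding key[OF F] key[OF measurable_compose[OF swaps_measurable(5) F]]
  proof (rule nn_integral_cong, rule nn_integral_cong)
    fix w1 w2 assume [measurable]: "w1 \<in> space circle_measure" "w2 \<in> space circle_measure"
    let ?c = "- (w1 + w2)"
    let ?T = "\<lambda>y. (F (w1, w2, first_pt y, second_pt y, first_pt (?c - y), second_pt (?c - y))
      + F (w1, w2, first_pt y, second_pt y, second_pt (?c - y), first_pt (?c - y))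
      + F (w1, w2, second_pt y, first_pt y, first_pt (?c - y), second_pt (?c - y))
      + F (w1, w2, second_pt y, first_pt y, second_pt (?c - y), first_pt (?c - y)))
      * ennreal (pair_weight (?c - y)) * ennreal (pair_weight y)"
    have "?T \<in> borel_measurable borel" by measurable
    note R = nn_integral_lborel_reflect[OF this, of ?c, symmetric]
    show "(\<integral>\<^sup>+y. (F (swap3546 (w1, w2, first_pt y, second_pt y, first_pt (?c - y), second_pt (?c - y)))
      + F (swap3546 (w1, w2, first_pt y, second_pt y, second_pt (?c - y), first_pt (?c - y)))
      + F (swap3546 (w1, w2, second_pt y, first_pt y, first_pt (?c - y), second_pt (?c - y)))
      + F (swap3546 (w1, w2, second_pt y, first_pt y, second_pt (?c - y), first_pt (?c - y))))
      * ennreal (pair_weight (?c - y)) * ennreal (pair_weight y) \<partial>lborel) = (\<integral>\<^sup>+y. ?T y \<partial>lborel)"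
      unfolding R
      by (rule nn_integral_cong) (simp add: swap3546_def add_ac mult_ac)
  qed
qed

subsection \<open>Boundedness of the weighted triple convolution\<close>

lemma borel_measurable_on_circle:
  "f \<in> borel_measurable borel \<Longrightarrow> f \<in> borel_measurable circle_measure"
  by (rule measurable_compose[OF circle_measurable_id])

text \<open>Separates the singularities at |y| = 0 and |y| = 2. With a = |y| and b = sqrt (4 - a^2)
  one has a^2 + b^2 = 4, hence a + b >= 2, and so 2/(a b) <= (a + b)/(a b) = 1/a + 1/b.\<close>

lemma pair_weight_le:
  "pair_weight y \<le> 1 / norm y + (if norm y < 2 then 1 / sqrt (4 - (norm y)\<^sup>2) else 0)"
proof (cases "0 < norm y \<and> norm y < 2")
  case True
  define a where "a = norm y"
  define b where "b = sqrt (4 - a\<^sup>2)"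
  have a: "0 < a" "a < 2" using True by (auto simp: a_def)
  have "a\<^sup>2 < 2\<^sup>2" using a by (intro power_strict_mono) auto
  then have b: "b > 0" "b\<^sup>2 = 4 - a\<^sup>2" by (auto simp: b_def)
  have "2\<^sup>2 \<le> (a + b)\<^sup>2" using b a by (simp add: power2_sum)
  then have "2 \<le> a + b" using a b by (intro power2_le_imp_le[of 2 "a + b"]) auto
  then have "2 / (a * b) \<le> 1 / a + 1 / b"
    using a b by (simp add: field_simps)
  then show ?thesis using True by (simp add: pair_weight_def a_def b_def)
next
  case False
  then have "pair_weight y = 0" by (auto simp: pair_weight_def)
  moreover have "(norm y)\<^sup>2 \<le> 2\<^sup>2" if "norm y < 2" using that by (intro power_mono) auto
  ultimately show ?thesis by (auto intro!: add_nonneg_nonneg)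
qed

text \<open>With r = (2/q) sin (t/2) the integrand becomes 2 / sqrt (4 - r^2) on [0, 2), whatever q
  is. This uniformity in q gives the uniform constant in
  \<open>nn_integral_outer_part\<close>.\<close>

lemma nn_integral_arcsin_density:
  assumes q: "0 < q" "q < (1::real)"
  shows "(\<integral>\<^sup>+t. ennreal (if sin (t / 2) < q then cos (t / 2) / sqrt (q\<^sup>2 - (sin (t / 2))\<^sup>2) else 0)
    * indicator {0..pi} t \<partial>lborel) = ennreal pi"
proof -
  let ?F = "\<lambda>r. ennreal (2 / sqrt (4 - r\<^sup>2)) * indicator {..<2} r"
  have "ennreal pi = (\<integral>\<^sup>+s. 1 * indicator {0..pi} s \<partial>lborel)" by simp
  also have "\<dots> = (\<integral>\<^sup>+r. 1 * ennreal (2 / sqrt (4 - r\<^sup>2)) * indicator {0..2} r \<partial>lborel)"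
    by (rule nn_integral_two_sin) simp
  also have "\<dots> = (\<integral>\<^sup>+r. ?F r * indicator {2 / q * sin (0 / 2)..2 / q * sin (pi / 2)} r \<partial>lborel)"
    using AE_lborel_singleton[of "2::real"]
  proof (intro nn_integral_cong_AE, eventually_elim)
    fix r :: real assume "r \<noteq> 2"
    moreover have "q * r \<le> 1 * 2" if "0 \<le> r" "r \<le> 2" using q that by (intro mult_mono) auto
    ultimately show "1 * ennreal (2 / sqrt (4 - r\<^sup>2)) * indicator {0..2} r
      = ?F r * indicator {2 / q * sin (0 / 2)..2 / q * sin (pi / 2)} r"
      using q by (auto split: split_indicator simp: field_simps)
  qed
  also have "\<dots> = (\<integral>\<^sup>+t. ?F (2 / q * sin (t / 2)) * ennreal (cos (t / 2) / q) * indicator {0..pi} t \<partial>lborel)"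
  proof (rule nn_integral_substitution_aux)
    show "cos (s / 2) / q \<ge> 0" if "s \<in> {0..pi}" for s
      using that q by (intro divide_nonneg_pos cos_ge_zero) (auto simp: field_simps)
    show "((\<lambda>s. 2 / q * sin (s / 2)) has_real_derivative cos (s / 2) / q) (at s)" for s
      using q by (auto intro!: derivative_eq_intros)
    show "continuous_on {0..pi} (\<lambda>s. cos (s / 2) / q)" using q by (intro continuous_intros) auto
  qed auto
  also have "\<dots> = (\<integral>\<^sup>+t. ennreal (if sin (t / 2) < q then cos (t / 2) / sqrt (q\<^sup>2 - (sin (t / 2))\<^sup>2) else 0)
    * indicator {0..pi} t \<partial>lborel)"
  proof (rule nn_integral_cong)
    fix t :: real
    show "?F (2 / q * sin (t / 2)) * ennreal (cos (t / 2) / q) * indicator {0..pi} t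
      = ennreal (if sin (t / 2) < q then cos (t / 2) / sqrt (q\<^sup>2 - (sin (t / 2))\<^sup>2) else 0) * indicator {0..pi} t"
    proof (cases "t \<in> {0..pi} \<and> sin (t / 2) < q")
      case True
      have c: "cos (t / 2) \<ge> 0" using True by (intro cos_ge_zero) (auto simp: field_simps)
      have s: "sin (t / 2) \<ge> 0" using True by (intro sin_ge_zero) (auto simp: field_simps)
      have "(sin (t / 2))\<^sup>2 < q\<^sup>2" using True s by (intro power_strict_mono) auto
      have "4 - (2 / q * sin (t / 2))\<^sup>2 = (2 / q)\<^sup>2 * (q\<^sup>2 - (sin (t / 2))\<^sup>2)"
        using q by (simp add: field_simps power2_eq_square)
      then have "sqrt (4 - (2 / q * sin (t / 2))\<^sup>2) = 2 / q * sqrt (q\<^sup>2 - (sin (t / 2))\<^sup>2)"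
        using q by (simp add: real_sqrt_mult)
      then have "2 / sqrt (4 - (2 / q * sin (t / 2))\<^sup>2) * (cos (t / 2) / q)
        = cos (t / 2) / sqrt (q\<^sup>2 - (sin (t / 2))\<^sup>2)"
        using q by simp
      moreover have "2 / q * sin (t / 2) < 2" using True q by (simp add: field_simps)
      moreover have "0 \<le> 2 / sqrt (4 - (2 / q * sin (t / 2))\<^sup>2)"
        using \<open>sqrt (4 - _) = _\<close> \<open>_ < q\<^sup>2\<close> q by simp
      ultimately show ?thesis using True c q by (simp add: ennreal_mult[symmetric] del: times_divide_eq_left)
    next
      case False
      then show ?thesis using q by (auto split: split_indicator simp: field_simps)
    qed
  qed
  finally show ?thesis ..
qed

text \<open>The delicate case: for 1 < r < 3 the circle of radius 2 about r crosses the unit circle,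
  and the integrand has an inverse square root singularity at the crossings. By 4 - |r - cis t|^2 =
  4 r (q^2 - sin^2 (t/2)) it is at most 1/k times the density of
  \<open>nn_integral_arcsin_density\<close>.\<close>

lemma nn_integral_outer_part:
  assumes r: "1 < r" "r < (3::real)"
  shows "ennreal (r\<^sup>2 - 1) * (\<integral>\<^sup>+w. ennreal (if norm (of_real r - w) < 2 then 1 / sqrt (4 - (norm (of_real r - w))\<^sup>2) else 0)
    \<partial>circle_measure) \<le> ennreal (8 * pi)"
proof -
  let ?f = "\<lambda>w::complex. ennreal (if norm (of_real r - w) < 2 then 1 / sqrt (4 - (norm (of_real r - w))\<^sup>2) else 0)"
  have [measurable]: "?f \<in> borel_measurable borel" by measurable
  have fC: "?f \<in> borel_measurable circle_measure"
    using measurable_compose[OF circle_measurable_id \<open>?f \<in> borel_measurable borel\<close>] .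
  have [measurable]: "cis \<in> borel_measurable borel"
    by (intro borel_measurable_continuous_onI continuous_intros)
  \<comment> \<open>The crossings with the circle of radius 2 are at the angles t with sin (t/2)
    equal to \<open>q\<close> up to sign.\<close>
  define q where "q = sqrt ((3 - r) * (1 + r) / (4 * r))"
  have q2: "q\<^sup>2 = (3 - r) * (1 + r) / (4 * r)" using r by (simp add: q_def)
  have q2': "1 - q\<^sup>2 = (r + 3) * (r - 1) / (4 * r)" unfolding q2 using r by (simp add: field_simps)
  have "q\<^sup>2 < 1" using q2' r by (smt (verit) divide_pos_pos mult_pos_pos)
  then have q: "0 < q" "q < 1" using r 
    by (auto simp: q_def power2_eq_square abs_square_less_1 real_sqrt_lt_1_iff)
  \<comment> \<open>\<open>k\<close> is 2 sqrt r sqrt (1 - q^2), the lower bound of 2 sqrt r cos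
    (t/2) on the arc sin (t/2) < q. It inserts the numerator cos (t/2) that the arcsine density
    needs.\<close>
  define k where "k = sqrt ((r + 3) * (r - 1))"
  have k: "k > 0" "k\<^sup>2 = (r + 3) * (r - 1)" using r by (auto simp: k_def)
  have cis_norm: "4 - (norm (of_real r - cis t))\<^sup>2 = 4 * r * (q\<^sup>2 - (sin (t / 2))\<^sup>2)" for t
  proof -
    have "(norm (of_real r - cis t))\<^sup>2 = (r - cos t)\<^sup>2 + (sin t)\<^sup>2"
      by (simp add: cmod_power2)
    also have "\<dots> = r\<^sup>2 + 1 - 2 * r * cos t"
      using sin_cos_squared_add[of t] by (simp add: power2_diff)
    also have "cos t = 1 - 2 * (sin (t / 2))\<^sup>2" using cos_double_sin[of "t / 2"] by simp
    finally have "4 - (norm (of_real r - cis t))\<^sup>2 = (3 - r) * (1 + r) - 4 * r * (sin (t / 2))\<^sup>2"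
      by (simp add: algebra_simps power2_eq_square)
    moreover have "4 * r * q\<^sup>2 = (3 - r) * (1 + r)" unfolding q2 using r by simp
    ultimately show ?thesis by (simp add: right_diff_distrib)
  qed
  have pt: "?f (cis t) * indicator {0..pi} t \<le> ennreal (1 / k) *
      (ennreal (if sin (t / 2) < q then cos (t / 2) / sqrt (q\<^sup>2 - (sin (t / 2))\<^sup>2) else 0) * indicator {0..pi} t)" for t
  proof (cases "t \<in> {0..pi} \<and> norm (of_real r - cis t) < 2")
    case True
    have c: "cos (t / 2) \<ge> 0" using True by (intro cos_ge_zero) (auto simp: field_simps)
    have s: "sin (t / 2) \<ge> 0" using True by (intro sin_ge_zero) (auto simp: field_simps)
    define d where "d = sqrt (q\<^sup>2 - (sin (t / 2))\<^sup>2)"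
    have "(norm (of_real r - cis t))\<^sup>2 < 2\<^sup>2" using True by (intro power_strict_mono) auto
    then have "4 * r * (q\<^sup>2 - (sin (t / 2))\<^sup>2) > 0" using cis_norm[of t] by simp
    then have p: "(sin (t / 2))\<^sup>2 < q\<^sup>2" using r by (simp add: zero_less_mult_iff)
    then have sq: "sin (t / 2) < q" using q by (intro power2_less_imp_less[of _ q]) auto
    have d: "d > 0" using p by (simp add: d_def)
    have sq4: "sqrt (4 - (norm (of_real r - cis t))\<^sup>2) = 2 * sqrt r * d"
      unfolding cis_norm d_def using r by (simp add: real_sqrt_mult)
    have "k\<^sup>2 \<le> (2 * sqrt r * cos (t / 2))\<^sup>2"
    proof -
      have "(2 * sqrt r * cos (t / 2))\<^sup>2 = 4 * r * (cos (t / 2))\<^sup>2"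
        using r by (simp add: power_mult_distrib)
      moreover have "(cos (t / 2))\<^sup>2 \<ge> 1 - q\<^sup>2" using p by (simp add: cos_squared_eq)
      moreover have "4 * r * (1 - q\<^sup>2) = k\<^sup>2" unfolding q2' k using r by simp
      moreover have "4 * r * (1 - q\<^sup>2) \<le> 4 * r * (cos (t / 2))\<^sup>2"
        using r \<open>1 - q\<^sup>2 \<le> _\<close> by (intro mult_left_mono) auto
      ultimately show ?thesis by linarith
    qed
    then have "k \<le> 2 * sqrt r * cos (t / 2)" by (rule power2_le_imp_le) (use c r in simp)
    then have "k / (2 * sqrt r) \<le> cos (t / 2)"
      using r by (subst pos_divide_le_eq) (auto simp: mult.commute)
    then have "k / (2 * sqrt r) / (k * d) \<le> cos (t / 2) / (k * d)"
      using d k(1) by (intro divide_right_mono) auto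
    moreover have "k / (2 * sqrt r) / (k * d) = 1 / (2 * sqrt r * d)" using k(1) by simp
    moreover have "cos (t / 2) / (k * d) = 1 / k * (cos (t / 2) / d)" by simp
    ultimately have "1 / (2 * sqrt r * d) \<le> 1 / k * (cos (t / 2) / d)" by (simp only:)
    then have "ennreal (1 / (2 * sqrt r * d)) \<le> ennreal (1 / k * (cos (t / 2) / d))"
      by (rule ennreal_leI)
    also have "\<dots> = ennreal (1 / k) * ennreal (cos (t / 2) / d)"
      by (rule ennreal_mult) (use k(1) c d in simp_all)
    finally have "ennreal (1 / (2 * sqrt r * d)) \<le> ennreal (1 / k) * ennreal (cos (t / 2) / d)" .
    moreover have "?f (cis t) * indicator {0..pi} t = ennreal (1 / (2 * sqrt r * d))"
      using True by (simp only: sq4) simp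
    ultimately show ?thesis using True sq unfolding d_def by simp
  next
    case False then show ?thesis by auto
  qed
  have half: "(\<integral>\<^sup>+t. ?f (cis t) * indicator {0..pi} t \<partial>lborel) \<le> ennreal (pi / k)"
  proof -
    have "(\<integral>\<^sup>+t. ?f (cis t) * indicator {0..pi} t \<partial>lborel) \<le> (\<integral>\<^sup>+t. ennreal (1 / k) *
      (ennreal (if sin (t / 2) < q then cos (t / 2) / sqrt (q\<^sup>2 - (sin (t / 2))\<^sup>2) else 0) * indicator {0..pi} t) \<partial>lborel)"
      by (rule nn_integral_mono) (rule pt)
    also have "\<dots> = ennreal (1 / k) * ennreal pi"
      by (subst nn_integral_cmult) (simp_all only: nn_integral_arcsin_density[OF q], measurable)
    also have "\<dots> = ennreal (pi / k)" using k by (simp add: ennreal_mult[symmetric])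
    finally show ?thesis .
  qed
  have "(\<integral>\<^sup>+w. ?f w \<partial>circle_measure) = (\<integral>\<^sup>+t. ?f (cis t) * indicator {-pi..<-pi + 2 * pi} t \<partial>lborel)"
    by (rule nn_integral_circle_shift) (rule fC)
  also have "\<dots> \<le> (\<integral>\<^sup>+t. ?f (cis t) * indicator {0..pi} t + ?f (cis t) * indicator {-pi..0} t \<partial>lborel)"
    by (intro nn_integral_mono) (auto split: split_indicator)
  also have "\<dots> = (\<integral>\<^sup>+t. ?f (cis t) * indicator {0..pi} t \<partial>lborel) + (\<integral>\<^sup>+t. ?f (cis t) * indicator {-pi..0} t \<partial>lborel)"
    by (rule nn_integral_add) measurable
  also have "(\<integral>\<^sup>+t. ?f (cis t) * indicator {-pi..0} t \<partial>lborel) = (\<integral>\<^sup>+t. ?f (cis t) * indicator {0..pi} t \<partial>lborel)"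
  proof -
    have n: "norm (of_real r - cis (- t)) = norm (of_real r - cis t)" for t
      by (metis cis_cnj complex_cnj_complex_of_real complex_cnj_diff complex_mod_cnj)
    show ?thesis
      by (subst nn_integral_real_affine[where c="-1" and t=0])
         (measurable, auto intro!: nn_integral_cong split: split_indicator simp: n)
  qed
  also have "(\<integral>\<^sup>+t. ?f (cis t) * indicator {0..pi} t \<partial>lborel) + (\<integral>\<^sup>+t. ?f (cis t) * indicator {0..pi} t \<partial>lborel)
     \<le> ennreal (pi / k) + ennreal (pi / k)"
    by (intro add_mono half)
  also have "\<dots> = ennreal (2 * pi / k)" using k by (simp add: ennreal_plus[symmetric] del: ennreal_plus)
  finally have "ennreal (r\<^sup>2 - 1) * (\<integral>\<^sup>+w. ?f w \<partial>circle_measure) \<le> ennreal (r\<^sup>2 - 1) * ennreal (2 * pi / k)"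
    by (rule mult_left_mono) simp
  also have "\<dots> = ennreal ((r\<^sup>2 - 1) * (2 * pi / k))"
    using r k by (intro ennreal_mult[symmetric]) auto
  also have "\<dots> \<le> ennreal (8 * pi)"
  proof (rule ennreal_leI)
    \<comment> \<open>Near r = 1 the number \<open>k\<close> vanishes only like sqrt (r - 1),
      whereas r^2 - 1 vanishes linearly. So for r < 3 the latter is at most a multiple of
      \<open>k\<close>.\<close>
    have "((r\<^sup>2 - 1) / 4)\<^sup>2 \<le> k\<^sup>2"
    proof -
      have "k\<^sup>2 - ((r\<^sup>2 - 1) / 4)\<^sup>2 = (r - 1) * ((r + 3) - (r - 1) * (r + 1)\<^sup>2 / 16)"
        unfolding k by (simp add: power2_eq_square algebra_simps)
      moreover have "(r - 1) * (r + 1)\<^sup>2 \<le> 32"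
        using mult_mono[of "r - 1" 2 "(r + 1)\<^sup>2" "4\<^sup>2"] power_mono[of "r + 1" 4 2] r by simp
      then have "0 \<le> (r - 1) * ((r + 3) - (r - 1) * (r + 1)\<^sup>2 / 16)"
        using r by (intro mult_nonneg_nonneg) auto
      ultimately show ?thesis by linarith
    qed
    then have "(r\<^sup>2 - 1) / 4 \<le> k" by (rule power2_le_imp_le) (use k in simp)
    then have "(r\<^sup>2 - 1) * (2 * pi / k) \<le> 4 * k * (2 * pi / k)"
      using k(1) by (intro mult_right_mono) auto
    then show "(r\<^sup>2 - 1) * (2 * pi / k) \<le> 8 * pi" using k(1) by simp
  qed
  finally show ?thesis .
qed

text \<open>The integral is half the density at x of the triple convolution of arc length, singular
  at |x| = 1. Of the two terms of \<open>pair_weight_le\<close>, the first is at most 1 / ||x| - 1|.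
  The second is at most 1 / (1 - |x|) inside the unit disc and is treated by
  \<open>nn_integral_outer_part\<close> outside. Multiplied by the weight, each contributes at most
  8 pi.\<close>

lemma circle_kernel_bound:
  "ennreal \<bar>(norm x)\<^sup>2 - 1\<bar> * (\<integral>\<^sup>+w. ennreal (pair_weight (x - w)) \<partial>circle_measure) \<le> ennreal (16 * pi)"
proof (cases "norm x = 1 \<or> norm x \<ge> 3")
  case True
  have "(\<integral>\<^sup>+w. ennreal (pair_weight (x - w)) \<partial>circle_measure) = 0" if "norm x \<ge> 3"
  proof -
    have "(\<integral>\<^sup>+w. ennreal (pair_weight (x - w)) \<partial>circle_measure) = (\<integral>\<^sup>+w. 0 \<partial>circle_measure)"
    proof (rule nn_integral_cong)
      fix w assume "w \<in> space circle_measure"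
      then have "norm (x - w) \<ge> 2" using that norm_triangle_ineq2[of x w] by simp
      then show "ennreal (pair_weight (x - w)) = 0" by (simp add: pair_weight_def)
    qed
    then show ?thesis by simp
  qed
  with True show ?thesis by auto
next
  case False
  define r where "r = norm x"
  have r: "r \<noteq> 1" "0 \<le> r" "r < 3" using False by (auto simp: r_def)
  define e where "e = (if x = 0 then 1 else sgn x)"
  have e: "norm e = 1" "x = e * of_real r"
    by (simp_all add: e_def r_def norm_sgn) (simp add: sgn_div_norm scaleR_conv_of_real)
  let ?a = "\<lambda>w::complex. ennreal (1 / norm (of_real r - w))"
  let ?b = "\<lambda>w::complex. ennreal (if norm (of_real r - w) < 2 then 1 / sqrt (4 - (norm (of_real r - w))\<^sup>2) else 0)"
  have m: "(\<lambda>w. ennreal (pair_weight (x - w))) \<in> borel_measurable circle_measure"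
    "?a \<in> borel_measurable circle_measure" "?b \<in> borel_measurable circle_measure"
    by (rule borel_measurable_on_circle; measurable)+
  have "(\<integral>\<^sup>+w. ennreal (pair_weight (x - w)) \<partial>circle_measure) = (\<integral>\<^sup>+w. ennreal (pair_weight (x - e * w)) \<partial>circle_measure)"
    by (rule nn_integral_circle_rotate[OF m(1) e(1), symmetric])
  also have "\<dots> \<le> (\<integral>\<^sup>+w. ?a w + ?b w \<partial>circle_measure)"
  proof (rule nn_integral_mono)
    fix w
    have "norm (x - e * w) = norm (of_real r - w)"
      using e by (simp add: right_diff_distrib[symmetric] norm_mult)
    then show "ennreal (pair_weight (x - e * w)) \<le> ?a w + ?b w"
      using pair_weight_le[of "x - e * w"] power_mono[of "norm (of_real r - w)" 2 2]
      by (subst ennreal_plus[symmetric]) (auto intro!: ennreal_leI simp del: ennreal_plus)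
  qed
  also have "\<dots> = (\<integral>\<^sup>+w. ?a w \<partial>circle_measure) + (\<integral>\<^sup>+w. ?b w \<partial>circle_measure)"
    by (rule nn_integral_add) (rule m)+
  finally have "ennreal \<bar>r\<^sup>2 - 1\<bar> * (\<integral>\<^sup>+w. ennreal (pair_weight (x - w)) \<partial>circle_measure)
    \<le> ennreal \<bar>r\<^sup>2 - 1\<bar> * ((\<integral>\<^sup>+w. ?a w \<partial>circle_measure) + (\<integral>\<^sup>+w. ?b w \<partial>circle_measure))"
    by (rule mult_left_mono) simp
  also have "\<dots> = ennreal \<bar>r\<^sup>2 - 1\<bar> * (\<integral>\<^sup>+w. ?a w \<partial>circle_measure) + ennreal \<bar>r\<^sup>2 - 1\<bar> * (\<integral>\<^sup>+w. ?b w \<partial>circle_measure)"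
    by (rule distrib_left)
  also have "\<dots> \<le> ennreal (8 * pi) + ennreal (8 * pi)"
  proof (rule add_mono)
    have const: "(\<integral>\<^sup>+w. ennreal c \<partial>circle_measure) = ennreal (c * (2 * pi))" if "c \<ge> 0" for c
      using that by (simp add: emeasure_circle_measure_space[simplified] ennreal_mult)
    have "r\<^sup>2 - 1 = (r - 1) * (r + 1)" by (simp add: power2_eq_square algebra_simps)
    then have f: "\<bar>r\<^sup>2 - 1\<bar> = \<bar>r - 1\<bar> * (r + 1)"
      using r by (simp add: abs_mult)
    have "(\<integral>\<^sup>+w. ?a w \<partial>circle_measure) \<le> (\<integral>\<^sup>+w. ennreal (1 / \<bar>r - 1\<bar>) \<partial>circle_measure)"
    proof (rule nn_integral_mono)
      fix w assume "w \<in> space circle_measure"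
      then have "\<bar>r - 1\<bar> \<le> norm (of_real r - w)"
        using norm_triangle_ineq3[of "of_real r" w] r by simp
      then show "?a w \<le> ennreal (1 / \<bar>r - 1\<bar>)"
        using r by (intro ennreal_leI divide_left_mono mult_pos_pos) auto
    qed
    then have "ennreal \<bar>r\<^sup>2 - 1\<bar> * (\<integral>\<^sup>+w. ?a w \<partial>circle_measure) \<le> ennreal \<bar>r\<^sup>2 - 1\<bar> * ennreal (1 / \<bar>r - 1\<bar> * (2 * pi))"
      by (subst const[symmetric]) (auto intro: mult_left_mono)
    also have "\<dots> = ennreal (\<bar>r\<^sup>2 - 1\<bar> * (1 / \<bar>r - 1\<bar> * (2 * pi)))"
      by (intro ennreal_mult[symmetric]) auto
    also have "\<dots> \<le> ennreal (8 * pi)" using r unfolding f by (intro ennreal_leI) auto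
    finally show "ennreal \<bar>r\<^sup>2 - 1\<bar> * (\<integral>\<^sup>+w. ?a w \<partial>circle_measure) \<le> ennreal (8 * pi)" .
    show "ennreal \<bar>r\<^sup>2 - 1\<bar> * (\<integral>\<^sup>+w. ?b w \<partial>circle_measure) \<le> ennreal (8 * pi)"
    proof (cases "r < 1")
      case False
      then have "1 < r" using r by auto
      then have "\<bar>r\<^sup>2 - 1\<bar> = r\<^sup>2 - 1" by (simp add: power2_eq_square less_1_mult less_imp_le)
      then show ?thesis using nn_integral_outer_part[OF \<open>1 < r\<close> r(3)] by simp
    next
      case True
      have "(\<integral>\<^sup>+w. ?b w \<partial>circle_measure) \<le> (\<integral>\<^sup>+w. ennreal (1 / (1 - r)) \<partial>circle_measure)"
      proof (rule nn_integral_mono)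
        fix w assume "w \<in> space circle_measure"
        then have "norm (of_real r - w) \<le> 1 + r"
          using norm_triangle_ineq4[of "of_real r" w] r by simp
        then have "(norm (of_real r - w))\<^sup>2 \<le> (1 + r)\<^sup>2" by (intro power_mono) auto
        then have "(1 - r)\<^sup>2 \<le> 4 - (norm (of_real r - w))\<^sup>2"
          using True r by (simp add: power2_eq_square algebra_simps) (smt (verit) mult_left_le)
        then have "1 - r \<le> sqrt (4 - (norm (of_real r - w))\<^sup>2)" by (rule real_le_rsqrt)
        then have "1 / sqrt (4 - (norm (of_real r - w))\<^sup>2) \<le> 1 / (1 - r)"
          using True by (intro divide_left_mono mult_pos_pos) linarith+
        then show "?b w \<le> ennreal (1 / (1 - r))"
          using True by (auto intro!: ennreal_leI)
      qed
      then have "ennreal \<bar>r\<^sup>2 - 1\<bar> * (\<integral>\<^sup>+w. ?b w \<partial>circle_measure) \<le> ennreal \<bar>r\<^sup>2 - 1\<bar> * ennreal (1 / (1 - r) * (2 * pi))"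
        using True by (subst const[symmetric]) (auto intro: mult_left_mono)
      also have "\<dots> = ennreal (\<bar>r\<^sup>2 - 1\<bar> * (1 / (1 - r) * (2 * pi)))"
        using True by (intro ennreal_mult[symmetric]) auto
      also have "\<dots> \<le> ennreal (8 * pi)" using True r unfolding f by (intro ennreal_leI) auto
      finally show ?thesis .
    qed
  qed
  also have "\<dots> = ennreal (16 * pi)" by (subst ennreal_plus[symmetric]) auto
  finally show ?thesis unfolding r_def .
qed

text \<open>Access by index lets permutations of the points act on indices. Every index from 5 on
  reads the last point, so measurability and unit norm hold for all natural numbers.\<close>

definition coord :: "nat \<Rightarrow> complex6 \<Rightarrow> complex" where
  "coord i = (\<lambda>(a, b, c, d, e, f). if i = 0 then a else if i = 1 then b else if i = 2 then c
     else if i = 3 then d else if i = 4 then e else f)"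

lemma coord_measurable [measurable]: "coord i \<in> circle6 \<rightarrow>\<^sub>M circle_measure"
proof -
  have "coord i = (if i = 0 then (\<lambda>x. fst x) else if i = 1 then (\<lambda>x. fst (snd x))
     else if i = 2 then (\<lambda>x. fst (snd (snd x))) else if i = 3 then (\<lambda>x. fst (snd (snd (snd x))))
     else if i = 4 then (\<lambda>x. fst (snd (snd (snd (snd x))))) else (\<lambda>x. snd (snd (snd (snd (snd x))))))"
    by (auto simp: coord_def fun_eq_iff)
  then show ?thesis unfolding circle6_eq by (auto split: if_splits)
qed

lemma coord_borel [measurable]: "coord i \<in> borel_measurable circle6"
  by (rule borel_measurable_circleI) (rule coord_measurable)

lemma coord_borel_delta6 [measurable]: "coord i \<in> borel_measurable delta6"
  and coord_measurable_delta6 [measurable]: "coord i \<in> delta6 \<rightarrow>\<^sub>M circle_measure"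
  using coord_borel[of i] coord_measurable[of i] by (simp_all cong: measurable_cong_sets)

lemma norm_coord: "x \<in> space delta6 \<Longrightarrow> norm (coord i x) = 1"
  using measurable_space[OF coord_measurable, of x i] by simp

section \<open>The symmetric group acting on the coordinates\<close>

lemma delta6_invariant_distr:
  assumes "delta6_invariant \<tau>"
  shows "distr delta6 delta6 \<tau> = delta6"
proof (rule measure_eqI)
  have \<tau>: "\<tau> \<in> delta6 \<rightarrow>\<^sub>M delta6"
    using assms unfolding delta6_invariant_def by (simp cong: measurable_cong_sets)
  fix A assume "A \<in> sets (distr delta6 delta6 \<tau>)"
  then have A: "A \<in> sets circle6" by simp
  have "emeasure (distr delta6 delta6 \<tau>) A = (\<integral>\<^sup>+x. indicator A x \<partial>distr delta6 delta6 \<tau>)"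
    using A by simp
  also have "\<dots> = (\<integral>\<^sup>+x. indicator A (\<tau> x) \<partial>delta6)"
    using A by (intro nn_integral_distr \<tau>) simp
  also have "\<dots> = (\<integral>\<^sup>+x. indicator A x \<partial>delta6)"
    using assms A unfolding delta6_invariant_def by (auto dest: bspec[where x="indicator A"])
  also have "\<dots> = emeasure delta6 A" using A by simp
  finally show "emeasure (distr delta6 delta6 \<tau>) A = emeasure delta6 A" .
qed simp

text \<open>Here \<open>coord (p i)\<close> of a point is \<open>coord i\<close> of its image under a symmetry of \<^const>\<open>delta6\<close>.\<close>

definition perm6 :: "(nat \<Rightarrow> nat) \<Rightarrow> bool" where
  "perm6 p \<longleftrightarrow> (\<forall>i<6. p i < 6) \<and>
    (\<exists>\<tau>. delta6_invariant \<tau> \<and> (\<forall>x. \<forall>i<6. coord i (\<tau> x) = coord (p i) x))"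

lemma perm6_comp:
  assumes "perm6 p" "perm6 q"
  shows "perm6 (q \<circ> p)"
proof -
  obtain \<tau> \<rho> where \<tau>: "delta6_invariant \<tau>" "\<And>x i. i < 6 \<Longrightarrow> coord i (\<tau> x) = coord (p i) x"
    and \<rho>: "delta6_invariant \<rho>" "\<And>x i. i < 6 \<Longrightarrow> coord i (\<rho> x) = coord (q i) x"
    and pq: "\<And>i. i < 6 \<Longrightarrow> p i < 6" "\<And>i. i < 6 \<Longrightarrow> q i < 6"
    using assms unfolding perm6_def by blast
  have "\<forall>x. \<forall>i<6. coord i (\<tau> (\<rho> x)) = coord ((q \<circ> p) i) x"
    using \<tau>(2) \<rho>(2) pq by simp
  then show ?thesis
    unfolding perm6_def using delta6_invariant_comp[OF \<tau>(1) \<rho>(1)] pq by (intro conjI exI[of _ "\<lambda>x. \<tau> (\<rho> x)"]) auto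
qed

lemma perm6_cong: "perm6 p \<Longrightarrow> (\<And>i. i < 6 \<Longrightarrow> q i = p i) \<Longrightarrow> perm6 q"
  unfolding perm6_def by auto

lemma less_6_iff: "i < 6 \<longleftrightarrow> i = 0 \<or> i = 1 \<or> i = 2 \<or> i = 3 \<or> i = 4 \<or> i = (5::nat)"
  by auto

lemma perm6_id: "perm6 id"
proof -
  have "delta6_invariant (\<lambda>x. x)" by (simp add: delta6_invariant_def)
  then show ?thesis unfolding perm6_def by auto
qed

lemma perm6_transpose_trans:
  assumes "perm6 (Transposition.transpose i j)" "perm6 (Transposition.transpose j k)" "i \<noteq> k" "j \<noteq> k" "i \<noteq> j"
  shows "perm6 (Transposition.transpose i k)"
proof (rule perm6_cong)
  show "perm6 (Transposition.transpose i j \<circ> (Transposition.transpose j k \<circ> Transposition.transpose i j))"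
    using assms by (intro perm6_comp)
  show "Transposition.transpose i k l = (Transposition.transpose i j \<circ> (Transposition.transpose j k \<circ> Transposition.transpose i j)) l" for l
    using assms(3-5)
    by (cases "l = i"; cases "l = j"; cases "l = k") (simp_all add: Transposition.transpose_def)
qed

lemma perm6_transpose:
  assumes "i < 6" "j < 6"
  shows "perm6 (Transposition.transpose i j)"
proof -
  have *: "perm6 p" if "delta6_invariant \<tau>" "\<forall>i<6. p i < 6"
    "\<And>a b c d e f i. i < 6 \<Longrightarrow> coord i (\<tau> (a, b, c, d, e, f)) = coord (p i) (a, b, c, d, e, f)" for p \<tau>
    unfolding perm6_def using that by auto
  have 01: "perm6 (Transposition.transpose 0 1)"
    by (rule *[OF delta6_invariant_swap12]) (auto simp: less_6_iff swap12_def coord_def Transposition.transpose_def)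
  have 12: "perm6 (Transposition.transpose 1 2)"
    by (rule *[OF delta6_invariant_swap23]) (auto simp: less_6_iff swap23_def coord_def Transposition.transpose_def)
  have 23: "perm6 (Transposition.transpose 2 3)"
    by (rule *[OF delta6_invariant_swap34]) (auto simp: less_6_iff swap34_def coord_def Transposition.transpose_def)
  have 45: "perm6 (Transposition.transpose 4 5)"
    by (rule *[OF delta6_invariant_swap56]) (auto simp: less_6_iff swap56_def coord_def Transposition.transpose_def)
  have s: "perm6 (Transposition.transpose 2 4 \<circ> Transposition.transpose 3 5)"
    by (rule *[OF delta6_invariant_swap3546]) (auto simp: less_6_iff swap3546_def coord_def Transposition.transpose_def)
  \<comment> \<open>Conjugating (1 2) by the double transposition (2 4)(3 5) yields (1 4), the link
    between the free indices 0 to 3 and the determined ones. All other transpositions then pass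
    through the index 1.\<close>
  have 14: "perm6 (Transposition.transpose 1 4)"
  proof (rule perm6_cong)
    show "perm6 ((Transposition.transpose 2 4 \<circ> Transposition.transpose 3 5) \<circ> (Transposition.transpose 1 2 \<circ> (Transposition.transpose 2 4 \<circ> Transposition.transpose 3 5)))"
      by (intro perm6_comp s 12)
  qed (auto simp: less_6_iff Transposition.transpose_def)
  have 13: "perm6 (Transposition.transpose 1 3)" by (rule perm6_transpose_trans[OF 12 23]) auto
  have 15: "perm6 (Transposition.transpose 1 5)" by (rule perm6_transpose_trans[OF 14 45]) auto
  have one: "perm6 (Transposition.transpose 1 k)" if "k < 6" for k
    using that 01 12 13 14 15 by (auto simp: less_6_iff Transposition.transpose_commute[of "Suc 0" 0] perm6_id)
  show ?thesis
  proof (cases "i = j \<or> i = 1 \<or> j = 1")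
    case True
    then show ?thesis using one[OF assms(1)] one[OF assms(2)] perm6_id
      by (auto simp: Transposition.transpose_commute[of _ "Suc 0"])
  next
    case False
    then show ?thesis using one assms
      by (intro perm6_transpose_trans[of i 1 j]) (auto simp: Transposition.transpose_commute[of i "Suc 0"])
  qed
qed

text \<open>\<open>loc\<close> enters because the symmetry realising \<open>p\<close> controls only
  the indices below 6.\<close>

lemma nn_integral_perm6:
  fixes F :: "(nat \<Rightarrow> complex) \<Rightarrow> ennreal"
  assumes p: "perm6 p" and F: "(\<lambda>x. F (\<lambda>i. coord i x)) \<in> borel_measurable circle6"
    and loc: "\<And>a b. (\<And>i. i < 6 \<Longrightarrow> a i = b i) \<Longrightarrow> F a = F b"
  shows "(\<integral>\<^sup>+x. F (\<lambda>i. coord (p i) x) \<partial>delta6) = (\<integral>\<^sup>+x. F (\<lambda>i. coord i x) \<partial>delta6)"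
proof -
  obtain \<tau> where \<tau>: "delta6_invariant \<tau>" "\<And>x i. i < 6 \<Longrightarrow> coord i (\<tau> x) = coord (p i) x"
    using p by (auto simp: perm6_def)
  have "(\<integral>\<^sup>+x. F (\<lambda>i. coord (p i) x) \<partial>delta6) = (\<integral>\<^sup>+x. F (\<lambda>i. coord i (\<tau> x)) \<partial>delta6)"
    by (intro nn_integral_cong loc) (simp add: \<tau>(2))
  also have "\<dots> = (\<integral>\<^sup>+x. F (\<lambda>i. coord i x) \<partial>delta6)"
    using \<tau>(1) F unfolding delta6_invariant_def by (auto dest: bspec[where x="\<lambda>x. F (\<lambda>i. coord i x)"])
  finally show ?thesis .
qed

lemma integral_perm6:
  fixes F :: "(nat \<Rightarrow> complex) \<Rightarrow> real"
  assumes p: "perm6 p" and F: "(\<lambda>x. F (\<lambda>i. coord i x)) \<in> borel_measurable circle6"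
    and loc: "\<And>a b. (\<And>i. i < 6 \<Longrightarrow> a i = b i) \<Longrightarrow> F a = F b"
  shows "(\<integral>x. F (\<lambda>i. coord (p i) x) \<partial>delta6) = (\<integral>x. F (\<lambda>i. coord i x) \<partial>delta6)"
    and "integrable delta6 (\<lambda>x. F (\<lambda>i. coord (p i) x)) \<longleftrightarrow> integrable delta6 (\<lambda>x. F (\<lambda>i. coord i x))"
proof -
  obtain \<tau> where \<tau>: "delta6_invariant \<tau>" "\<And>x i. i < 6 \<Longrightarrow> coord i (\<tau> x) = coord (p i) x"
    using p by (auto simp: perm6_def)
  have m: "\<tau> \<in> delta6 \<rightarrow>\<^sub>M delta6" "(\<lambda>x. F (\<lambda>i. coord i x)) \<in> borel_measurable delta6"
    using \<tau>(1) F unfolding delta6_invariant_def by (simp_all cong: measurable_cong_sets)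
  have e: "F (\<lambda>i. coord (p i) x) = F (\<lambda>i. coord i (\<tau> x))" for x
    by (intro loc) (simp add: \<tau>(2))
  show "(\<integral>x. F (\<lambda>i. coord (p i) x) \<partial>delta6) = (\<integral>x. F (\<lambda>i. coord i x) \<partial>delta6)"
    unfolding e using integral_distr[OF m] by (simp add: delta6_invariant_distr[OF \<tau>(1)])
  show "integrable delta6 (\<lambda>x. F (\<lambda>i. coord (p i) x)) \<longleftrightarrow> integrable delta6 (\<lambda>x. F (\<lambda>i. coord i x))"
    unfolding e using integrable_distr_eq[OF m] by (simp add: delta6_invariant_distr[OF \<tau>(1)])
qed

lemma coord_lift:
  "coord i (lift1 (w1, w2, w3, w4)) = (if i = 0 then w1 else if i = 1 then w2 else if i = 2 then w3
    else if i = 3 then w4 else if i = 4 then first_pt (neg_sum4 (w1, w2, w3, w4)) else second_pt (neg_sum4 (w1, w2, w3, w4)))"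
  "coord i (lift2 (w1, w2, w3, w4)) = (if i = 0 then w1 else if i = 1 then w2 else if i = 2 then w3
    else if i = 3 then w4 else if i = 4 then second_pt (neg_sum4 (w1, w2, w3, w4)) else first_pt (neg_sum4 (w1, w2, w3, w4)))"
  by (auto simp: coord_def lift_eq)

text \<open>Where the pair weight vanishes, \<open>first_pt\<close> and \<open>second_pt\<close>
  take the default value 1 and the six points need not sum to 0. Such configurations carry no
  mass.\<close>

lemma AE_delta6_sum: "AE x in delta6. (\<Sum>i<6. coord i x) = 0"
proof -
  let ?N = "{x \<in> space circle6. (\<Sum>i<6. coord i x) \<noteq> 0}"
  have N: "?N \<in> sets circle6" by measurable
  have z: "indicator ?N (lift1 x) * ennreal (pair_weight (neg_sum4 x)) = 0"
    "indicator ?N (lift2 x) * ennreal (pair_weight (neg_sum4 x)) = 0" for x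
  proof -
    obtain w1 w2 w3 w4 where x: "x = (w1, w2, w3, w4)" by (cases x)
    have "(\<Sum>i<6. coord i (lift1 x)) = 0 \<and> (\<Sum>i<6. coord i (lift2 x)) = 0"
      if "pair_weight (neg_sum4 x) \<noteq> 0"
      using pts_add[OF that] by (simp add: x coord_lift neg_sum4_def eval_nat_numeral algebra_simps)
    then show "indicator ?N (lift1 x) * ennreal (pair_weight (neg_sum4 x)) = 0"
      "indicator ?N (lift2 x) * ennreal (pair_weight (neg_sum4 x)) = 0"
      by (auto split: split_indicator)
  qed
  have "emeasure delta6 ?N = (\<integral>\<^sup>+x. indicator ?N x \<partial>delta6)" using N by simp
  also have "\<dots> = (\<integral>\<^sup>+x. (indicator ?N (lift1 x) + indicator ?N (lift2 x)) * ennreal (pair_weight (neg_sum4 x)) \<partial>circle4)"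
    by (rule nn_integral_delta6_lift) (use N in simp)
  also have "\<dots> = 0" by (simp add: distrib_right z)
  finally show ?thesis using N by (intro AE_I[of _ _ ?N]) auto
qed

text \<open>For fixed first three points the determined pair has the sum -(w1 + w2 + w3) - w4, so
  the integral over w4 is the one in \<open>circle_kernel_bound\<close>. The two lifts double the
  constant 16 pi.\<close>

lemma nn_integral_triple_bound:
  fixes a b c :: "complex \<Rightarrow> ennreal"
  assumes a [measurable]: "a \<in> borel_measurable circle_measure" and b [measurable]: "b \<in> borel_measurable circle_measure"
    and c [measurable]: "c \<in> borel_measurable circle_measure"
  shows "(\<integral>\<^sup>+x. a (coord 0 x) * b (coord 1 x) * c (coord 2 x)
      * ennreal \<bar>(norm (coord 0 x + coord 1 x + coord 2 x))\<^sup>2 - 1\<bar> \<partial>delta6)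
    \<le> ennreal (32 * pi) * ((\<integral>\<^sup>+w. a w \<partial>circle_measure) * (\<integral>\<^sup>+w. b w \<partial>circle_measure) * (\<integral>\<^sup>+w. c w \<partial>circle_measure))"
proof -
  let ?F = "\<lambda>x. a (coord 0 x) * b (coord 1 x) * c (coord 2 x)
      * ennreal \<bar>(norm (coord 0 x + coord 1 x + coord 2 x))\<^sup>2 - 1\<bar>"
  have F: "?F \<in> borel_measurable circle6" by measurable
  let ?H = "\<lambda>x. (?F (lift1 x) + ?F (lift2 x)) * ennreal (pair_weight (neg_sum4 x))"
  have H: "?H \<in> borel_measurable circle4" by (rule lift_integrand_measurable[OF F])
  have "(\<integral>\<^sup>+x. ?F x \<partial>delta6) = (\<integral>\<^sup>+x. ?H x \<partial>circle4)"
    by (rule nn_integral_delta6_lift[OF F])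
  also have "\<dots> = (\<integral>\<^sup>+w1. \<integral>\<^sup>+w2. \<integral>\<^sup>+w3. \<integral>\<^sup>+w4. ?H (w1, w2, w3, w4)
    \<partial>circle_measure \<partial>circle_measure \<partial>circle_measure \<partial>circle_measure)"
    by (rule nn_integral_circle4[OF H])
  also have "\<dots> \<le> (\<integral>\<^sup>+w1. \<integral>\<^sup>+w2. \<integral>\<^sup>+w3. ennreal (32 * pi) * (a w1 * (b w2 * c w3))
    \<partial>circle_measure \<partial>circle_measure \<partial>circle_measure)"
  proof (intro nn_integral_mono)
    fix w1 w2 w3 :: complex
    let ?x = "- (w1 + w2 + w3)"
    have m: "(\<lambda>w. ennreal (pair_weight (?x - w))) \<in> borel_measurable circle_measure"
      by (rule borel_measurable_on_circle) measurable
    have n: "norm ?x = norm (w1 + w2 + w3)" by (rule norm_minus_cancel)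
    have "(\<integral>\<^sup>+w4. ?H (w1, w2, w3, w4) \<partial>circle_measure)
      = (\<integral>\<^sup>+w. (2 * (a w1 * (b w2 * c w3)) * ennreal \<bar>(norm ?x)\<^sup>2 - 1\<bar>) * ennreal (pair_weight (?x - w)) \<partial>circle_measure)"
      unfolding n by (intro nn_integral_cong)
       (simp add: coord_lift neg_sum4_def algebra_simps mult_2)
    also have "\<dots> = (2 * (a w1 * (b w2 * c w3)) * ennreal \<bar>(norm ?x)\<^sup>2 - 1\<bar>) * (\<integral>\<^sup>+w. ennreal (pair_weight (?x - w)) \<partial>circle_measure)"
      by (rule nn_integral_cmult) (rule m)
    also have "\<dots> = 2 * (a w1 * (b w2 * c w3)) * (ennreal \<bar>(norm ?x)\<^sup>2 - 1\<bar> * (\<integral>\<^sup>+w. ennreal (pair_weight (?x - w)) \<partial>circle_measure))"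
      by (simp only: mult.assoc)
    also have "\<dots> \<le> 2 * (a w1 * (b w2 * c w3)) * ennreal (16 * pi)"
      by (rule mult_left_mono) (rule circle_kernel_bound, simp)
    also have "\<dots> = ennreal (32 * pi) * (a w1 * (b w2 * c w3))"
    proof -
      have "ennreal (32 * pi) = 2 * ennreal (16 * pi)"
        by (simp add: mult_2 flip: ennreal_plus)
      then show ?thesis by (simp add: mult_ac)
    qed
    finally show "(\<integral>\<^sup>+w4. ?H (w1, w2, w3, w4) \<partial>circle_measure) \<le> ennreal (32 * pi) * (a w1 * (b w2 * c w3))" .
  qed
  also have "\<dots> = ennreal (32 * pi) * ((\<integral>\<^sup>+w. a w \<partial>circle_measure) * (\<integral>\<^sup>+w. b w \<partial>circle_measure) * (\<integral>\<^sup>+w. c w \<partial>circle_measure))"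
    by (simp add: nn_integral_cmult nn_integral_multc mult_ac)
  finally show ?thesis .
qed

section \<open>The pointwise average over the ten splittings\<close>

lemma norm_triple:
  fixes a b c :: complex
  assumes "norm a = 1" "norm b = 1" "norm c = 1"
  shows "(norm (a + b + c))\<^sup>2 = 3 + 2 * (a \<bullet> b) + 2 * (a \<bullet> c) + 2 * (b \<bullet> c)"
proof -
  have "a \<bullet> a = 1" "b \<bullet> b = 1" "c \<bullet> c = 1"
    using assms by (simp_all add: dot_square_norm)
  then show ?thesis by (simp add: power2_norm_eq_inner algebra_simps inner_commute)
qed

text \<open>Pairing the sum with each of the six vectors gives six linear relations among the
  fifteen inner products. They are solved here in the order in which
  \<open>triple_difference_identity\<close> substitutes them.\<close>

lemma dots_of_sum_eq_0:
  fixes a :: "nat \<Rightarrow> complex"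
  assumes "\<And>i. i < 6 \<Longrightarrow> norm (a i) = 1" "(\<Sum>i<6. a i) = 0"
  shows "a 4 \<bullet> a 5 = -1 - a 0 \<bullet> a 4 - a 1 \<bullet> a 4 - a 2 \<bullet> a 4 - a 3 \<bullet> a 4"
    "a 3 \<bullet> a 5 = -1 - a 0 \<bullet> a 3 - a 1 \<bullet> a 3 - a 2 \<bullet> a 3 - a 3 \<bullet> a 4"
    "a 2 \<bullet> a 5 = -1 - a 0 \<bullet> a 2 - a 1 \<bullet> a 2 - a 2 \<bullet> a 3 - a 2 \<bullet> a 4"
    "a 1 \<bullet> a 5 = -1 - a 0 \<bullet> a 1 - a 1 \<bullet> a 2 - a 1 \<bullet> a 3 - a 1 \<bullet> a 4"
    "a 0 \<bullet> a 5 = -1 - a 0 \<bullet> a 1 - a 0 \<bullet> a 2 - a 0 \<bullet> a 3 - a 0 \<bullet> a 4"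
    "a 3 \<bullet> a 4 = -2 - a 0 \<bullet> a 1 - a 0 \<bullet> a 2 - a 0 \<bullet> a 3 - a 0 \<bullet> a 4 - a 1 \<bullet> a 2 - a 1 \<bullet> a 3 - a 1 \<bullet> a 4
      - a 2 \<bullet> a 3 - a 2 \<bullet> a 4"
proof -
  have S: "a 0 + a 1 + a 2 + a 3 + a 4 + a 5 = 0"
    using assms(2) by (simp add: eval_nat_numeral)
  have u: "a 0 \<bullet> a 0 = 1" "a 1 \<bullet> a 1 = 1" "a 2 \<bullet> a 2 = 1" "a 3 \<bullet> a 3 = 1" "a 4 \<bullet> a 4 = 1" "a 5 \<bullet> a 5 = 1"
    using assms(1) by (simp_all add: dot_square_norm)
  have T: "a i \<bullet> a 0 + a i \<bullet> a 1 + a i \<bullet> a 2 + a i \<bullet> a 3 + a i \<bullet> a 4 + a i \<bullet> a 5 = 0" for i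
    using arg_cong[OF S, of "\<lambda>v. a i \<bullet> v"] by (simp add: inner_add_right)
  note C = inner_commute[of "a 1" "a 0"] inner_commute[of "a 2" "a 0"] inner_commute[of "a 3" "a 0"]
    inner_commute[of "a 4" "a 0"] inner_commute[of "a 5" "a 0"] inner_commute[of "a 2" "a 1"]
    inner_commute[of "a 3" "a 1"] inner_commute[of "a 4" "a 1"] inner_commute[of "a 5" "a 1"]
    inner_commute[of "a 3" "a 2"] inner_commute[of "a 4" "a 2"] inner_commute[of "a 5" "a 2"]
    inner_commute[of "a 4" "a 3"] inner_commute[of "a 5" "a 3"] inner_commute[of "a 5" "a 4"]
  note E = T[of 0, unfolded C u] T[of 1, unfolded C u]
    T[of 2, unfolded C u] T[of 3, unfolded C u]
    T[of 4, unfolded C u] T[of 5, unfolded C u]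
  show "a 4 \<bullet> a 5 = -1 - a 0 \<bullet> a 4 - a 1 \<bullet> a 4 - a 2 \<bullet> a 4 - a 3 \<bullet> a 4"
    "a 3 \<bullet> a 5 = -1 - a 0 \<bullet> a 3 - a 1 \<bullet> a 3 - a 2 \<bullet> a 3 - a 3 \<bullet> a 4"
    "a 2 \<bullet> a 5 = -1 - a 0 \<bullet> a 2 - a 1 \<bullet> a 2 - a 2 \<bullet> a 3 - a 2 \<bullet> a 4"
    "a 1 \<bullet> a 5 = -1 - a 0 \<bullet> a 1 - a 1 \<bullet> a 2 - a 1 \<bullet> a 3 - a 1 \<bullet> a 4"
    "a 0 \<bullet> a 5 = -1 - a 0 \<bullet> a 1 - a 0 \<bullet> a 2 - a 0 \<bullet> a 3 - a 0 \<bullet> a 4"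
    "a 3 \<bullet> a 4 = -2 - a 0 \<bullet> a 1 - a 0 \<bullet> a 2 - a 0 \<bullet> a 3 - a 0 \<bullet> a 4 - a 1 \<bullet> a 2 - a 1 \<bullet> a 3 - a 1 \<bullet> a 4
      - a 2 \<bullet> a 3 - a 2 \<bullet> a 4"
    using E by linarith+
qed

definition triple_weight :: "(nat \<Rightarrow> complex) \<Rightarrow> real" where
  "triple_weight a = (norm (a 0 + a 1 + a 2))\<^sup>2 - 1"

text \<open>One representative for each of the ten ways to split the six indices into two triples.\<close>

definition triple_perms :: "(nat \<Rightarrow> nat) list" where
  "triple_perms = [id, Transposition.transpose 1 3, Transposition.transpose 1 4, Transposition.transpose 1 5, Transposition.transpose 2 3, Transposition.transpose 2 4, Transposition.transpose 2 5,
     Transposition.transpose 1 3 \<circ> Transposition.transpose 2 4, Transposition.transpose 1 3 \<circ> Transposition.transpose 2 5, Transposition.transpose 1 4 \<circ> Transposition.transpose 2 5]"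

lemma triple_perms_perm6: "p \<in> set triple_perms \<Longrightarrow> perm6 p"
  unfolding triple_perms_def
  by (auto intro!: perm6_comp perm6_transpose perm6_id)

lemma triple_perms_less: "p \<in> set triple_perms \<Longrightarrow> i < 6 \<Longrightarrow> p i < 6"
  using triple_perms_perm6 by (auto simp: perm6_def)

text \<open>The variables \<open>dij\<close> stand for the inner products of six unit vectors with sum \<open>0\<close>; the
  hypotheses solve the resulting six linear relations.\<close>

lemma triple_difference_identity:
  fixes d01 d02 d03 d04 d05 d12 d13 d14 d15 d23 d24 d25 d34 d35 d45 g0 g1 g2 g3 g4 g5 :: real
  assumes "d45 = -1 - d04 - d14 - d24 - d34"
    "d35 = -1 - d03 - d13 - d23 - d34"
    "d25 = -1 - d02 - d12 - d23 - d24"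
    "d15 = -1 - d01 - d12 - d13 - d14"
    "d05 = -1 - d01 - d02 - d03 - d04"
    "d34 = -2 - d01 - d02 - d03 - d04 - d12 - d13 - d14 - d23 - d24"
  shows "(g0 + g1 + g2 - g3 - g4 - g5)\<^sup>2 * (2 + 2 * d01 + 2 * d02 + 2 * d12)
    + (g0 + g3 + g2 - g1 - g4 - g5)\<^sup>2 * (2 + 2 * d03 + 2 * d02 + 2 * d23)
    + (g0 + g4 + g2 - g3 - g1 - g5)\<^sup>2 * (2 + 2 * d04 + 2 * d02 + 2 * d24)
    + (g0 + g5 + g2 - g3 - g4 - g1)\<^sup>2 * (2 + 2 * d05 + 2 * d02 + 2 * d25)
    + (g0 + g1 + g3 - g2 - g4 - g5)\<^sup>2 * (2 + 2 * d01 + 2 * d03 + 2 * d13)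
    + (g0 + g1 + g4 - g3 - g2 - g5)\<^sup>2 * (2 + 2 * d01 + 2 * d04 + 2 * d14)
    + (g0 + g1 + g5 - g3 - g4 - g2)\<^sup>2 * (2 + 2 * d01 + 2 * d05 + 2 * d15)
    + (g0 + g3 + g4 - g1 - g2 - g5)\<^sup>2 * (2 + 2 * d03 + 2 * d04 + 2 * d34)
    + (g0 + g3 + g5 - g1 - g4 - g2)\<^sup>2 * (2 + 2 * d03 + 2 * d05 + 2 * d35)
    + (g0 + g4 + g5 - g3 - g1 - g2)\<^sup>2 * (2 + 2 * d04 + 2 * d05 + 2 * d45)
    = 8 * (g0\<^sup>2 + g1\<^sup>2 + g2\<^sup>2 + g3\<^sup>2 + g4\<^sup>2 + g5\<^sup>2 + 2 * (g0 * g1 * d01 + g0 * g2 * d02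
      + g0 * g3 * d03 + g0 * g4 * d04 + g0 * g5 * d05 + g1 * g2 * d12 + g1 * g3 * d13 + g1 * g4 * d14 + g1 * g5 * d15 + g2 * g3 * d23
      + g2 * g4 * d24 + g2 * g5 * d25 + g3 * g4 * d34 + g3 * g5 * d35 + g4 * g5 * d45))"
  unfolding assms by algebra

lemma triple_weight_dots:
  assumes "norm (b 0) = 1" "norm (b 1) = 1" "norm (b 2) = 1"
  shows "triple_weight b = 2 + 2 * (b 0 \<bullet> b 1) + 2 * (b 0 \<bullet> b 2) + 2 * (b 1 \<bullet> b 2)"
  unfolding triple_weight_def norm_triple[OF assms] by simp

text \<open>A cross term g_i g_j has sign + in the 4 splittings that keep i and j together and sign
  - in the other 6. Once the relations between the inner products are used, the signed weights add
  up to 8 times the inner product of a_i and a_j, which matches the expansion of the squared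
  norm.\<close>

lemma triple_difference_average:
  fixes g :: "nat \<Rightarrow> real"
  assumes "\<And>i. i < 6 \<Longrightarrow> norm (a i) = 1" "(\<Sum>i<6. a i) = 0"
  shows "(\<Sum>p\<leftarrow>triple_perms. (g (p 0) + g (p 1) + g (p 2) - g (p 3) - g (p 4) - g (p 5))\<^sup>2 * triple_weight (\<lambda>i. a (p i)))
    = 8 * (norm (\<Sum>i<6. g i *\<^sub>R a i))\<^sup>2"
proof -
  have u: "a 0 \<bullet> a 0 = 1" "a 1 \<bullet> a 1 = 1" "a 2 \<bullet> a 2 = 1" "a 3 \<bullet> a 3 = 1" "a 4 \<bullet> a 4 = 1" "a 5 \<bullet> a 5 = 1"
    using assms(1) by (simp_all add: dot_square_norm)
  note C = inner_commute[of "a 1" "a 0"] inner_commute[of "a 2" "a 0"] inner_commute[of "a 3" "a 0"]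
    inner_commute[of "a 4" "a 0"] inner_commute[of "a 5" "a 0"] inner_commute[of "a 2" "a 1"]
    inner_commute[of "a 3" "a 1"] inner_commute[of "a 4" "a 1"] inner_commute[of "a 5" "a 1"]
    inner_commute[of "a 3" "a 2"] inner_commute[of "a 4" "a 2"] inner_commute[of "a 5" "a 2"]
    inner_commute[of "a 4" "a 3"] inner_commute[of "a 5" "a 3"] inner_commute[of "a 5" "a 4"]
  have s6: "(\<Sum>i<6. f i) = f 0 + f 1 + f 2 + f 3 + f 4 + f 5" for f :: "nat \<Rightarrow> complex"
    by (simp add: eval_nat_numeral)
  have nd: "(norm (\<Sum>i<6. g i *\<^sub>R a i))\<^sup>2 = (g 0)\<^sup>2 + (g 1)\<^sup>2 + (g 2)\<^sup>2 + (g 3)\<^sup>2 + (g 4)\<^sup>2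
      + (g 5)\<^sup>2
    + 2 * (g 0 * g 1 * (a 0 \<bullet> a 1) + g 0 * g 2 * (a 0 \<bullet> a 2) + g 0 * g 3 * (a 0 \<bullet> a 3) + g 0 * g 4 * (a 0 \<bullet> a 4)
    + g 0 * g 5 * (a 0 \<bullet> a 5) + g 1 * g 2 * (a 1 \<bullet> a 2) + g 1 * g 3 * (a 1 \<bullet> a 3) + g 1 * g 4 * (a 1 \<bullet> a 4)
    + g 1 * g 5 * (a 1 \<bullet> a 5) + g 2 * g 3 * (a 2 \<bullet> a 3) + g 2 * g 4 * (a 2 \<bullet> a 4) + g 2 * g 5 * (a 2 \<bullet> a 5)
    + g 3 * g 4 * (a 3 \<bullet> a 4) + g 3 * g 5 * (a 3 \<bullet> a 5) + g 4 * g 5 * (a 4 \<bullet> a 5))"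
    unfolding power2_norm_eq_inner s6
    by (simp add: inner_add_left inner_add_right C u power2_eq_square algebra_simps del: One_nat_def)
  have "(\<Sum>p\<leftarrow>triple_perms. (g (p 0) + g (p 1) + g (p 2) - g (p 3) - g (p 4) - g (p 5))\<^sup>2 * triple_weight (\<lambda>i. a (p i)))
    = (g 0 + g 1 + g 2 - g 3 - g 4 - g 5)\<^sup>2 * (2 + 2 * (a 0 \<bullet> a 1) + 2 * (a 0 \<bullet> a 2) + 2 * (a 1 \<bullet> a 2))
    + (g 0 + g 3 + g 2 - g 1 - g 4 - g 5)\<^sup>2 * (2 + 2 * (a 0 \<bullet> a 3) + 2 * (a 0 \<bullet> a 2) + 2 * (a 2 \<bullet> a 3))
    + (g 0 + g 4 + g 2 - g 3 - g 1 - g 5)\<^sup>2 * (2 + 2 * (a 0 \<bullet> a 4) + 2 * (a 0 \<bullet> a 2) + 2 * (a 2 \<bullet> a 4))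
    + (g 0 + g 5 + g 2 - g 3 - g 4 - g 1)\<^sup>2 * (2 + 2 * (a 0 \<bullet> a 5) + 2 * (a 0 \<bullet> a 2) + 2 * (a 2 \<bullet> a 5))
    + (g 0 + g 1 + g 3 - g 2 - g 4 - g 5)\<^sup>2 * (2 + 2 * (a 0 \<bullet> a 1) + 2 * (a 0 \<bullet> a 3) + 2 * (a 1 \<bullet> a 3))
    + (g 0 + g 1 + g 4 - g 3 - g 2 - g 5)\<^sup>2 * (2 + 2 * (a 0 \<bullet> a 1) + 2 * (a 0 \<bullet> a 4) + 2 * (a 1 \<bullet> a 4))
    + (g 0 + g 1 + g 5 - g 3 - g 4 - g 2)\<^sup>2 * (2 + 2 * (a 0 \<bullet> a 1) + 2 * (a 0 \<bullet> a 5) + 2 * (a 1 \<bullet> a 5))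
    + (g 0 + g 3 + g 4 - g 1 - g 2 - g 5)\<^sup>2 * (2 + 2 * (a 0 \<bullet> a 3) + 2 * (a 0 \<bullet> a 4) + 2 * (a 3 \<bullet> a 4))
    + (g 0 + g 3 + g 5 - g 1 - g 4 - g 2)\<^sup>2 * (2 + 2 * (a 0 \<bullet> a 3) + 2 * (a 0 \<bullet> a 5) + 2 * (a 3 \<bullet> a 5))
    + (g 0 + g 4 + g 5 - g 3 - g 1 - g 2)\<^sup>2 * (2 + 2 * (a 0 \<bullet> a 4) + 2 * (a 0 \<bullet> a 5) + 2 * (a 4 \<bullet> a 5))"
  proof -
    define D where "D q0 q1 q2 q3 q4 q5 = (g q0 + g q1 + g q2 - g q3 - g q4 - g q5)\<^sup>2
      * (2 + 2 * (a q0 \<bullet> a q1) + 2 * (a q0 \<bullet> a q2) + 2 * (a q1 \<bullet> a q2))" for q0 q1 q2 q3 q4 q5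
    have "(\<Sum>p\<leftarrow>triple_perms. (g (p 0) + g (p 1) + g (p 2) - g (p 3) - g (p 4) - g (p 5))\<^sup>2 * triple_weight (\<lambda>i. a (p i)))
      = (\<Sum>p\<leftarrow>triple_perms. D (p 0) (p 1) (p 2) (p 3) (p 4) (p 5))"
    proof (rule arg_cong[where f=sum_list], rule map_cong[OF refl])
      fix p assume p: "p \<in> set triple_perms"
      have "norm (a (p i)) = 1" if "i < 6" for i using assms(1) triple_perms_less[OF p that] .
      then have "triple_weight (\<lambda>i. a (p i))
        = 2 + 2 * (a (p 0) \<bullet> a (p 1)) + 2 * (a (p 0) \<bullet> a (p 2)) + 2 * (a (p 1) \<bullet> a (p 2))"
        by (intro triple_weight_dots) auto
      then show "(g (p 0) + g (p 1) + g (p 2) - g (p 3) - g (p 4) - g (p 5))\<^sup>2 * triple_weight (\<lambda>i. a (p i))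
        = D (p 0) (p 1) (p 2) (p 3) (p 4) (p 5)"
        unfolding D_def by (simp only:)
    qed
    also have "\<dots> = D 0 1 2 3 4 5 + D 0 3 2 1 4 5 + D 0 4 2 3 1 5 + D 0 5 2 3 4 1 + D 0 1 3 2 4 5 + D 0 1 4 3 2 5
      + D 0 1 5 3 4 2 + D 0 3 4 1 2 5 + D 0 3 5 1 4 2 + D 0 4 5 3 1 2"
      by (simp add: triple_perms_def Transposition.transpose_def add.assoc del: One_nat_def)
    finally show ?thesis
      by (simp only: D_def inner_commute[of "a 3" "a 2"] inner_commute[of "a 4" "a 2"] inner_commute[of "a 5" "a 2"])
  qed
  also have "\<dots> = 8 * ((g 0)\<^sup>2 + (g 1)\<^sup>2 + (g 2)\<^sup>2 + (g 3)\<^sup>2 + (g 4)\<^sup>2 + (g 5)\<^sup>2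
      + 2 * (g 0 * g 1 * (a 0 \<bullet> a 1) + g 0 * g 2 * (a 0 \<bullet> a 2) + g 0 * g 3 * (a 0 \<bullet> a 3)
      + g 0 * g 4 * (a 0 \<bullet> a 4) + g 0 * g 5 * (a 0 \<bullet> a 5) + g 1 * g 2 * (a 1 \<bullet> a 2)
      + g 1 * g 3 * (a 1 \<bullet> a 3) + g 1 * g 4 * (a 1 \<bullet> a 4) + g 1 * g 5 * (a 1 \<bullet> a 5)
      + g 2 * g 3 * (a 2 \<bullet> a 3) + g 2 * g 4 * (a 2 \<bullet> a 4) + g 2 * g 5 * (a 2 \<bullet> a 5)
      + g 3 * g 4 * (a 3 \<bullet> a 4) + g 3 * g 5 * (a 3 \<bullet> a 5) + g 4 * g 5 * (a 4 \<bullet> a 5)))"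
    by (rule triple_difference_identity[OF dots_of_sum_eq_0[OF assms]])
  finally show ?thesis unfolding nd .
qed

text \<open>For the indicator g of the index 0 every squared difference equals 1 and the moment is
  the unit vector a_0, so this is a special case of \<open>triple_difference_average\<close>. It
  rules out that all ten weights are small together.\<close>

lemma triple_weight_average:
  assumes a: "\<And>i. i < 6 \<Longrightarrow> norm (a i) = 1" "(\<Sum>i<6. a i) = 0"
  shows "(\<Sum>p\<leftarrow>triple_perms. triple_weight (\<lambda>i. a (p i))) = 8"
proof -
  let ?g = "\<lambda>i::nat. if i = 0 then 1 else (0::real)"
  have "(\<Sum>p\<leftarrow>triple_perms. triple_weight (\<lambda>i. a (p i)))
    = (\<Sum>p\<leftarrow>triple_perms. (?g (p 0) + ?g (p 1) + ?g (p 2) - ?g (p 3) - ?g (p 4) - ?g (p 5))\<^sup>2 * triple_weight (\<lambda>i. a (p i)))"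
  proof (rule arg_cong[where f=sum_list], rule map_cong[OF refl])
    fix p assume "p \<in> set triple_perms"
    then have "p 0 = 0 \<and> p 1 \<noteq> 0 \<and> p 2 \<noteq> 0 \<and> p 3 \<noteq> 0 \<and> p 4 \<noteq> 0 \<and> p 5 \<noteq> 0"
      by (auto simp: triple_perms_def Transposition.transpose_def)
    then show "triple_weight (\<lambda>i. a (p i))
      = (?g (p 0) + ?g (p 1) + ?g (p 2) - ?g (p 3) - ?g (p 4) - ?g (p 5))\<^sup>2 * triple_weight (\<lambda>i. a (p i))"
      by simp
  qed
  also have "\<dots> = 8 * (norm (\<Sum>i<6. ?g i *\<^sub>R a i))\<^sup>2"
    by (rule triple_difference_average[OF a])
  also have "(\<Sum>i<6. ?g i *\<^sub>R a i) = a 0" by (simp add: eval_nat_numeral)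
  finally show ?thesis using a(1)[of 0] by simp
qed

subsection \<open>The quadratic form at the constant function\<close>

lemma nn_integral_sum_list:
  fixes f :: "'b \<Rightarrow> 'a \<Rightarrow> ennreal"
  assumes "\<And>p. p \<in> set ps \<Longrightarrow> f p \<in> borel_measurable M"
  shows "(\<integral>\<^sup>+x. (\<Sum>p\<leftarrow>ps. f p x) \<partial>M) = (\<Sum>p\<leftarrow>ps. \<integral>\<^sup>+x. f p x \<partial>M)"
    and "(\<lambda>x. \<Sum>p\<leftarrow>ps. f p x) \<in> borel_measurable M"
  using assms by (induction ps) (auto simp: nn_integral_add)

lemma integral_sum_list:
  fixes f :: "'b \<Rightarrow> 'a \<Rightarrow> real"
  assumes "\<And>p. p \<in> set ps \<Longrightarrow> integrable M (f p)"
  shows "(\<integral>x. (\<Sum>p\<leftarrow>ps. f p x) \<partial>M) = (\<Sum>p\<leftarrow>ps. \<integral>x. f p x \<partial>M)"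
    and "integrable M (\<lambda>x. \<Sum>p\<leftarrow>ps. f p x)"
  using assms by (induction ps) auto

lemma AE_delta6_config:
  "AE x in delta6. (\<forall>i. norm (coord i x) = 1) \<and> (\<Sum>i<6. coord i x) = 0"
  using AE_delta6_sum AE_space by eventually_elim (auto simp: norm_coord)

lemma triple_weight_coord_measurable [measurable]:
  "(\<lambda>x. triple_weight (\<lambda>i. coord (p i) x)) \<in> borel_measurable circle6"
  unfolding triple_weight_def by measurable

lemma abs_triple_weight_le:
  assumes "norm (a 0) = 1" "norm (a 1) = 1" "norm (a 2) = 1"
  shows "\<bar>triple_weight a\<bar> \<le> 8"
proof -
  have "norm (a 0 + a 1 + a 2) \<le> 3"
    using norm_triangle_ineq[of "a 0 + a 1" "a 2"] norm_triangle_ineq[of "a 0" "a 1"] assms by simp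
  then have "(norm (a 0 + a 1 + a 2))\<^sup>2 \<le> 9"
    using power_mono[of "norm (a 0 + a 1 + a 2)" 3 2] by simp
  moreover have "(norm (a 0 + a 1 + a 2))\<^sup>2 \<ge> 0" by simp
  ultimately show ?thesis unfolding triple_weight_def by (intro abs_leI) linarith+
qed

lemma triple_perms_0: "p \<in> set triple_perms \<Longrightarrow> p 0 = 0"
  by (auto simp: triple_perms_def Transposition.transpose_def)

text \<open>The marginals of \<open>delta6\<close> have bounded density, although
  \<open>nn_integral_triple_bound\<close> controls weighted integrals only. The ten weights sum to
  8, so their absolute values sum to at least 8, and each of the ten permutations fixes the index 0
  and leaves \<open>h (coord 0 x)\<close> alone. The constant is 10/8 times 32 pi (2 pi)^2.\<close>

lemma nn_integral_coord_bound:
  fixes h :: "complex \<Rightarrow> ennreal"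
  assumes h [measurable]: "h \<in> borel_measurable circle_measure" and i: "i < 6"
  shows "(\<integral>\<^sup>+x. h (coord i x) \<partial>delta6) \<le> ennreal (160 * pi ^ 3) * (\<integral>\<^sup>+w. h w \<partial>circle_measure)"
proof -
  let ?I = "\<integral>\<^sup>+w. h w \<partial>circle_measure"
  let ?F = "\<lambda>a. h (a 0) * ennreal \<bar>triple_weight a\<bar>"
  have Fm: "(\<lambda>x. ?F (\<lambda>i. coord (p i) x)) \<in> borel_measurable circle6" for p by measurable
  have F1: "(\<integral>\<^sup>+x. ?F (\<lambda>i. coord i x) \<partial>delta6) \<le> ennreal (128 * pi ^ 3) * ?I"
  proof -
    have "(\<integral>\<^sup>+x. ?F (\<lambda>i. coord i x) \<partial>delta6) = (\<integral>\<^sup>+x. h (coord 0 x) * 1 * 1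
        * ennreal \<bar>(norm (coord 0 x + coord 1 x + coord 2 x))\<^sup>2 - 1\<bar> \<partial>delta6)"
      by (simp add: triple_weight_def)
    also have "\<dots> \<le> ennreal (32 * pi) * (?I * (\<integral>\<^sup>+w. 1 \<partial>circle_measure) * (\<integral>\<^sup>+w. 1 \<partial>circle_measure))"
      by (rule nn_integral_triple_bound[of h "\<lambda>_. 1" "\<lambda>_. 1"]) auto
    also have "\<dots> = ennreal (32 * pi) * (ennreal (2 * pi) * ennreal (2 * pi)) * ?I"
      by (simp add: emeasure_circle_measure_space[simplified] mult_ac)
    also have "ennreal (32 * pi) * (ennreal (2 * pi) * ennreal (2 * pi)) = ennreal (128 * pi ^ 3)"
      by (simp add: ennreal_mult[symmetric] power3_eq_cube algebra_simps)
    finally show ?thesis .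
  qed
  have "8 * (\<integral>\<^sup>+x. h (coord 0 x) \<partial>delta6) = (\<integral>\<^sup>+x. 8 * h (coord 0 x) \<partial>delta6)"
    by (rule nn_integral_cmult[symmetric]) measurable
  also have "\<dots> \<le> (\<integral>\<^sup>+x. (\<Sum>p\<leftarrow>triple_perms. ?F (\<lambda>i. coord (p i) x)) \<partial>delta6)"
  proof (rule nn_integral_mono_AE, use AE_delta6_config in eventually_elim)
    fix x assume x: "(\<forall>i. norm (coord i x) = 1) \<and> (\<Sum>i<6. coord i x) = 0"
    let ?w = "\<lambda>p. triple_weight (\<lambda>i. coord (p i) x)"
    have "8 = (\<Sum>p\<leftarrow>triple_perms. ?w p)"
      using triple_weight_average[of "\<lambda>i. coord i x"] x by simp
    also have "\<dots> \<le> (\<Sum>p\<leftarrow>triple_perms. \<bar>?w p\<bar>)" by (intro sum_list_mono) auto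
    finally have "ennreal 8 \<le> ennreal (\<Sum>p\<leftarrow>triple_perms. \<bar>?w p\<bar>)" by (rule ennreal_leI)
    also have "\<dots> = (\<Sum>p\<leftarrow>triple_perms. ennreal \<bar>?w p\<bar>)"
      by (rule sum_list_ennreal[symmetric, unfolded map_map comp_def]) auto
    finally have "8 * h (coord 0 x) \<le> (\<Sum>p\<leftarrow>triple_perms. ennreal \<bar>?w p\<bar>) * h (coord 0 x)"
      by (intro mult_right_mono) auto
    also have "\<dots> = (\<Sum>p\<leftarrow>triple_perms. ennreal \<bar>?w p\<bar> * h (coord 0 x))"
      by (rule sum_list_mult_const[symmetric])
    also have "\<dots> = (\<Sum>p\<leftarrow>triple_perms. ?F (\<lambda>i. coord (p i) x))"
      by (intro arg_cong[where f=sum_list] map_cong refl) (simp add: triple_perms_0 mult.commute)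
    finally show "8 * h (coord 0 x) \<le> (\<Sum>p\<leftarrow>triple_perms. ?F (\<lambda>i. coord (p i) x))" .
  qed
  also have "\<dots> = (\<Sum>p\<leftarrow>triple_perms. \<integral>\<^sup>+x. ?F (\<lambda>i. coord (p i) x) \<partial>delta6)"
    by (rule nn_integral_sum_list) (use Fm in \<open>simp cong: measurable_cong_sets\<close>)
  also have "\<dots> = (\<Sum>p\<leftarrow>triple_perms. \<integral>\<^sup>+x. ?F (\<lambda>i. coord i x) \<partial>delta6)"
  proof (rule arg_cong[where f=sum_list], rule map_cong[OF refl])
    fix p assume "p \<in> set triple_perms"
    then show "(\<integral>\<^sup>+x. ?F (\<lambda>i. coord (p i) x) \<partial>delta6) = (\<integral>\<^sup>+x. ?F (\<lambda>i. coord i x) \<partial>delta6)"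
      by (intro nn_integral_perm6[of p ?F] triple_perms_perm6 Fm[of "\<lambda>i. i"]) (simp_all add: triple_weight_def)
  qed
  also have "\<dots> = 10 * (\<integral>\<^sup>+x. ?F (\<lambda>i. coord i x) \<partial>delta6)"
    by (subst sum_list_triv) (simp add: triple_perms_def)
  also have "\<dots> \<le> 10 * (ennreal (128 * pi ^ 3) * ?I)" by (intro mult_left_mono F1) simp
  also have "\<dots> = 8 * (ennreal (160 * pi ^ 3) * ?I)"
  proof -
    have "ennreal 10 * ennreal (128 * pi ^ 3) = ennreal 8 * ennreal (160 * pi ^ 3)"
      by (subst (1 2) ennreal_mult[symmetric]) auto
    then show ?thesis by (simp add: mult.assoc[symmetric])
  qed
  finally have "(\<integral>\<^sup>+x. h (coord 0 x) \<partial>delta6) \<le> ennreal (160 * pi ^ 3) * ?I"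
    by (subst (asm) ennreal_mult_le_mult_iff) auto
  also have "(\<integral>\<^sup>+x. h (coord 0 x) \<partial>delta6) = (\<integral>\<^sup>+x. h (coord i x) \<partial>delta6)"
    using nn_integral_perm6[of "Transposition.transpose 0 i" "\<lambda>a. h (a 0)"] i
    by (simp add: perm6_transpose)
  finally show ?thesis .
qed

lemma integrable_coord:
  fixes h :: "complex \<Rightarrow> real"
  assumes h: "integrable circle_measure h" and i: "i < 6"
  shows "integrable delta6 (\<lambda>x. h (coord i x))"
    and "(\<integral>x. \<bar>h (coord i x)\<bar> \<partial>delta6) \<le> 160 * pi ^ 3 * (\<integral>w. \<bar>h w\<bar> \<partial>circle_measure)"
proof -
  have [measurable]: "h \<in> borel_measurable circle_measure" using h by auto
  have b: "(\<integral>\<^sup>+x. ennreal \<bar>h (coord i x)\<bar> \<partial>delta6) \<le> ennreal (160 * pi ^ 3 * (\<integral>w. \<bar>h w\<bar> \<partial>circle_measure))"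
  proof -
    have "(\<integral>\<^sup>+x. ennreal \<bar>h (coord i x)\<bar> \<partial>delta6) \<le> ennreal (160 * pi ^ 3) * (\<integral>\<^sup>+w. ennreal \<bar>h w\<bar> \<partial>circle_measure)"
      by (rule nn_integral_coord_bound[of "\<lambda>w. ennreal \<bar>h w\<bar>"]) (use i in auto)
    also have "(\<integral>\<^sup>+w. ennreal \<bar>h w\<bar> \<partial>circle_measure) = ennreal (\<integral>w. \<bar>h w\<bar> \<partial>circle_measure)"
      using h by (intro nn_integral_eq_integral) auto
    finally show ?thesis by (simp add: ennreal_mult)
  qed
  show int: "integrable delta6 (\<lambda>x. h (coord i x))"
  proof (rule integrableI_bounded)
    show "(\<integral>\<^sup>+x. ennreal (norm (h (coord i x))) \<partial>delta6) < \<infinity>"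
      using b by (simp add: le_less_trans ennreal_less_top)
  qed measurable
  have "ennreal (\<integral>x. \<bar>h (coord i x)\<bar> \<partial>delta6) = (\<integral>\<^sup>+x. ennreal \<bar>h (coord i x)\<bar> \<partial>delta6)"
    using int by (intro nn_integral_eq_integral[symmetric]) auto
  with b show "(\<integral>x. \<bar>h (coord i x)\<bar> \<partial>delta6) \<le> 160 * pi ^ 3 * (\<integral>w. \<bar>h w\<bar> \<partial>circle_measure)"
    by (subst ennreal_le_iff[symmetric]) (auto intro!: mult_nonneg_nonneg)
qed

lemma sum_squared_le:
  fixes f :: "nat \<Rightarrow> real"
  shows "(\<Sum>i<6. f i)\<^sup>2 \<le> 6 * (\<Sum>i<6. (f i)\<^sup>2)"
  using sum_squared_le_sum_of_squares[of f "{..<6}"] by simp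

definition moment :: "(complex \<Rightarrow> real) \<Rightarrow> complex6 \<Rightarrow> complex" where
  "moment g x = (\<Sum>i<6. g (coord i x) *\<^sub>R coord i x)"

text \<open>The first-order part in g of \<open>cubic_diff (\<lambda>w. 1 + g w)\<close>.\<close>

definition linear_diff :: "(complex \<Rightarrow> real) \<Rightarrow> complex6 \<Rightarrow> real" where
  "linear_diff g x = g (coord 0 x) + g (coord 1 x) + g (coord 2 x)
     - g (coord 3 x) - g (coord 4 x) - g (coord 5 x)"

definition weight :: "complex6 \<Rightarrow> real" where
  "weight x = (norm (coord 3 x + coord 4 x + coord 5 x))\<^sup>2 - 1"

lemma moment_measurable [measurable]:
  assumes [measurable]: "g \<in> borel_measurable circle_measure"
  shows "moment g \<in> borel_measurable delta6"
  unfolding moment_def[abs_def] by measurable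

lemma linear_diff_measurable [measurable]:
  assumes [measurable]: "g \<in> borel_measurable circle_measure"
  shows "linear_diff g \<in> borel_measurable delta6"
  unfolding linear_diff_def[abs_def] by measurable

lemma weight_measurable [measurable]: "weight \<in> borel_measurable delta6"
  unfolding weight_def[abs_def] by measurable

lemma AE_weight: "AE x in delta6. weight x = triple_weight (\<lambda>i. coord i x) \<and> \<bar>weight x\<bar> \<le> 8"
  using AE_delta6_config
proof eventually_elim
  fix x assume x: "(\<forall>i. norm (coord i x) = 1) \<and> (\<Sum>i<6. coord i x) = 0"
  have "coord 0 x + coord 1 x + coord 2 x + (coord 3 x + coord 4 x + coord 5 x) = 0"
    using x by (simp add: eval_nat_numeral add.assoc)
  then have "coord 0 x + coord 1 x + coord 2 x = - (coord 3 x + coord 4 x + coord 5 x)"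
    by (rule eq_neg_iff_add_eq_0[THEN iffD2])
  then have "norm (coord 0 x + coord 1 x + coord 2 x) = norm (coord 3 x + coord 4 x + coord 5 x)"
    by (metis norm_minus_cancel)
  then have w: "weight x = triple_weight (\<lambda>i. coord i x)" by (simp add: weight_def triple_weight_def)
  then show "weight x = triple_weight (\<lambda>i. coord i x) \<and> \<bar>weight x\<bar> \<le> 8"
    using abs_triple_weight_le[of "\<lambda>i. coord i x"] x by simp
qed

lemma L2_circleD:
  assumes "g \<in> L2_circle"
  shows "g \<in> borel_measurable circle_measure" "integrable circle_measure (\<lambda>w. (g w)\<^sup>2)"
  using assms by (auto simp: L2_circle_def)

lemma integrable_coord_square:
  assumes g: "g \<in> L2_circle"
  shows "integrable delta6 (\<lambda>x. \<Sum>i<6. (g (coord i x))\<^sup>2)"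
    and "(\<integral>x. (\<Sum>i<6. (g (coord i x))\<^sup>2) \<partial>delta6) \<le> 960 * pi ^ 3 * (\<integral>w. (g w)\<^sup>2 \<partial>circle_measure)"
proof -
  note I = integrable_coord[OF L2_circleD(2)[OF g]]
  show "integrable delta6 (\<lambda>x. \<Sum>i<6. (g (coord i x))\<^sup>2)" by (intro Bochner_Integration.integrable_sum I) auto
  have "(\<integral>x. (\<Sum>i<6. (g (coord i x))\<^sup>2) \<partial>delta6) = (\<Sum>i<6. \<integral>x. (g (coord i x))\<^sup>2 \<partial>delta6)"
    by (rule Bochner_Integration.integral_sum) (use I in auto)
  also have "\<dots> \<le> (\<Sum>i<6::nat. 160 * pi ^ 3 * (\<integral>w. (g w)\<^sup>2 \<partial>circle_measure))"
    by (intro sum_mono) (use I(2) in auto)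
  finally show "(\<integral>x. (\<Sum>i<6. (g (coord i x))\<^sup>2) \<partial>delta6) \<le> 960 * pi ^ 3 * (\<integral>w. (g w)\<^sup>2 \<partial>circle_measure)"
    by simp
qed

lemma linear_diff_square_le: "(linear_diff g x)\<^sup>2 \<le> 6 * (\<Sum>i<6. (g (coord i x))\<^sup>2)"
proof -
  have "linear_diff g x = (\<Sum>i<6. if i < 3 then g (coord i x) else - g (coord i x))"
    by (simp add: linear_diff_def eval_nat_numeral)
  also have "\<dots>\<^sup>2 \<le> 6 * (\<Sum>i<6. (if i < 3 then g (coord i x) else - g (coord i x))\<^sup>2)"
    by (rule sum_squared_le)
  also have "(\<Sum>i<6. (if i < 3 then g (coord i x) else - g (coord i x))\<^sup>2) = (\<Sum>i<6. (g (coord i x))\<^sup>2)"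
    by (intro sum.cong) auto
  finally show ?thesis .
qed

lemma moment_square_le:
  assumes "\<And>i. norm (coord i x) = 1"
  shows "(norm (moment g x))\<^sup>2 \<le> 6 * (\<Sum>i<6. (g (coord i x))\<^sup>2)"
proof -
  have "norm (moment g x) \<le> (\<Sum>i<6. \<bar>g (coord i x)\<bar>)"
    unfolding moment_def by (rule order_trans[OF norm_sum]) (simp add: assms)
  then have "(norm (moment g x))\<^sup>2 \<le> (\<Sum>i<6. \<bar>g (coord i x)\<bar>)\<^sup>2" by (intro power_mono) auto
  also have "\<dots> \<le> 6 * (\<Sum>i<6. \<bar>g (coord i x)\<bar>\<^sup>2)" by (rule sum_squared_le)
  finally show ?thesis by simp
qed

lemma integrable_moment_square:
  assumes g: "g \<in> L2_circle"
  shows "integrable delta6 (\<lambda>x. (norm (moment g x))\<^sup>2)"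
    and "(\<integral>x. (norm (moment g x))\<^sup>2 \<partial>delta6) \<le> 5760 * pi ^ 3 * (\<integral>w. (g w)\<^sup>2 \<partial>circle_measure)"
proof -
  note [measurable] = L2_circleD(1)[OF g]
  have le: "AE x in delta6. (norm (moment g x))\<^sup>2 \<le> 6 * (\<Sum>i<6. (g (coord i x))\<^sup>2)"
    using AE_delta6_config by eventually_elim (auto intro: moment_square_le)
  have I: "integrable delta6 (\<lambda>x. 6 * (\<Sum>i<6. (g (coord i x))\<^sup>2))"
    using integrable_coord_square(1)[OF g] by simp
  show M: "integrable delta6 (\<lambda>x. (norm (moment g x))\<^sup>2)"
    by (rule Bochner_Integration.integrable_bound[OF I]) (measurable, use le in \<open>auto elim!: eventually_mono\<close>)
  have "(\<integral>x. (norm (moment g x))\<^sup>2 \<partial>delta6) \<le> (\<integral>x. 6 * (\<Sum>i<6. (g (coord i x))\<^sup>2) \<partial>delta6)"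
    by (rule integral_mono_AE[OF M I le])
  also have "\<dots> \<le> 6 * (960 * pi ^ 3 * (\<integral>w. (g w)\<^sup>2 \<partial>circle_measure))"
    using integrable_coord_square(2)[OF g] by simp
  finally show "(\<integral>x. (norm (moment g x))\<^sup>2 \<partial>delta6) \<le> 5760 * pi ^ 3 * (\<integral>w. (g w)\<^sup>2 \<partial>circle_measure)" by simp
qed

text \<open>Invariance makes ten times the form equal to the integral of the ten permuted
  integrands, which is pointwise 8 times the squared moment. The versions with
  \<open>\<bar>weight x\<bar>\<close> control the loss in \<open>perturbation_lower_bound\<close>;
  46080 is 8 (weight) times 6 (Cauchy-Schwarz) times 960.\<close>

lemma quadratic_form:
  assumes g: "g \<in> L2_circle"
  shows "integrable delta6 (\<lambda>x. (linear_diff g x)\<^sup>2 * weight x)"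
    and "(\<integral>x. (linear_diff g x)\<^sup>2 * weight x \<partial>delta6) = 4 / 5 * (\<integral>x. (norm (moment g x))\<^sup>2 \<partial>delta6)"
    and "integrable delta6 (\<lambda>x. (linear_diff g x)\<^sup>2 * \<bar>weight x\<bar>)"
    and "(\<integral>x. (linear_diff g x)\<^sup>2 * \<bar>weight x\<bar> \<partial>delta6) \<le> 46080 * pi ^ 3 * (\<integral>w. (g w)\<^sup>2 \<partial>circle_measure)"
proof -
  note gm [measurable] = L2_circleD(1)[OF g]
  have I: "integrable delta6 (\<lambda>x. 48 * (\<Sum>i<6. (g (coord i x))\<^sup>2))"
    using integrable_coord_square(1)[OF g] by simp
  have le: "AE x in delta6. (linear_diff g x)\<^sup>2 * \<bar>weight x\<bar> \<le> 48 * (\<Sum>i<6. (g (coord i x))\<^sup>2)"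
    using AE_weight
  proof eventually_elim
    case (elim x)
    then have "(linear_diff g x)\<^sup>2 * \<bar>weight x\<bar> \<le> (6 * (\<Sum>i<6. (g (coord i x))\<^sup>2)) * 8"
      by (intro mult_mono linear_diff_square_le) (auto intro!: sum_nonneg)
    then show ?case by simp
  qed
  show int: "integrable delta6 (\<lambda>x. (linear_diff g x)\<^sup>2 * weight x)"
    by (rule Bochner_Integration.integrable_bound[OF I]) (measurable, use le in \<open>auto elim!: eventually_mono simp: abs_mult\<close>)
  show int': "integrable delta6 (\<lambda>x. (linear_diff g x)\<^sup>2 * \<bar>weight x\<bar>)"
    by (rule Bochner_Integration.integrable_bound[OF I]) (measurable, use le in \<open>auto elim!: eventually_mono simp: abs_mult\<close>)
  have "(\<integral>x. (linear_diff g x)\<^sup>2 * \<bar>weight x\<bar> \<partial>delta6) \<le> (\<integral>x. 48 * (\<Sum>i<6. (g (coord i x))\<^sup>2) \<partial>delta6)"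
    by (rule integral_mono_AE[OF int' I le])
  also have "\<dots> \<le> 48 * (960 * pi ^ 3 * (\<integral>w. (g w)\<^sup>2 \<partial>circle_measure))"
    using integrable_coord_square(2)[OF g] by simp
  finally show "(\<integral>x. (linear_diff g x)\<^sup>2 * \<bar>weight x\<bar> \<partial>delta6) \<le> 46080 * pi ^ 3 * (\<integral>w. (g w)\<^sup>2 \<partial>circle_measure)"
    by simp
  define F where "F a = (g (a 0) + g (a 1) + g (a 2) - g (a 3) - g (a 4) - g (a 5))\<^sup>2 * triple_weight a" for a
  have Fm: "(\<lambda>x. F (\<lambda>i. coord i x)) \<in> borel_measurable circle6" unfolding F_def by measurable
  have loc: "F a = F b" if "\<And>i. i < 6 \<Longrightarrow> a i = b i" for a b
    using that unfolding F_def triple_weight_def by simp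
  have AEF: "AE x in delta6. (linear_diff g x)\<^sup>2 * weight x = F (\<lambda>i. coord i x)"
    using AE_weight by eventually_elim (simp add: F_def linear_diff_def)
  have F_int: "integrable delta6 (\<lambda>x. F (\<lambda>i. coord i x))"
    using int AEF by (subst integrable_cong_AE[symmetric]) (use Fm in \<open>auto cong: measurable_cong_sets\<close>)
  have perm: "(\<integral>x. F (\<lambda>i. coord (p i) x) \<partial>delta6) = (\<integral>x. F (\<lambda>i. coord i x) \<partial>delta6)"
    "integrable delta6 (\<lambda>x. F (\<lambda>i. coord (p i) x))" if "p \<in> set triple_perms" for p
    using integral_perm6[OF triple_perms_perm6[OF that] Fm loc] F_int by auto
  have "10 * (\<integral>x. (linear_diff g x)\<^sup>2 * weight x \<partial>delta6) = 10 * (\<integral>x. F (\<lambda>i. coord i x) \<partial>delta6)"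
    using AEF by (subst integral_cong_AE[of _ _ "\<lambda>x. F (\<lambda>i. coord i x)"]) (use Fm in \<open>auto cong: measurable_cong_sets\<close>)
  also have "\<dots> = (\<Sum>p\<leftarrow>triple_perms. \<integral>x. F (\<lambda>i. coord i x) \<partial>delta6)"
    by (subst sum_list_triv) (simp add: triple_perms_def)
  also have "\<dots> = (\<Sum>p\<leftarrow>triple_perms. \<integral>x. F (\<lambda>i. coord (p i) x) \<partial>delta6)"
    by (rule arg_cong[where f=sum_list], rule map_cong[OF refl]) (simp add: perm)
  also have "\<dots> = (\<integral>x. (\<Sum>p\<leftarrow>triple_perms. F (\<lambda>i. coord (p i) x)) \<partial>delta6)"
    by (rule integral_sum_list(1)[symmetric]) (rule perm)
  also have "\<dots> = (\<integral>x. 8 * (norm (moment g x))\<^sup>2 \<partial>delta6)"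
  proof (rule integral_cong_AE)
    show "(\<lambda>x. \<Sum>p\<leftarrow>triple_perms. F (\<lambda>i. coord (p i) x)) \<in> borel_measurable delta6"
      by (rule borel_measurable_integrable, rule integral_sum_list(2), rule perm(2))
    show "AE x in delta6. (\<Sum>p\<leftarrow>triple_perms. F (\<lambda>i. coord (p i) x)) = 8 * (norm (moment g x))\<^sup>2"
      using AE_delta6_config
    proof eventually_elim
      case (elim x)
      show ?case unfolding F_def moment_def
        by (rule triple_difference_average[of "\<lambda>i. coord i x" "\<lambda>i. g (coord i x)"]) (use elim in auto)
    qed
  qed measurable
  finally show "(\<integral>x. (linear_diff g x)\<^sup>2 * weight x \<partial>delta6) = 4 / 5 * (\<integral>x. (norm (moment g x))\<^sup>2 \<partial>delta6)"
    by simp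
qed

subsection \<open>Rigidity of the kernel of the quadratic form\<close>

definition torus4 :: "complex4 set" where
  "torus4 = sphere 0 1 \<times> sphere 0 1 \<times> sphere 0 1 \<times> sphere 0 1"

lemma compact_torus4: "compact torus4"
  unfolding torus4_def by (intro compact_Times) auto

lemma space_circle4: "space circle4 = torus4"
  by (simp add: circle4_def torus4_def space_pair_measure)

lemma circle_arc_measure_pos:
  assumes w: "w \<in> sphere 0 1" and d: "d > 0"
  shows "ball w d \<inter> sphere 0 1 \<in> sets circle_measure"
    and "emeasure circle_measure (ball w d \<inter> sphere 0 1) > 0"
proof -
  show A: "ball w d \<inter> sphere 0 1 \<in> sets circle_measure"
    by (auto simp: sets_restrict_space)
  obtain a where a: "0 \<le> a" "a < 2 * pi" "w = cis a"
    using w Arg2pi[of w] by (auto simp: is_Arg_def cis_conv_exp intro!: that[of "Arg2pi w"])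
  have "continuous_on UNIV cis" by (intro continuous_intros)
  then have "isCont cis a" by (simp add: continuous_on_eq_continuous_at)
  then obtain e where e: "e > 0" "\<And>t. dist t a < e \<Longrightarrow> dist (cis t) (cis a) < d"
    using d unfolding continuous_at_eps_delta by (metis dist_norm real_norm_def)
  \<comment> \<open>A one-sided arc starting at \<open>a\<close> is enough. Cutting it at
    \<open>2 * pi\<close> keeps it in the parameter interval even when \<open>a\<close> is close to
    the end.\<close>
  define b where "b = min (a + e) (2 * pi)"
  have ab: "a < b" using a e by (auto simp: b_def)
  have "0 < emeasure lborel {a..<b}" using ab by simp
  also have "\<dots> = (\<integral>\<^sup>+t. indicator {a..<b} t \<partial>lborel)" by simp
  also have "\<dots> \<le> (\<integral>\<^sup>+t. indicator (ball w d \<inter> sphere 0 1) (cis t) * indicator {0..<2 * pi} t \<partial>lborel)"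
  proof (rule nn_integral_mono)
    fix t
    have "cis t \<in> ball w d" if "t \<in> {a..<b}"
      using e(2)[of t] that a by (auto simp: b_def dist_real_def dist_commute)
    then show "indicator {a..<b} t \<le> (indicator (ball w d \<inter> sphere 0 1) (cis t) * indicator {0..<2 * pi} t :: ennreal)"
      using a by (auto split: split_indicator simp: b_def)
  qed
  also have "\<dots> = (\<integral>\<^sup>+w'. indicator (ball w d \<inter> sphere 0 1) w' \<partial>circle_measure)"
    using A by (intro nn_integral_circle[symmetric]) simp
  also have "\<dots> = emeasure circle_measure (ball w d \<inter> sphere 0 1)"
    using A by (rule nn_integral_indicator)
  finally show "emeasure circle_measure (ball w d \<inter> sphere 0 1) > 0" .
qed

lemma nn_integral_pos_box:
  fixes f :: "'a \<Rightarrow> real"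
  assumes "B \<in> sets M" "emeasure M B > 0" "e > 0" "\<And>x. x \<in> B \<Longrightarrow> e \<le> f x"
  shows "(\<integral>\<^sup>+x. ennreal (f x) \<partial>M) > 0"
proof -
  have "0 < ennreal e * emeasure M B" using assms by (simp add: ennreal_zero_less_mult_iff)
  also have "\<dots> = (\<integral>\<^sup>+x. ennreal e * indicator B x \<partial>M)"
    using assms by (simp add: nn_integral_cmult_indicator)
  also have "\<dots> \<le> (\<integral>\<^sup>+x. ennreal (f x) \<partial>M)"
    using assms by (intro nn_integral_mono) (auto split: split_indicator intro: ennreal_leI)
  finally show ?thesis .
qed

lemma dist_Pair_le: "dist (a, b) (c, d) \<le> dist a c + dist b d"
  unfolding dist_Pair_Pair by (rule sqrt_sum_squares_le_sum) auto

lemma circle3_box: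
  assumes w: "w1 \<in> sphere 0 1" "w2 \<in> sphere 0 1" "w3 \<in> sphere 0 1" and e: "e > 0"
  obtains B where "B \<in> sets (circle_measure \<Otimes>\<^sub>M circle_measure \<Otimes>\<^sub>M circle_measure)"
    "emeasure (circle_measure \<Otimes>\<^sub>M circle_measure \<Otimes>\<^sub>M circle_measure) B > 0"
    "B \<subseteq> sphere 0 1 \<times> sphere 0 1 \<times> sphere 0 1"
    "\<And>p. p \<in> B \<Longrightarrow> dist p (w1, w2, w3) < e"
proof
  let ?A = "\<lambda>w. ball w (e / 3) \<inter> sphere (0::complex) 1"
  let ?B = "?A w1 \<times> ?A w2 \<times> ?A w3"
  have A: "?A w \<in> sets circle_measure" "emeasure circle_measure (?A w) > 0" if "w \<in> sphere 0 1" for w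
    using circle_arc_measure_pos[of w "e / 3"] that e by auto
  show "?B \<in> sets (circle_measure \<Otimes>\<^sub>M circle_measure \<Otimes>\<^sub>M circle_measure)"
    using A w by (intro pair_measureI) auto
  show "emeasure (circle_measure \<Otimes>\<^sub>M circle_measure \<Otimes>\<^sub>M circle_measure) ?B > 0"
    using A w
    by (subst circle_pair.emeasure_pair_measure_Times, (auto intro!: pair_measureI)[2])
       (simp add: circle.emeasure_pair_measure_Times ennreal_zero_less_mult_iff)
  show "?B \<subseteq> sphere 0 1 \<times> sphere 0 1 \<times> sphere 0 1" by auto
  fix p assume p: "p \<in> ?B"
  obtain p1 p2 p3 where P: "p = (p1, p2, p3)" by (cases p)
  have "dist p (w1, w2, w3) \<le> dist p1 w1 + (dist p2 w2 + dist p3 w3)"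
    unfolding P by (rule order_trans[OF dist_Pair_le add_left_mono[OF dist_Pair_le]])
  also have "\<dots> < e / 3 + (e / 3 + e / 3)" using p unfolding P by (intro add_strict_mono) (auto simp: dist_commute)
  finally show "dist p (w1, w2, w3) < e" by simp
qed

lemma nn_integral_circle4_pos:
  fixes f :: "complex4 \<Rightarrow> real"
  assumes x: "x \<in> torus4" and c: "continuous (at x within torus4) f" and pos: "f x > 0"
  shows "(\<integral>\<^sup>+x. ennreal (f x) \<partial>circle4) > 0"
proof -
  obtain w0 w1 w2 w3 where X: "x = (w0, w1, w2, w3)" by (cases x)
  have w: "w0 \<in> sphere 0 1" "w1 \<in> sphere 0 1" "w2 \<in> sphere 0 1" "w3 \<in> sphere 0 1"
    using x by (auto simp: X torus4_def)
  obtain d where d: "d > 0" "\<And>z. z \<in> torus4 \<Longrightarrow> dist z x < d \<Longrightarrow> dist (f z) (f x) < f x / 2"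
    using c pos unfolding continuous_within_eps_delta by (metis dist_norm half_gt_zero)
  obtain B where B: "B \<in> sets (circle_measure \<Otimes>\<^sub>M circle_measure \<Otimes>\<^sub>M circle_measure)"
    "emeasure (circle_measure \<Otimes>\<^sub>M circle_measure \<Otimes>\<^sub>M circle_measure) B > 0"
    "B \<subseteq> sphere 0 1 \<times> sphere 0 1 \<times> sphere 0 1" "\<And>p. p \<in> B \<Longrightarrow> dist p (w1, w2, w3) < d / 2"
    using circle3_box[of w1 w2 w3 "d / 2"] w d(1) by auto
  let ?A = "ball w0 (d / 2) \<inter> sphere 0 1"
  have A: "?A \<in> sets circle_measure" "emeasure circle_measure ?A > 0"
    using circle_arc_measure_pos[of w0 "d / 2"] w d(1) by auto
  show ?thesis
  proof (rule nn_integral_pos_box)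
    show "?A \<times> B \<in> sets circle4" unfolding circle4_def using A B by (intro pair_measureI)
    show "emeasure circle4 (?A \<times> B) > 0"
      unfolding circle4_def using A B
      by (subst circle3.emeasure_pair_measure_Times) (auto simp: ennreal_zero_less_mult_iff)
    show "0 < f x / 2" using pos by simp
    fix z assume z: "z \<in> ?A \<times> B"
    obtain a p where Z: "z = (a, p)" by (cases z)
    have "dist z x \<le> dist a w0 + dist p (w1, w2, w3)" unfolding Z X by (rule dist_Pair_le)
    also have "\<dots> < d / 2 + d / 2" using z B(4) unfolding Z by (intro add_strict_mono) (auto simp: dist_commute)
    finally have "dist z x < d" by simp
    moreover have "z \<in> torus4" using z B(3) unfolding Z torus4_def by auto
    ultimately have "dist (f z) (f x) < f x / 2" by (intro d(2))
    then show "f x / 2 \<le> f z" unfolding dist_real_def by linarith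
  qed
qed

lemma isCont_pts:
  assumes "0 < norm y" "norm y < 2"
  shows "isCont first_pt y" "isCont second_pt y" "isCont pair_weight y"
proof -
  let ?U = "{y::complex. 0 < norm y} \<inter> {y. norm y < 2}"
  have U: "open ?U" by (intro open_Int open_Collect_less continuous_intros)
  have y: "y \<in> ?U" using assms by auto
  have s4: "4 - (norm x)\<^sup>2 > 0" if "x \<in> ?U" for x :: complex
    using that power_strict_mono[of "norm x" 2 2] by auto
  have f: "continuous_on ?U first_pt"
  proof (rule continuous_on_eq)
    show "continuous_on ?U (\<lambda>y::complex. y / 2 + \<i> * sgn y * of_real (sqrt (1 - (norm y)\<^sup>2 / 4)))"
      by (intro continuous_intros) auto
  qed (auto simp: first_pt_def)
  have g: "continuous_on ?U second_pt"
  proof (rule continuous_on_eq)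
    show "continuous_on ?U (\<lambda>y. y - first_pt y)" by (intro continuous_intros f)
  qed (auto simp: second_pt_def)
  have h: "continuous_on ?U pair_weight"
  proof (rule continuous_on_eq)
    show "continuous_on ?U (\<lambda>y::complex. 2 / (norm y * sqrt (4 - (norm y)\<^sup>2)))"
      using s4 by (intro continuous_intros) force
  qed (auto simp: pair_weight_def)
  show "isCont first_pt y" "isCont second_pt y" "isCont pair_weight y"
    using continuous_on_eq_continuous_at[OF U] f g h y by auto
qed

lemma neg_sum4_tendsto: "(neg_sum4 \<longlongrightarrow> neg_sum4 x) (at x within S)"
proof -
  have eq: "neg_sum4 = (\<lambda>x. - (fst x + fst (snd x) + fst (snd (snd x)) + snd (snd (snd x))))"
    by (auto simp: neg_sum4_def fun_eq_iff)
  show ?thesis unfolding eq by (intro tendsto_intros)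
qed

lemma moment_tendsto:
  fixes F :: "'a filter"
  assumes g: "continuous_on (sphere 0 1) g"
    and c: "\<And>i. i < 6 \<Longrightarrow> ((\<lambda>z. coord i (f z)) \<longlongrightarrow> coord i y) F"
    and n: "\<And>i. norm (coord i y) = 1" "\<forall>\<^sub>F z in F. \<forall>i. norm (coord i (f z)) = 1"
  shows "((\<lambda>z. moment g (f z)) \<longlongrightarrow> moment g y) F"
proof -
  have gt: "((\<lambda>z. g (coord i (f z))) \<longlongrightarrow> g (coord i y)) F" if i: "i < 6" for i
    by (rule continuous_on_tendsto_compose[OF g c[OF i]]) (use n in \<open>auto elim!: eventually_mono\<close>)
  show ?thesis unfolding moment_def by (intro tendsto_intros gt c) auto
qed

text \<open>If the moment were nonzero at one configuration, continuity would keep it nonzero on a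
  box of positive measure. The condition on |w4 + w5| keeps away from the values where the
  determined pair jumps. The order of that pair does not matter because the moment is symmetric, so
  \<open>lift1\<close> alone suffices.\<close>

lemma moment_eq_0_pointwise:
  assumes g: "continuous_on (sphere 0 1) g" "g \<in> L2_circle"
    and z: "(\<integral>x. (norm (moment g x))\<^sup>2 \<partial>delta6) = 0"
    and w: "norm w0 = 1" "norm w1 = 1" "norm w2 = 1" "norm w3 = 1" "norm w4 = 1" "norm w5 = 1"
    and sum: "w0 + w1 + w2 + w3 + w4 + w5 = 0" and y: "0 < norm (w4 + w5)" "norm (w4 + w5) < 2"
  shows "g w0 *\<^sub>R w0 + g w1 *\<^sub>R w1 + g w2 *\<^sub>R w2 + g w3 *\<^sub>R w3 + g w4 *\<^sub>R w4 + g w5 *\<^sub>R w5 = 0"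
proof (rule ccontr)
  assume ne: "\<not> ?thesis"
  let ?x = "(w0, w1, w2, w3)"
  have ns: "neg_sum4 ?x = w4 + w5" using sum by (simp add: neg_sum4_def add_eq_0_iff algebra_simps)
  have x: "?x \<in> torus4" using w by (simp add: torus4_def)
  have "(w4, w5) \<in> circle_pairs (w4 + w5)" using w by (simp add: circle_pairs_def)
  then have pts: "(w4 = first_pt (w4 + w5) \<and> w5 = second_pt (w4 + w5))
      \<or> (w4 = second_pt (w4 + w5) \<and> w5 = first_pt (w4 + w5))"
    using circle_pairs_eq(1)[OF y] by auto
  have "moment g (lift1 ?x) = g w0 *\<^sub>R w0 + g w1 *\<^sub>R w1 + g w2 *\<^sub>R w2 + g w3 *\<^sub>R w3
     + g (first_pt (w4 + w5)) *\<^sub>R first_pt (w4 + w5) + g (second_pt (w4 + w5)) *\<^sub>R second_pt (w4 + w5)"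
    by (simp add: moment_def coord_lift ns eval_nat_numeral add.assoc)
  also have "\<dots> = g w0 *\<^sub>R w0 + g w1 *\<^sub>R w1 + g w2 *\<^sub>R w2 + g w3 *\<^sub>R w3 + g w4 *\<^sub>R w4 + g w5 *\<^sub>R w5"
    using pts by (elim disjE conjE) (metis, metis add.assoc add.commute)
  finally have m: "moment g (lift1 ?x) \<noteq> 0" using ne by simp
  let ?f = "\<lambda>x. (norm (moment g (lift1 x)))\<^sup>2 * pair_weight (neg_sum4 x)"
  have "pair_weight (neg_sum4 ?x) > 0"
  proof -
    have "4 - (norm (w4 + w5))\<^sup>2 > 0" using y power_strict_mono[of "norm (w4 + w5)" 2 2] by auto
    then show ?thesis unfolding ns using y by (simp add: pair_weight_def)
  qed
  then have pos: "?f ?x > 0" using m by simp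
  have "continuous (at ?x within torus4) ?f"
    unfolding continuous_within
  proof (intro tendsto_intros)
    have nt: "(neg_sum4 \<longlongrightarrow> w4 + w5) (at ?x within torus4)" using neg_sum4_tendsto[of ?x torus4] ns by simp
    show "((\<lambda>x. pair_weight (neg_sum4 x)) \<longlongrightarrow> pair_weight (neg_sum4 ?x)) (at ?x within torus4)"
      unfolding ns by (rule isCont_tendsto_compose[OF isCont_pts(3)[OF y] nt])
    have ft: "((\<lambda>x. first_pt (neg_sum4 x)) \<longlongrightarrow> first_pt (w4 + w5)) (at ?x within torus4)"
      by (rule isCont_tendsto_compose[OF isCont_pts(1)[OF y] nt])
    have st: "((\<lambda>x. second_pt (neg_sum4 x)) \<longlongrightarrow> second_pt (w4 + w5)) (at ?x within torus4)"
      by (rule isCont_tendsto_compose[OF isCont_pts(2)[OF y] nt])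
    have cl: "coord i (lift1 z) = (if i = 0 then fst z else if i = 1 then fst (snd z) else if i = 2 then fst (snd (snd z))
      else if i = 3 then snd (snd (snd z)) else if i = 4 then first_pt (neg_sum4 z) else second_pt (neg_sum4 z))" for i z
      by (cases z) (auto simp: coord_lift)
    show "((\<lambda>x. moment g (lift1 x)) \<longlongrightarrow> moment g (lift1 ?x)) (at ?x within torus4)"
    proof (rule moment_tendsto[OF g(1)])
      show "((\<lambda>z. coord i (lift1 z)) \<longlongrightarrow> coord i (lift1 ?x)) (at ?x within torus4)" for i
        unfolding cl using ft st by (auto simp: ns intro!: tendsto_eq_intros)
      show "norm (coord i (lift1 ?x)) = 1" for i unfolding cl using w by auto
      have "\<forall>\<^sub>F z in at ?x within torus4. z \<in> torus4" by (simp add: eventually_at_filter)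
      then show "\<forall>\<^sub>F z in at ?x within torus4. \<forall>i. norm (coord i (lift1 z)) = 1"
        by eventually_elim (auto simp: cl torus4_def)
    qed
  qed
  from nn_integral_circle4_pos[OF x this pos]
  have P: "(\<integral>\<^sup>+x. ennreal (?f x) \<partial>circle4) > 0" .
  note [measurable] = L2_circleD(1)[OF g(2)]
  let ?F = "\<lambda>x. ennreal ((norm (moment g x))\<^sup>2)"
  have Fm: "?F \<in> borel_measurable circle6"
    using moment_measurable[OF L2_circleD(1)[OF g(2)]] by (simp cong: measurable_cong_sets)
  have "(\<integral>\<^sup>+x. ennreal (?f x) \<partial>circle4) \<le> (\<integral>\<^sup>+x. (?F (lift1 x) + ?F (lift2 x)) * ennreal (pair_weight (neg_sum4 x)) \<partial>circle4)"
    by (intro nn_integral_mono) (simp add: ennreal_mult distrib_right)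
  also have "\<dots> = (\<integral>\<^sup>+x. ?F x \<partial>delta6)"
    by (rule nn_integral_delta6_lift[OF Fm, symmetric])
  also have "\<dots> = ennreal (\<integral>x. (norm (moment g x))\<^sup>2 \<partial>delta6)"
    by (rule nn_integral_eq_integral) (use integrable_moment_square(1)[OF g(2)] in auto)
  finally show False using P z by simp
qed

text \<open>The configurations give a scaling relation by the factor -2 for the sum of g over two
  points symmetric about \<open>cis b\<close>. Iterated towards 0 and combined with continuity, it
  makes this sum independent of the two points. So g at \<open>cis b\<close> is the mean of g over
  any such pair, and a maximum of g spreads to the whole circle.\<close>

lemma moment_eq_0_imp_constant:
  assumes g: "continuous_on (sphere 0 1) g" "g \<in> L2_circle"
    and z: "(\<integral>x. (norm (moment g x))\<^sup>2 \<partial>delta6) = 0"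
  shows "\<exists>c. \<forall>w \<in> sphere 0 1. g w = c"
proof -
  \<comment> \<open>\<open>x\<close> is the common projection of the two points onto
    \<open>cis b\<close>; the value x = 1 is the doubled point \<open>cis b\<close> itself.\<close>
  define G where "G b x = g (cis (b + arccos x)) + g (cis (b - arccos x))" for b x
  have halving: "G b (- 2 * x) = G b x" if x: "x \<noteq> 0" "\<bar>x\<bar> \<le> 1 / 2" for b x
  proof -
    define s where "s = arccos x"
    define t where "t = arccos (- 2 * x)"
    have cs: "cos s = x" using x by (auto simp: s_def abs_le_iff intro!: cos_arccos)
    have ct: "cos t = - 2 * x" using x by (auto simp: t_def abs_le_iff intro!: cos_arccos)
    have pair: "cis (b + r) + cis (b - r) = of_real (2 * cos r) * cis b" for r
      by (simp add: complex_eq_iff cos_add cos_diff sin_add sin_diff)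
    \<comment> \<open>The condition 0 < |x| <= 1/2 does two things: it makes arccos (-2 x) a genuine
      angle, and it puts the length 2 |x| of the last pair strictly between 0 and 2.\<close>
    have nrm: "norm (cis (b + s) + cis (b - s)) = 2 * \<bar>x\<bar>"
      unfolding pair cs by (simp add: norm_mult)
    have "g (cis (b + t)) *\<^sub>R cis (b + t) + g (cis (b - t)) *\<^sub>R cis (b - t)
      + g (cis (b + s)) *\<^sub>R cis (b + s) + g (cis (b - s)) *\<^sub>R cis (b - s)
      + g (cis (b + s)) *\<^sub>R cis (b + s) + g (cis (b - s)) *\<^sub>R cis (b - s) = 0"
    proof (rule moment_eq_0_pointwise[OF g z])
      have "cis (b + t) + cis (b - t) + cis (b + s) + cis (b - s) + cis (b + s) + cis (b - s)
        = (cis (b + t) + cis (b - t)) + (cis (b + s) + cis (b - s)) + (cis (b + s) + cis (b - s))"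
        by (simp only: add.assoc)
      also have "\<dots> = 0" unfolding pair cs ct by (simp add: algebra_simps)
      finally show "cis (b + t) + cis (b - t) + cis (b + s) + cis (b - s) + cis (b + s) + cis (b - s) = 0" .
    qed (use x nrm in auto)
    then have "(g (cis (b + t)) *\<^sub>R cis (b + t) + g (cis (b - t)) *\<^sub>R cis (b - t)
      + g (cis (b + s)) *\<^sub>R cis (b + s) + g (cis (b - s)) *\<^sub>R cis (b - s)
      + g (cis (b + s)) *\<^sub>R cis (b + s) + g (cis (b - s)) *\<^sub>R cis (b - s)) \<bullet> cis b = 0"
      by simp
    moreover have "cis (b + r) \<bullet> cis b = cos r" "cis (b - r) \<bullet> cis b = cos r" for r
      using cos_diff[of "b + r" b] cos_diff[of "b - r" b] by (simp_all add: inner_complex_def)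
    ultimately have "g (cis (b + t)) * cos t + g (cis (b - t)) * cos t + g (cis (b + s)) * cos s + g (cis (b - s)) * cos s
      + g (cis (b + s)) * cos s + g (cis (b - s)) * cos s = 0"
      by (simp only: inner_add_left inner_scaleR_left)
    then have "cos t * (g (cis (b + t)) + g (cis (b - t))) + 2 * cos s * (g (cis (b + s)) + g (cis (b - s))) = 0"
      by (simp add: algebra_simps)
    then have "2 * x * (g (cis (b + s)) + g (cis (b - s))) = 2 * x * (g (cis (b + t)) + g (cis (b - t)))"
      unfolding cs ct by simp
    then show ?thesis using x(1) unfolding G_def s_def t_def by simp
  qed
  have Gc: "continuous_on {-1..1} (G b)" for b
    unfolding G_def
    by (intro continuous_on_add continuous_on_compose2[OF g(1)] continuous_intros) auto
  have G0: "G b x = G b 0" if x: "\<bar>x\<bar> \<le> 1" for b x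
  proof (cases "x = 0")
    case False
    \<comment> \<open>The relation is applied backwards, from -2 u to u. Every u that occurs has
      absolute value at most 1/2, so \<open>halving\<close> applies.\<close>
    have it: "G b ((- (1/2)) ^ n * x) = G b x" for n
    proof (induction n)
      case (Suc n)
      let ?u = "(- (1/2)) ^ Suc n * x"
      have "\<bar>?u\<bar> \<le> 1 / 2"
        using x power_le_one[of "1/2::real" n] by (simp add: abs_mult power_abs mult_le_one)
      then have "G b (- 2 * ?u) = G b ?u" using False by (intro halving) auto
      then show ?case using Suc by simp
    qed simp
    have "(\<lambda>n. (- (1/2)) ^ n * x) \<longlonglongrightarrow> 0 * x" by (intro tendsto_intros LIMSEQ_power_zero) auto
    then have "(\<lambda>n. G b ((- (1/2)) ^ n * x)) \<longlonglongrightarrow> G b 0"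
    proof (intro continuous_on_tendsto_compose[OF Gc])
      have "\<bar>(- (1/2)) ^ n * x\<bar> \<le> 1" for n
        using x power_le_one[of "1/2::real" n] by (simp add: abs_mult power_abs mult_le_one)
      then show "\<forall>\<^sub>F n in sequentially. (- (1/2)) ^ n * x \<in> {-1..1}"
        by (auto simp: abs_le_iff minus_le_iff)
    qed auto
    then have "(\<lambda>n. G b x) \<longlonglongrightarrow> G b 0" unfolding it .
    then show ?thesis by (rule LIMSEQ_const_iff[THEN iffD1])
  qed simp
  have mid: "g (cis (b + t)) + g (cis (b - t)) = 2 * g (cis b)" if "0 \<le> t" "t \<le> pi" for b t
    using G0[of "cos t" b] G0[of 1 b] that by (simp add: G_def arccos_cos)
  obtain w0 where w0: "w0 \<in> sphere 0 1" "\<And>w. w \<in> sphere 0 1 \<Longrightarrow> g w \<le> g w0"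
    using continuous_attains_sup[OF _ _ g(1)] by force
  obtain b where b: "w0 = cis b"
    using w0(1) Arg2pi[of w0] by (auto simp: is_Arg_def cis_conv_exp intro!: that[of "Arg2pi w0"])
  have "g w = g w0" if w: "w \<in> sphere 0 1" for w
  proof -
    have "norm (w / w0) = 1" using w w0 by (simp add: norm_divide)
    moreover from this have "w / w0 \<noteq> 0" by (metis norm_zero zero_neq_one)
    ultimately have "w / w0 = cis (Arg (w / w0))" using cis_Arg[of "w / w0"] by (auto simp: sgn_div_norm)
    define r where "r = Arg (w / w0)"
    have r: "-pi < r" "r \<le> pi" using Arg_bounded[of "w / w0"] by (auto simp: r_def)
    have "w = w0 * (w / w0)" using \<open>norm (w / w0) = 1\<close> by auto
    also have "\<dots> = w0 * cis r" unfolding r_def by (rule arg_cong) (rule \<open>w / w0 = _\<close>)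
    finally have wr: "w = cis (b + r)" by (simp add: b cis_mult)
    have "g (cis (b + \<bar>r\<bar>)) + g (cis (b - \<bar>r\<bar>)) = 2 * g w0" unfolding b using r by (intro mid) auto
    moreover have "g (cis (b + \<bar>r\<bar>)) \<le> g w0" "g (cis (b - \<bar>r\<bar>)) \<le> g w0" using w0(2) by auto
    moreover have "w = cis (b + \<bar>r\<bar>) \<or> w = cis (b - \<bar>r\<bar>)" unfolding wr by (cases "r \<ge> 0") auto
    ultimately show ?thesis by (elim disjE) auto
  qed
  then show ?thesis by blast
qed

subsection \<open>Averaging operators\<close>

text \<open>This is 4 / (pair_weight z)^2 for 0 < |z| < 2, so it vanishes exactly where the pair
  weight is singular and \<open>psi\<close> times \<open>pair_weight\<close> tends to 0
  there.\<close>

definition psi :: "complex \<Rightarrow> real" where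
  "psi z = (norm z)\<^sup>2 * (4 - (norm z)\<^sup>2)"

lemma psi_bounds:
  assumes "norm z \<le> 2"
  shows "0 \<le> psi z" "psi z \<le> 4"
proof -
  have "(norm z)\<^sup>2 \<le> 4" using power_mono[OF assms, of 2] by simp
  then show "0 \<le> psi z" by (simp add: psi_def)
  have "0 \<le> ((norm z)\<^sup>2 - 2)\<^sup>2" by simp
  then show "psi z \<le> 4" by (simp add: psi_def power2_eq_square algebra_simps)
qed

lemma psi_sum_bounds:
  assumes "norm a = 1" "norm b = 1"
  shows "0 \<le> psi (a + b)" "psi (a + b) \<le> 4"
  using psi_bounds[of "a + b"] norm_triangle_ineq[of a b] assms by auto

text \<open>Multiplying by the cutoff removes the singularities of the pair weight, also after any of the
  permutations of the indices \<open>1, 4, 5\<close> (counted from \<open>0\<close>), under which the cutoff is invariant.\<close>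

definition cutoff :: "(nat \<Rightarrow> complex) \<Rightarrow> real" where
  "cutoff a = psi (a 4 + a 5) * (psi (a 1 + a 5) * psi (a 1 + a 4))"

lemma cutoff_bounds:
  assumes "\<And>i. norm (a i) = 1"
  shows "0 \<le> cutoff a" "cutoff a \<le> 64"
proof -
  have p: "0 \<le> psi (a i + a j)" "psi (a i + a j) \<le> 4" for i j by (rule psi_sum_bounds[OF assms assms])+
  have "psi (a 1 + a 5) * psi (a 1 + a 4) \<le> 4 * 4" by (intro mult_mono p) auto
  then show "cutoff a \<le> 64"
    unfolding cutoff_def using mult_mono[OF p(2)[of 4 5], of "psi (a 1 + a 5) * psi (a 1 + a 4)" 16] p by simp
  show "0 \<le> cutoff a" unfolding cutoff_def by (intro mult_nonneg_nonneg p)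
qed

lemma psi_measurable [measurable]: "psi \<in> borel_measurable borel"
  unfolding psi_def[abs_def] by measurable

lemma cutoff_measurable [measurable]: "(\<lambda>x. cutoff (\<lambda>i. coord i x)) \<in> borel_measurable circle6"
  unfolding cutoff_def by measurable

definition kern :: "complex4 \<Rightarrow> real" where
  "kern x = cutoff (\<lambda>i. coord i (lift1 x)) * pair_weight (neg_sum4 x)"

lemma cutoff_lift2: "cutoff (\<lambda>i. coord i (lift2 x)) = cutoff (\<lambda>i. coord i (lift1 x))"
  by (cases x) (simp add: cutoff_def coord_lift add.commute mult.commute)

lemma kern_measurable: "kern \<in> borel_measurable circle4"
  unfolding kern_def[abs_def] using measurable_compose[OF lift_measurable(1) cutoff_measurable] by measurable

text \<open>The right-hand side is continuous on the whole plane; \<open>max 0\<close> makes it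
  vanish for |y| >= 2, as the pair weight does.\<close>

lemma psi_pair_weight:
  "psi (first_pt y + second_pt y) * pair_weight y = 2 * norm y * sqrt (max 0 (4 - (norm y)\<^sup>2))"
proof (cases "0 < norm y \<and> norm y < 2")
  case True
  define r where "r = norm y"
  define t where "t = sqrt (4 - r\<^sup>2)"
  have D: "4 - r\<^sup>2 > 0" using True power_strict_mono[of r 2 2] by (auto simp: r_def)
  then have t: "t > 0" "4 - r\<^sup>2 = t\<^sup>2" by (auto simp: t_def)
  have "first_pt y + second_pt y = y" using True by (simp add: second_pt_def)
  then have "psi (first_pt y + second_pt y) * pair_weight y = r\<^sup>2 * t\<^sup>2 * (2 / (r * t))"
    using True by (simp add: psi_def pair_weight_def t_def[symmetric] r_def[symmetric] t(2)[symmetric])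
  also have "\<dots> = 2 * r * t" using t True by (simp add: power2_eq_square r_def)
  finally show ?thesis using D unfolding t_def r_def by (simp add: max_def)
next
  case False
  then have "pair_weight y = 0" by (auto simp: pair_weight_def)
  moreover have "4 - (norm y)\<^sup>2 \<le> 0 \<or> y = 0"
    using False power_mono[of 2 "norm y" 2] by auto
  ultimately show ?thesis by (auto simp: max_def)
qed

lemma kern_eq: "kern (w0, w1, w2, w3) = (let y = neg_sum4 (w0, w1, w2, w3) in
    2 * norm y * sqrt (max 0 (4 - (norm y)\<^sup>2)) * (psi (w1 + second_pt y) * psi (w1 + first_pt y)))"
  unfolding Let_def psi_pair_weight[symmetric] kern_def cutoff_def by (simp add: coord_lift mult_ac)

text \<open>The second bound involves the determined pair only through its sum, so it remains useful
  where the pair jumps. The last one uses |y| <= 4: 32 * 4 * 2 = 256.\<close>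

lemma kern_bounds:
  assumes "x \<in> torus4"
  shows "0 \<le> kern x" "kern x \<le> 32 * norm (neg_sum4 x) * sqrt (max 0 (4 - (norm (neg_sum4 x))\<^sup>2))" "kern x \<le> 256"
proof -
  obtain w0 w1 w2 w3 where X: "x = (w0, w1, w2, w3)" by (cases x)
  define y where "y = neg_sum4 x"
  have w: "norm w0 = 1" "norm w1 = 1" "norm w2 = 1" "norm w3 = 1" using assms by (auto simp: X torus4_def)
  define P where "P = psi (w1 + second_pt y) * psi (w1 + first_pt y)"
  note p = psi_sum_bounds[OF w(2) norm_pt(1)[of y]] psi_sum_bounds[OF w(2) norm_pt(2)[of y]]
  have P: "0 \<le> P" unfolding P_def by (intro mult_nonneg_nonneg p)
  have "P \<le> 4 * 4" unfolding P_def by (intro mult_mono p) simp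
  note P = P this
  define q where "q = 2 * norm y * sqrt (max 0 (4 - (norm y)\<^sup>2))"
  have q: "0 \<le> q" unfolding q_def by simp
  have k: "kern x = q * P" by (simp add: X kern_eq Let_def q_def P_def y_def)
  show "0 \<le> kern x" unfolding k using P q by simp
  have kq: "kern x \<le> q * 16" unfolding k using P q by (intro mult_left_mono) auto
  then show "kern x \<le> 32 * norm (neg_sum4 x) * sqrt (max 0 (4 - (norm (neg_sum4 x))\<^sup>2))"
    by (simp add: q_def y_def)
  have "norm y \<le> 4"
    unfolding y_def X neg_sum4_def
    using norm_triangle_ineq[of "w0 + w1 + w2" w3] norm_triangle_ineq[of "w0 + w1" w2] norm_triangle_ineq[of w0 w1] w
    by (simp add: norm_minus_commute flip: norm_minus_cancel[of "w0 + w1 + w2 + w3"])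
  moreover have "sqrt (max 0 (4 - (norm y)\<^sup>2)) \<le> 2"
    by (rule real_le_lsqrt) auto
  ultimately have "q \<le> 2 * 4 * 2" unfolding q_def by (intro mult_mono) auto
  then show "kern x \<le> 256" using kq by simp
qed

text \<open>For 0 < |y| < 2 every factor is continuous. For the other y the determined pair may
  jump, but there the second bound of \<open>kern_bounds\<close> squeezes \<open>kern\<close> to
  0.\<close>

lemma continuous_on_kern: "continuous_on torus4 kern"
  unfolding continuous_on_eq_continuous_within
proof
  fix x assume x: "x \<in> torus4"
  have nt: "(neg_sum4 \<longlongrightarrow> neg_sum4 x) (at x within torus4)" by (rule neg_sum4_tendsto)
  have ev: "\<forall>\<^sub>F z in at x within torus4. z \<in> torus4" by (simp add: eventually_at_filter)
  let ?y = "neg_sum4 x"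
  let ?q = "\<lambda>x. 32 * norm (neg_sum4 x) * sqrt (max 0 (4 - (norm (neg_sum4 x))\<^sup>2))"
  show "continuous (at x within torus4) kern"
  proof (cases "0 < norm ?y \<and> norm ?y < 2")
    case True
    have k: "kern = (\<lambda>x. 2 * norm (neg_sum4 x) * sqrt (max 0 (4 - (norm (neg_sum4 x))\<^sup>2))
        * (psi (fst (snd x) + second_pt (neg_sum4 x)) * psi (fst (snd x) + first_pt (neg_sum4 x))))"
      by (auto simp: fun_eq_iff kern_eq Let_def)
    have f: "((\<lambda>x. first_pt (neg_sum4 x)) \<longlongrightarrow> first_pt ?y) (at x within torus4)"
      by (rule isCont_tendsto_compose[OF isCont_pts(1) nt]) (use True in auto)
    have s: "((\<lambda>x. second_pt (neg_sum4 x)) \<longlongrightarrow> second_pt ?y) (at x within torus4)"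
      by (rule isCont_tendsto_compose[OF isCont_pts(2) nt]) (use True in auto)
    show ?thesis unfolding continuous_within k psi_def
      by (intro tendsto_intros nt f s)
  next
    case False
    then have q0: "?q x = 0" using power_mono[of 2 "norm ?y" 2] by auto
    have "(?q \<longlongrightarrow> ?q x) (at x within torus4)" by (intro tendsto_intros nt)
    then have q: "(?q \<longlongrightarrow> 0) (at x within torus4)" unfolding q0 .
    have "(kern \<longlongrightarrow> 0) (at x within torus4)"
    proof (rule Lim_null_comparison[OF _ q])
      show "\<forall>\<^sub>F z in at x within torus4. norm (kern z) \<le> ?q z"
        using ev by eventually_elim (use kern_bounds in auto)
    qed
    moreover have "kern x = 0" using kern_bounds(1,2)[OF x] q0 by linarith
    ultimately show ?thesis unfolding continuous_within by simp
  qed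
qed

abbreviation "C3 \<equiv> circle_measure \<Otimes>\<^sub>M circle_measure \<Otimes>\<^sub>M circle_measure"
abbreviation "torus3 \<equiv> sphere (0::complex) 1 \<times> sphere (0::complex) 1 \<times> sphere (0::complex) 1"

lemma space_C3: "space C3 = torus3"
  by (simp add: space_pair_measure)

lemma circle4_C3: "circle4 = circle_measure \<Otimes>\<^sub>M C3"
  unfolding circle4_def ..

lemma integrable_comp_fst_snd:
  fixes f :: "'a \<Rightarrow> real"
  assumes "finite_measure M" "finite_measure N" and f: "integrable M f"
  shows "integrable (M \<Otimes>\<^sub>M N) (\<lambda>p. f (fst p))" "integrable (N \<Otimes>\<^sub>M M) (\<lambda>p. f (snd p))"
    and "(\<integral>p. f (fst p) \<partial>(M \<Otimes>\<^sub>M N)) = measure N (space N) * (\<integral>x. f x \<partial>M)"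
    and "(\<integral>p. f (snd p) \<partial>(N \<Otimes>\<^sub>M M)) = measure N (space N) * (\<integral>x. f x \<partial>M)"
proof -
  interpret M: finite_measure M by fact
  interpret N: finite_measure N by fact
  interpret MN: pair_sigma_finite M N ..
  interpret NM: pair_sigma_finite N M ..
  have [measurable]: "f \<in> borel_measurable M" using f by auto
  have Nf: "emeasure N (space N) < \<infinity>" using N.emeasure_finite[of "space N"] by (metis infinity_ennreal_def top.not_eq_extremum)
  have fin: "(\<integral>\<^sup>+x. ennreal (norm (f x)) \<partial>M) < \<infinity>" using f by (simp add: integrable_iff_bounded)
  show 1: "integrable (M \<Otimes>\<^sub>M N) (\<lambda>p. f (fst p))"
  proof (rule integrableI_bounded)
    have "(\<integral>\<^sup>+p. ennreal (norm (f (fst p))) \<partial>(M \<Otimes>\<^sub>M N)) = (\<integral>\<^sup>+x. \<integral>\<^sup>+y. ennreal (norm (f x)) \<partial>N \<partial>M)"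
      by (subst N.nn_integral_fst[symmetric]) auto
    also have "\<dots> = (\<integral>\<^sup>+x. ennreal (norm (f x)) \<partial>M) * emeasure N (space N)"
      by (simp add: nn_integral_multc)
    also have "\<dots> < \<infinity>" using fin Nf by (simp add: ennreal_mult_less_top)
    finally show "(\<integral>\<^sup>+p. ennreal (norm (f (fst p))) \<partial>(M \<Otimes>\<^sub>M N)) < \<infinity>" .
  qed measurable
  show 2: "integrable (N \<Otimes>\<^sub>M M) (\<lambda>p. f (snd p))"
  proof (rule integrableI_bounded)
    have "(\<integral>\<^sup>+p. ennreal (norm (f (snd p))) \<partial>(N \<Otimes>\<^sub>M M)) = (\<integral>\<^sup>+x. \<integral>\<^sup>+y. ennreal (norm (f y)) \<partial>M \<partial>N)"
      by (subst M.nn_integral_fst[symmetric]) auto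
    also have "\<dots> = (\<integral>\<^sup>+x. ennreal (norm (f x)) \<partial>M) * emeasure N (space N)"
      by simp
    also have "\<dots> < \<infinity>" using fin Nf by (simp add: ennreal_mult_less_top)
    finally show "(\<integral>\<^sup>+p. ennreal (norm (f (snd p))) \<partial>(N \<Otimes>\<^sub>M M)) < \<infinity>" .
  qed measurable
  show "(\<integral>p. f (fst p) \<partial>(M \<Otimes>\<^sub>M N)) = measure N (space N) * (\<integral>x. f x \<partial>M)"
    using MN.integral_fst'[OF 1] by simp
  show "(\<integral>p. f (snd p) \<partial>(N \<Otimes>\<^sub>M M)) = measure N (space N) * (\<integral>x. f x \<partial>M)"
    using NM.integral_fst'[OF 2] by simp
qed

lemma measure_circle: "measure circle_measure (space circle_measure) = 2 * pi"
  using emeasure_circle_measure_space by (simp add: measure_def)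

lemma finite_measure_C2: "finite_measure (circle_measure \<Otimes>\<^sub>M circle_measure)"
  and measure_C2: "measure (circle_measure \<Otimes>\<^sub>M circle_measure) (space (circle_measure \<Otimes>\<^sub>M circle_measure)) = 4 * pi\<^sup>2"
proof -
  have e: "emeasure (circle_measure \<Otimes>\<^sub>M circle_measure) (space (circle_measure \<Otimes>\<^sub>M circle_measure)) = ennreal (4 * pi\<^sup>2)"
    unfolding space_pair_measure
    by (subst circle.emeasure_pair_measure_Times)
       (auto simp: emeasure_circle_measure_space[unfolded space_circle_measure] ennreal_mult[symmetric]
          power2_eq_square sets.top[of circle_measure, simplified])
  then show "finite_measure (circle_measure \<Otimes>\<^sub>M circle_measure)" by (intro finite_measureI) simp
  show "measure (circle_measure \<Otimes>\<^sub>M circle_measure) (space (circle_measure \<Otimes>\<^sub>M circle_measure)) = 4 * pi\<^sup>2"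
    using e by (simp add: measure_def)
qed

interpretation C2: finite_measure "circle_measure \<Otimes>\<^sub>M circle_measure" by (rule finite_measure_C2)

lemma finite_measure_C3: "finite_measure C3"
proof (rule finite_measureI)
  have "emeasure C3 (space C3) = emeasure circle_measure (space circle_measure)
      * emeasure (circle_measure \<Otimes>\<^sub>M circle_measure) (space (circle_measure \<Otimes>\<^sub>M circle_measure))"
    unfolding space_pair_measure[of circle_measure "circle_measure \<Otimes>\<^sub>M circle_measure"]
    by (rule circle_pair.emeasure_pair_measure_Times[OF sets.top sets.top])
  then show "emeasure C3 (space C3) \<noteq> \<infinity>"
    using circle.emeasure_finite C2.emeasure_finite by (simp add: ennreal_mult_eq_top_iff)
qed

interpretation C3: finite_measure C3 by (rule finite_measure_C3)

lemma integrable_C3_coord: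
  fixes f :: "complex \<Rightarrow> real"
  assumes f: "integrable circle_measure f"
  shows "integrable C3 (\<lambda>p. f (fst p))" "integrable C3 (\<lambda>p. f (fst (snd p)))" "integrable C3 (\<lambda>p. f (snd (snd p)))"
    and "(\<integral>p. f (fst p) \<partial>C3) = 4 * pi\<^sup>2 * (\<integral>w. f w \<partial>circle_measure)"
    and "(\<integral>p. f (fst (snd p)) \<partial>C3) = 4 * pi\<^sup>2 * (\<integral>w. f w \<partial>circle_measure)"
    and "(\<integral>p. f (snd (snd p)) \<partial>C3) = 4 * pi\<^sup>2 * (\<integral>w. f w \<partial>circle_measure)"
proof -
  note fm = finite_measure_circle
  note A = integrable_comp_fst_snd[OF fm fm f]
  show "integrable C3 (\<lambda>p. f (fst p))" "(\<integral>p. f (fst p) \<partial>C3) = 4 * pi\<^sup>2 * (\<integral>w. f w \<partial>circle_measure)"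
    using integrable_comp_fst_snd(1,3)[OF fm finite_measure_C2 f] measure_C2 by simp_all
  show "integrable C3 (\<lambda>p. f (fst (snd p)))" "(\<integral>p. f (fst (snd p)) \<partial>C3) = 4 * pi\<^sup>2 * (\<integral>w. f w \<partial>circle_measure)"
    using integrable_comp_fst_snd(2,4)[OF finite_measure_C2 fm A(1)] A(3) measure_circle
    by (simp_all add: power2_eq_square)
  show "integrable C3 (\<lambda>p. f (snd (snd p)))" "(\<integral>p. f (snd (snd p)) \<partial>C3) = 4 * pi\<^sup>2 * (\<integral>w. f w \<partial>circle_measure)"
    using integrable_comp_fst_snd(2,4)[OF finite_measure_C2 fm A(2)] A(4) measure_circle
    by (simp_all add: power2_eq_square)
qed

lemma integrable_circle4_coord:
  fixes f :: "complex \<Rightarrow> real"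
  assumes f: "integrable circle_measure f"
  shows "integrable circle4 (\<lambda>x. f (fst x))" "integrable circle4 (\<lambda>x. f (fst (snd x)))"
    "integrable circle4 (\<lambda>x. f (fst (snd (snd x))))" "integrable circle4 (\<lambda>x. f (snd (snd (snd x))))"
  unfolding circle4_C3
  using integrable_comp_fst_snd(1)[OF finite_measure_circle finite_measure_C3 f]
    integrable_comp_fst_snd(2)[OF finite_measure_C3 finite_measure_circle] integrable_C3_coord(1-3)[OF f]
  by auto

lemma kern_measurable_C3:
  assumes "w \<in> sphere 0 1"
  shows "(\<lambda>p. kern (w, p)) \<in> borel_measurable C3"
  using measurable_compose[OF measurable_Pair1'[of w circle_measure C3], of kern borel] kern_measurable assms
  unfolding circle4_C3 by simp

text \<open>Integrating \<open>coord 0 x \<bullet> moment g x\<close> against the cutoff with \<open>coord 0 x\<close> fixed gives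
  \<open>c_fun g + S_op g\<close> (lemma \<open>averaging\<close>), with coefficients \<open>6, 2, 2\<close> because the indices
  \<open>1, 4, 5\<close> contribute equally and each configuration is counted for both orders of the last pair.\<close>

definition c_fun :: "complex \<Rightarrow> real" where
  "c_fun w = (\<integral>p. 2 * kern (w, p) \<partial>C3)"

definition S_integrand :: "(complex \<Rightarrow> real) \<Rightarrow> complex \<Rightarrow> complex \<times> complex \<times> complex \<Rightarrow> real" where
  "S_integrand g w p = 6 * g (fst p) * ((w \<bullet> fst p) * kern (w, p))
     + 2 * g (fst (snd p)) * ((w \<bullet> fst (snd p)) * kern (w, p))
     + 2 * g (snd (snd p)) * ((w \<bullet> snd (snd p)) * kern (w, p))"

definition S_op :: "(complex \<Rightarrow> real) \<Rightarrow> complex \<Rightarrow> real" where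
  "S_op g w = (\<integral>p. S_integrand g w p \<partial>C3)"

text \<open>Bounds \<open>S_integrand g w\<close> up to the factor 256, and does not depend on
  \<open>w\<close>. Hence \<open>S_op g\<close> is bounded and has a modulus of continuity governed
  by the L^1 norm of g alone.\<close>

definition S_majorant :: "(complex \<Rightarrow> real) \<Rightarrow> complex \<times> complex \<times> complex \<Rightarrow> real" where
  "S_majorant g p = 6 * \<bar>g (fst p)\<bar> + 2 * \<bar>g (fst (snd p))\<bar> + 2 * \<bar>g (snd (snd p))\<bar>"

lemma integrable_L2:
  assumes "g \<in> L2_circle"
  shows "integrable circle_measure g" "integrable circle_measure (\<lambda>w. \<bar>g w\<bar>)"
    "(\<integral>w. \<bar>g w\<bar> \<partial>circle_measure) \<le> pi + (\<integral>w. (g w)\<^sup>2 \<partial>circle_measure) / 2"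
proof -
  note g = L2_circleD[OF assms]
  have I: "integrable circle_measure (\<lambda>w. 1 / 2 + (g w)\<^sup>2 / 2)" using g by simp
  have le: "\<bar>a\<bar> \<le> 1 / 2 + a\<^sup>2 / 2" for a :: real
    using sum_squares_bound[of 1 "\<bar>a\<bar>"] by simp
  show 1: "integrable circle_measure g"
    by (rule Bochner_Integration.integrable_bound[OF I g(1)]) (use le in \<open>auto intro!: AE_I2\<close>)
  then show 2: "integrable circle_measure (\<lambda>w. \<bar>g w\<bar>)" by simp
  have "(\<integral>w. \<bar>g w\<bar> \<partial>circle_measure) \<le> (\<integral>w. 1 / 2 + (g w)\<^sup>2 / 2 \<partial>circle_measure)"
    by (rule integral_mono[OF 2 I]) (rule le)
  also have "\<dots> = pi + (\<integral>w. (g w)\<^sup>2 \<partial>circle_measure) / 2"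
    using g measure_circle by simp
  finally show "(\<integral>w. \<bar>g w\<bar> \<partial>circle_measure) \<le> pi + (\<integral>w. (g w)\<^sup>2 \<partial>circle_measure) / 2" .
qed

lemma S_majorant_integrable:
  assumes "g \<in> L2_circle"
  shows "integrable C3 (S_majorant g)"
    and "(\<integral>p. S_majorant g p \<partial>C3) = 40 * pi\<^sup>2 * (\<integral>w. \<bar>g w\<bar> \<partial>circle_measure)"
  unfolding S_majorant_def using integrable_C3_coord[OF integrable_L2(2)[OF assms]] by simp_all

lemma S_integrand_integrable:
  assumes g: "g \<in> L2_circle" and w: "w \<in> sphere 0 1"
  shows "integrable C3 (S_integrand g w)"
    and "\<bar>S_op g w\<bar> \<le> 256 * (\<integral>p. S_majorant g p \<partial>C3)"
proof -
  note [measurable] = L2_circleD(1)[OF g] kern_measurable_C3[OF w]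
  have I: "integrable C3 (\<lambda>p. 256 * S_majorant g p)" using S_majorant_integrable(1)[OF g] by simp
  have [measurable]: "(\<lambda>p. fst p) \<in> borel_measurable C3" "(\<lambda>p. fst (snd p)) \<in> borel_measurable C3"
    "(\<lambda>p. snd (snd p)) \<in> borel_measurable C3"
    by (rule borel_measurable_circleI; measurable)+
  have m: "S_integrand g w \<in> borel_measurable C3"
    unfolding S_integrand_def[abs_def] by measurable
  have le: "norm (S_integrand g w p) \<le> 256 * S_majorant g p" if p: "p \<in> space C3" for p
  proof -
    have t: "(w, p) \<in> torus4" using p w unfolding space_C3 torus4_def by auto
    have d: "\<bar>(w \<bullet> v) * kern (w, p)\<bar> \<le> 1 * 256" if "norm v = 1" for v
      unfolding abs_mult using Cauchy_Schwarz_ineq2[of w v] kern_bounds[OF t] w that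
      by (intro mult_mono) auto
    have p3: "norm (fst p) = 1" "norm (fst (snd p)) = 1" "norm (snd (snd p)) = 1"
      using p unfolding space_C3 by auto
    have e: "\<bar>k * a * b\<bar> \<le> 256 * (k * \<bar>a\<bar>)" if "\<bar>b\<bar> \<le> 1 * 256" "k \<ge> 0" for k a b :: real
      using mult_left_mono[OF that(1), of "k * \<bar>a\<bar>"] that(2) by (simp add: abs_mult mult_ac)
    have "\<bar>6 * g (fst p) * ((w \<bullet> fst p) * kern (w, p))\<bar> \<le> 256 * (6 * \<bar>g (fst p)\<bar>)"
      by (rule e[OF d[OF p3(1)]]) simp
    moreover have "\<bar>2 * g (fst (snd p)) * ((w \<bullet> fst (snd p)) * kern (w, p))\<bar> \<le> 256 * (2 * \<bar>g (fst (snd p))\<bar>)"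
      by (rule e[OF d[OF p3(2)]]) simp
    moreover have "\<bar>2 * g (snd (snd p)) * ((w \<bullet> snd (snd p)) * kern (w, p))\<bar> \<le> 256 * (2 * \<bar>g (snd (snd p))\<bar>)"
      by (rule e[OF d[OF p3(3)]]) simp
    moreover have "\<bar>a + b + c\<bar> \<le> 256 * (x + y + z)"
      if "\<bar>a\<bar> \<le> 256 * x" "\<bar>b\<bar> \<le> 256 * y" "\<bar>c\<bar> \<le> 256 * z" for a b c x y z :: real
      using that by (smt (verit))
    ultimately show ?thesis
      unfolding S_integrand_def S_majorant_def real_norm_def by blast
  qed
  show int: "integrable C3 (S_integrand g w)"
    by (rule Bochner_Integration.integrable_bound[OF I m]) (use le in \<open>auto intro!: AE_I2 simp: S_majorant_def\<close>)
  have "\<bar>S_op g w\<bar> \<le> (\<integral>p. norm (S_integrand g w p) \<partial>C3)"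
    unfolding S_op_def using integral_norm_bound[of C3 "S_integrand g w"] by simp
  also have "\<dots> \<le> (\<integral>p. 256 * S_majorant g p \<partial>C3)"
    by (rule integral_mono[OF _ I]) (use int le in auto)
  finally show "\<bar>S_op g w\<bar> \<le> 256 * (\<integral>p. S_majorant g p \<partial>C3)" by simp
qed

lemma uniform_modulus:
  fixes k :: "complex4 \<Rightarrow> real"
  assumes k: "continuous_on torus4 k" and e: "e > 0"
  obtains d where "d > 0" "\<And>w v p. w \<in> sphere 0 1 \<Longrightarrow> v \<in> sphere 0 1 \<Longrightarrow> p \<in> torus3 \<Longrightarrow> dist w v < d \<Longrightarrow> \<bar>k (w, p) - k (v, p)\<bar> < e"
proof -
  have "uniformly_continuous_on torus4 k"
    by (rule compact_uniformly_continuous[OF k compact_torus4])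
  then obtain d where d: "d > 0" "\<And>x y. x \<in> torus4 \<Longrightarrow> y \<in> torus4 \<Longrightarrow> dist y x < d \<Longrightarrow> dist (k y) (k x) < e"
    using e unfolding uniformly_continuous_on_def by metis
  show ?thesis
  proof (rule that[OF d(1)])
    fix w v :: complex and p assume a: "w \<in> sphere 0 1" "v \<in> sphere 0 1" "p \<in> torus3" "dist w v < d"
    have "dist (k (w, p)) (k (v, p)) < e"
      using a by (intro d(2)) (auto simp: torus4_def dist_Pair_Pair)
    then show "\<bar>k (w, p) - k (v, p)\<bar> < e" by (simp add: dist_real_def)
  qed
qed

text \<open>\<open>d\<close> comes from the uniform continuity of the three kernels on the compact
  torus and is chosen before \<open>g\<close>. This is the equicontinuity needed for
  Arzela-Ascoli.\<close>

lemma S_op_modulus: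
  assumes e: "e > 0"
  obtains d where "d > 0"
    "\<And>g w v. g \<in> L2_circle \<Longrightarrow> w \<in> sphere 0 1 \<Longrightarrow> v \<in> sphere 0 1 \<Longrightarrow> dist w v < d \<Longrightarrow>
      \<bar>S_op g w - S_op g v\<bar> \<le> e * (\<integral>p. S_majorant g p \<partial>C3)"
proof -
  have kc: "continuous_on torus4 (\<lambda>x. (fst x \<bullet> f (snd x)) * kern x)"
    if "continuous_on UNIV f" for f :: "complex \<times> complex \<times> complex \<Rightarrow> complex"
    by (intro continuous_on_mult continuous_on_kern continuous_on_inner continuous_on_compose2[OF that] continuous_intros) auto
  obtain d0 where d0: "d0 > 0" "\<And>w v p. w \<in> sphere 0 1 \<Longrightarrow> v \<in> sphere 0 1 \<Longrightarrow> p \<in> torus3 \<Longrightarrow> dist w v < d0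
      \<Longrightarrow> \<bar>(w \<bullet> fst p) * kern (w, p) - (v \<bullet> fst p) * kern (v, p)\<bar> < e"
    by (rule uniform_modulus[OF kc[of fst] e]) (auto intro!: continuous_intros)
  obtain d1 where d1: "d1 > 0" "\<And>w v p. w \<in> sphere 0 1 \<Longrightarrow> v \<in> sphere 0 1 \<Longrightarrow> p \<in> torus3 \<Longrightarrow> dist w v < d1
      \<Longrightarrow> \<bar>(w \<bullet> fst (snd p)) * kern (w, p) - (v \<bullet> fst (snd p)) * kern (v, p)\<bar> < e"
    by (rule uniform_modulus[OF kc[of "\<lambda>p. fst (snd p)"] e]) (auto intro!: continuous_intros)
  obtain d2 where d2: "d2 > 0" "\<And>w v p. w \<in> sphere 0 1 \<Longrightarrow> v \<in> sphere 0 1 \<Longrightarrow> p \<in> torus3 \<Longrightarrow> dist w v < d2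
      \<Longrightarrow> \<bar>(w \<bullet> snd (snd p)) * kern (w, p) - (v \<bullet> snd (snd p)) * kern (v, p)\<bar> < e"
    by (rule uniform_modulus[OF kc[of "\<lambda>p. snd (snd p)"] e]) (auto intro!: continuous_intros)
  show ?thesis
  proof (rule that[of "min d0 (min d1 d2)"])
    show "0 < min d0 (min d1 d2)" using d0 d1 d2 by simp
    fix g and w v :: complex assume g: "g \<in> L2_circle" and wv: "w \<in> sphere 0 1" "v \<in> sphere 0 1" "dist w v < min d0 (min d1 d2)"
    have I: "integrable C3 (\<lambda>p. e * S_majorant g p)" using S_majorant_integrable(1)[OF g] by simp
    have J: "integrable C3 (\<lambda>p. S_integrand g w p - S_integrand g v p)"
      using S_integrand_integrable(1)[OF g] wv by simp
    have le: "norm (S_integrand g w p - S_integrand g v p) \<le> e * S_majorant g p" if p: "p \<in> space C3" for p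
    proof -
      have p': "p \<in> torus3" using p unfolding space_C3 .
      have E: "\<bar>k * a * b - k * a * c\<bar> \<le> e * (k * \<bar>a\<bar>)" if "\<bar>b - c\<bar> < e" "k \<ge> 0" for k a b c :: real
      proof -
        have "\<bar>k * a * b - k * a * c\<bar> = k * \<bar>a\<bar> * \<bar>b - c\<bar>"
          using that(2) by (simp add: abs_mult right_diff_distrib[symmetric])
        also have "\<dots> \<le> k * \<bar>a\<bar> * e" using that by (intro mult_left_mono) auto
        finally show ?thesis by (simp add: mult_ac)
      qed
      have b: "dist w v < d0" "dist w v < d1" "dist w v < d2" using wv by auto
      have "\<bar>6 * g (fst p) * ((w \<bullet> fst p) * kern (w, p)) - 6 * g (fst p) * ((v \<bullet> fst p) * kern (v, p))\<bar>
          \<le> e * (6 * \<bar>g (fst p)\<bar>)"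
        by (rule E[OF d0(2)[OF wv(1,2) p' b(1)]]) simp
      moreover have "\<bar>2 * g (fst (snd p)) * ((w \<bullet> fst (snd p)) * kern (w, p)) - 2 * g (fst (snd p)) * ((v \<bullet> fst (snd p)) * kern (v, p))\<bar>
          \<le> e * (2 * \<bar>g (fst (snd p))\<bar>)"
        by (rule E[OF d1(2)[OF wv(1,2) p' b(2)]]) simp
      moreover have "\<bar>2 * g (snd (snd p)) * ((w \<bullet> snd (snd p)) * kern (w, p)) - 2 * g (snd (snd p)) * ((v \<bullet> snd (snd p)) * kern (v, p))\<bar>
          \<le> e * (2 * \<bar>g (snd (snd p))\<bar>)"
        by (rule E[OF d2(2)[OF wv(1,2) p' b(3)]]) simp
      ultimately show ?thesis
        unfolding S_integrand_def S_majorant_def real_norm_def by (simp only: distrib_left) linarith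
    qed
    have "\<bar>S_op g w - S_op g v\<bar> = norm (\<integral>p. S_integrand g w p - S_integrand g v p \<partial>C3)"
      unfolding S_op_def using S_integrand_integrable(1)[OF g] wv by simp
    also have "\<dots> \<le> (\<integral>p. norm (S_integrand g w p - S_integrand g v p) \<partial>C3)"
      by (rule integral_norm_bound)
    also have "\<dots> \<le> (\<integral>p. e * S_majorant g p \<partial>C3)"
      by (rule integral_mono[OF _ I]) (use J le in auto)
    finally show "\<bar>S_op g w - S_op g v\<bar> \<le> e * (\<integral>p. S_majorant g p \<partial>C3)" by simp
  qed
qed

lemma kern_integrable:
  assumes w: "w \<in> sphere 0 1"
  shows "integrable C3 (\<lambda>p. kern (w, p))"
proof (rule C3.integrable_const_bound[where B=256])
  show "AE p in C3. norm (kern (w, p)) \<le> 256"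
    using kern_bounds[of "(w, p)" for p] w
    by (intro AE_I2) (auto simp: torus4_def space_pair_measure)
qed (rule kern_measurable_C3[OF w])

lemma continuous_on_c_fun: "continuous_on (sphere 0 1) c_fun"
  unfolding continuous_on_iff
proof (intro ballI allI impI)
  fix w :: complex and e :: real assume w: "w \<in> sphere 0 1" and e: "e > 0"
  define M where "M = measure C3 (space C3)"
  have M: "M \<ge> 0" unfolding M_def by simp
  define e' where "e' = e / (2 * M + 1)"
  have e': "e' > 0" unfolding e'_def using e M by simp
  obtain d where d: "d > 0" "\<And>w v p. w \<in> sphere 0 1 \<Longrightarrow> v \<in> sphere 0 1 \<Longrightarrow> p \<in> torus3 \<Longrightarrow> dist w v < d
      \<Longrightarrow> \<bar>kern (w, p) - kern (v, p)\<bar> < e'"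
    by (rule uniform_modulus[OF continuous_on_kern e']) auto
  show "\<exists>d>0. \<forall>v\<in>sphere 0 1. dist v w < d \<longrightarrow> dist (c_fun v) (c_fun w) < e"
  proof (intro exI[of _ d] conjI d(1) ballI impI)
    fix v :: complex assume v: "v \<in> sphere 0 1" "dist v w < d"
    note I = kern_integrable[OF v(1)] kern_integrable[OF w]
    have "dist (c_fun v) (c_fun w) = norm (\<integral>p. 2 * kern (v, p) - 2 * kern (w, p) \<partial>C3)"
      unfolding c_fun_def dist_real_def using I by simp
    also have "\<dots> \<le> (\<integral>p. norm (2 * kern (v, p) - 2 * kern (w, p)) \<partial>C3)" by (rule integral_norm_bound)
    also have "\<dots> \<le> (\<integral>p. 2 * e' \<partial>C3)"
    proof (rule integral_mono)
      show "integrable C3 (\<lambda>p. norm (2 * kern (v, p) - 2 * kern (w, p)))" using I by simp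
      show "norm (2 * kern (v, p) - 2 * kern (w, p)) \<le> 2 * e'" if "p \<in> space C3" for p
        using d(2)[OF v(1) w, of p] v(2) that by (simp add: space_C3 del: mem_Times_iff)
    qed simp
    also have "\<dots> = 2 * M * e'" by (simp add: M_def)
    also have "\<dots> < e" unfolding e'_def using e M by (simp add: field_simps)
    finally show "dist (c_fun v) (c_fun w) < e" .
  qed
qed

lemma c_fun_pos:
  assumes w: "w \<in> sphere 0 1"
  shows "c_fun w > 0"
proof -
  define z where "z = Complex (-1/2) (sqrt 3 / 2)"
  have z: "norm z = 1" "1 + z + cnj z = 0" by (simp_all add: z_def cmod_def power_divide complex_eq_iff)
  \<comment> \<open>\<open>z\<close> is a primitive cube root of unity, so the free points sum to
    \<open>w\<close> and the determined pair to \<open>- w\<close>. All three sums inside the cutoff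
    then have norm 1, so none of its factors vanishes.\<close>
  let ?x = "(w, w, w * z, w * cnj z)"
  have nw: "norm w = 1" using w by simp
  have y: "neg_sum4 ?x = - w"
  proof -
    have "neg_sum4 ?x = - w - w * (1 + z + cnj z)" by (simp add: neg_sum4_def algebra_simps)
    then show ?thesis using z by simp
  qed
  have "first_pt (- w) + second_pt (- w) = - w" using nw by (simp add: second_pt_def)
  then have fs: "w + (first_pt (- w) + second_pt (- w)) = 0" by simp
  have s: "w + second_pt (- w) = - first_pt (- w)" "w + first_pt (- w) = - second_pt (- w)"
    by (rule eq_neg_iff_add_eq_0[THEN iffD2], use fs in \<open>simp only: add_ac\<close>)+
  have k: "kern ?x > 0"
    unfolding kern_eq Let_def y s using nw by (simp add: psi_def)
  have x: "?x \<in> torus4" using nw z by (simp add: torus4_def norm_mult)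
  have "continuous (at ?x within torus4) kern"
    using continuous_on_kern x unfolding continuous_on_eq_continuous_within by blast
  then obtain d where d: "d > 0" "\<And>t. t \<in> torus4 \<Longrightarrow> dist t ?x < d \<Longrightarrow> dist (kern t) (kern ?x) < kern ?x / 2"
    using k unfolding continuous_within_eps_delta by (metis dist_norm half_gt_zero)
  obtain B where B: "B \<in> sets C3" "emeasure C3 B > 0" "B \<subseteq> torus3"
    "\<And>p. p \<in> B \<Longrightarrow> dist p (w, w * z, w * cnj z) < d"
    by (rule circle3_box[of w "w * z" "w * cnj z" d]) (use nw z d in \<open>auto simp: norm_mult\<close>)
  have "(\<integral>\<^sup>+p. ennreal (kern (w, p)) \<partial>C3) > 0"
  proof (rule nn_integral_pos_box[OF B(1,2)])
    show "kern ?x / 2 > 0" using k by simp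
    fix p assume p: "p \<in> B"
    have "dist (w, p) ?x < d" using B(4)[OF p] by (simp add: dist_Pair_Pair)
    moreover have "(w, p) \<in> torus4" using B(3) p w unfolding torus4_def by auto
    ultimately show "kern ?x / 2 \<le> kern (w, p)"
      using d(2)[of "(w, p)"] unfolding dist_real_def by linarith
  qed
  also have "(\<integral>\<^sup>+p. ennreal (kern (w, p)) \<partial>C3) = ennreal (\<integral>p. kern (w, p) \<partial>C3)"
    using kern_bounds(1) w
    by (intro nn_integral_eq_integral kern_integrable AE_I2) (auto simp: torus4_def space_pair_measure)
  finally show ?thesis unfolding c_fun_def by simp
qed

lemma c_fun_bounds:
  obtains c C where "c > 0" "\<And>w. w \<in> sphere 0 1 \<Longrightarrow> c \<le> c_fun w" "\<And>w. w \<in> sphere 0 1 \<Longrightarrow> c_fun w \<le> C"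
proof -
  have ne: "sphere (0::complex) 1 \<noteq> {}" by auto
  obtain a where a: "a \<in> sphere 0 1" "\<And>w. w \<in> sphere 0 1 \<Longrightarrow> c_fun a \<le> c_fun w"
    using continuous_attains_inf[OF compact_sphere ne continuous_on_c_fun] by blast
  obtain b where b: "b \<in> sphere 0 1" "\<And>w. w \<in> sphere 0 1 \<Longrightarrow> c_fun w \<le> c_fun b"
    using continuous_attains_sup[OF compact_sphere ne continuous_on_c_fun] by blast
  show ?thesis using that[OF c_fun_pos[OF a(1)] a(2) b(2)] .
qed

subsection \<open>Coercivity by compactness\<close>

lemma abs_mult_le_squares: "2 * \<bar>a * b\<bar> \<le> a\<^sup>2 + (b::real)\<^sup>2"
  using sum_squares_bound[of "\<bar>a\<bar>" "\<bar>b\<bar>"] by (simp add: abs_mult)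

lemma averaging_term_integrable:
  assumes g: "g \<in> L2_circle" and h: "h \<in> L2_circle" and i: "i < 6"
  shows "integrable delta6 (\<lambda>x. h (coord 0 x) * g (coord i x) * (coord 0 x \<bullet> coord i x) * cutoff (\<lambda>i. coord i x))"
proof (rule Bochner_Integration.integrable_bound)
  note [measurable] = L2_circleD(1)[OF g] L2_circleD(1)[OF h]
  have [measurable]: "(\<lambda>x. cutoff (\<lambda>i. coord i x)) \<in> borel_measurable delta6"
    using cutoff_measurable by (simp cong: measurable_cong_sets)
  show "integrable delta6 (\<lambda>x. 32 * ((h (coord 0 x))\<^sup>2 + (g (coord i x))\<^sup>2))"
    using integrable_coord(1)[OF L2_circleD(2)[OF g] i] integrable_coord(1)[OF L2_circleD(2)[OF h], of 0] by simp
  show "(\<lambda>x. h (coord 0 x) * g (coord i x) * (coord 0 x \<bullet> coord i x) * cutoff (\<lambda>i. coord i x)) \<in> borel_measurable delta6"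
    by measurable
  show "AE x in delta6. norm (h (coord 0 x) * g (coord i x) * (coord 0 x \<bullet> coord i x) * cutoff (\<lambda>i. coord i x))
      \<le> norm (32 * ((h (coord 0 x))\<^sup>2 + (g (coord i x))\<^sup>2))"
    using AE_delta6_config
  proof eventually_elim
    case (elim x)
    have c: "\<bar>cutoff (\<lambda>i. coord i x)\<bar> \<le> 64" using cutoff_bounds[of "\<lambda>i. coord i x"] elim by auto
    have d: "\<bar>coord 0 x \<bullet> coord i x\<bar> \<le> 1" using Cauchy_Schwarz_ineq2[of "coord 0 x" "coord i x"] elim by simp
    have "\<bar>h (coord 0 x) * g (coord i x) * (coord 0 x \<bullet> coord i x) * cutoff (\<lambda>i. coord i x)\<bar>
       = \<bar>h (coord 0 x) * g (coord i x)\<bar> * \<bar>coord 0 x \<bullet> coord i x\<bar> * \<bar>cutoff (\<lambda>i. coord i x)\<bar>"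
      by (simp add: abs_mult)
    also have "\<dots> \<le> \<bar>h (coord 0 x) * g (coord i x)\<bar> * 1 * 64"
      using c d by (intro mult_mono) auto
    also have "\<dots> \<le> 32 * ((h (coord 0 x))\<^sup>2 + (g (coord i x))\<^sup>2)"
      using abs_mult_le_squares[of "h (coord 0 x)" "g (coord i x)"] by simp
    finally show ?case by simp
  qed
qed

text \<open>A weak form: testing against an arbitrary \<open>h\<close> replaces conditioning on the
  first point. \<open>residual_bound\<close> takes \<open>h = residual g\<close>.\<close>

lemma averaging:
  assumes g: "g \<in> L2_circle" and h: "h \<in> L2_circle"
  shows "(\<integral>x. h (coord 0 x) * (coord 0 x \<bullet> moment g x) * cutoff (\<lambda>i. coord i x) \<partial>delta6)
    = (\<integral>w. h w * (c_fun w * g w + S_op g w) \<partial>circle_measure)"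
    and "integrable delta6 (\<lambda>x. h (coord 0 x) * (coord 0 x \<bullet> moment g x) * cutoff (\<lambda>i. coord i x))"
proof -
  note gm [measurable] = L2_circleD(1)[OF g] and hm [measurable] = L2_circleD(1)[OF h]
  have [measurable]: "(\<lambda>x. cutoff (\<lambda>i. coord i x)) \<in> borel_measurable delta6"
    using cutoff_measurable by (simp cong: measurable_cong_sets)
  define T where "T i a = h (a 0) * g (a i) * (a 0 \<bullet> a i) * cutoff a" for i :: nat and a :: "nat \<Rightarrow> complex"
  have Ti: "integrable delta6 (\<lambda>x. T i (\<lambda>i. coord i x))" if "i < 6" for i
    unfolding T_def by (rule averaging_term_integrable[OF g h that])
  have sumT: "h (coord 0 x) * (coord 0 x \<bullet> moment g x) * cutoff (\<lambda>i. coord i x) = (\<Sum>i<6. T i (\<lambda>i. coord i x))" for x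
    unfolding moment_def T_def by (simp add: inner_sum_right sum_distrib_left sum_distrib_right mult_ac)
  show "integrable delta6 (\<lambda>x. h (coord 0 x) * (coord 0 x \<bullet> moment g x) * cutoff (\<lambda>i. coord i x))"
    unfolding sumT by (intro Bochner_Integration.integrable_sum Ti) auto
  \<comment> \<open>The terms of the determined points would put g at points that depend
    discontinuously on the free ones. Transposing them with the free index 1, under which the cutoff
    is invariant, moves g to a variable of integration.\<close>
  have T1: "(\<integral>x. T j (\<lambda>i. coord i x) \<partial>delta6) = (\<integral>x. T 1 (\<lambda>i. coord i x) \<partial>delta6)" if j: "j = 4 \<or> j = 5" for j
  proof -
    let ?p = "Transposition.transpose 1 j"
    have m: "(\<lambda>x. T 1 (\<lambda>i. coord i x)) \<in> borel_measurable circle6"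
      using borel_measurable_integrable[OF Ti[of 1]] by (simp cong: measurable_cong_sets)
    have "T j (\<lambda>i. coord i x) = T 1 (\<lambda>i. coord (?p i) x)" for x
      using j by (auto simp: T_def cutoff_def Transposition.transpose_def add.commute mult_ac)
    then have "(\<integral>x. T j (\<lambda>i. coord i x) \<partial>delta6) = (\<integral>x. T 1 (\<lambda>i. coord (?p i) x) \<partial>delta6)" by simp
    also have "\<dots> = (\<integral>x. T 1 (\<lambda>i. coord i x) \<partial>delta6)"
      by (rule integral_perm6(1)[OF _ m]) (use j in \<open>auto simp: T_def cutoff_def intro!: perm6_transpose\<close>)
    finally show ?thesis .
  qed
  define \<Phi> where "\<Phi> x = T 0 (\<lambda>i. coord i x) + 3 * T 1 (\<lambda>i. coord i x) + T 2 (\<lambda>i. coord i x) + T 3 (\<lambda>i. coord i x)" for x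
  have \<Phi>: "integrable delta6 \<Phi>" unfolding \<Phi>_def[abs_def] using Ti by auto
  let ?H = "\<lambda>x. h (fst x) * (2 * g (fst x) * kern x) + h (fst x) * S_integrand g (fst x) (snd x)"
  have HP: "(\<Phi> (lift1 x) + \<Phi> (lift2 x)) * pair_weight (neg_sum4 x) = ?H x" if "x \<in> torus4" for x
  proof -
    obtain w0 w1 w2 w3 where X: "x = (w0, w1, w2, w3)" by (cases x)
    have d: "w0 \<bullet> w0 = 1" using that by (simp add: X torus4_def dot_square_norm)
    have "\<Phi> (lift2 x) = \<Phi> (lift1 x)"
      unfolding \<Phi>_def T_def cutoff_lift2 by (simp add: X coord_lift)
    moreover have "\<Phi> (lift1 x) = h w0 * (g w0 + 3 * g w1 * (w0 \<bullet> w1) + g w2 * (w0 \<bullet> w2) + g w3 * (w0 \<bullet> w3))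
        * cutoff (\<lambda>i. coord i (lift1 x))"
      unfolding \<Phi>_def T_def using d by (simp add: X coord_lift algebra_simps)
    ultimately have "(\<Phi> (lift1 x) + \<Phi> (lift2 x)) * pair_weight (neg_sum4 x)
        = 2 * (h w0 * (g w0 + 3 * g w1 * (w0 \<bullet> w1) + g w2 * (w0 \<bullet> w2) + g w3 * (w0 \<bullet> w3))) * kern x"
      by (simp add: kern_def)
    then show ?thesis by (simp add: X S_integrand_def algebra_simps)
  qed
  have km: "kern \<in> borel_measurable (circle_measure \<Otimes>\<^sub>M C3)" using kern_measurable unfolding circle4_C3 .
  have Hm: "?H \<in> borel_measurable circle4"
  proof -
    note [measurable] = km
    have [measurable]: "(\<lambda>x. fst x) \<in> borel_measurable (circle_measure \<Otimes>\<^sub>M C3)"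
      "(\<lambda>x. fst (snd x)) \<in> borel_measurable (circle_measure \<Otimes>\<^sub>M C3)"
      "(\<lambda>x. fst (snd (snd x))) \<in> borel_measurable (circle_measure \<Otimes>\<^sub>M C3)"
      "(\<lambda>x. snd (snd (snd x))) \<in> borel_measurable (circle_measure \<Otimes>\<^sub>M C3)"
      by (rule borel_measurable_circleI; measurable)+
    show ?thesis unfolding S_integrand_def circle4_C3 prod.collapse by measurable
  qed
  have HI: "integrable circle4 ?H"
  proof (rule Bochner_Integration.integrable_bound[OF _ Hm])
    note I = integrable_circle4_coord[OF L2_circleD(2)[OF g]] integrable_circle4_coord(1)[OF L2_circleD(2)[OF h]]
    show "integrable circle4 (\<lambda>x. 256 * (6 * (h (fst x))\<^sup>2 + (g (fst x))\<^sup>2 + 3 * (g (fst (snd x)))\<^sup>2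
        + (g (fst (snd (snd x))))\<^sup>2 + (g (snd (snd (snd x))))\<^sup>2))"
      using I by simp
    show "AE x in circle4. norm (?H x) \<le> norm (256 * (6 * (h (fst x))\<^sup>2 + (g (fst x))\<^sup>2 + 3 * (g (fst (snd x)))\<^sup>2
        + (g (fst (snd (snd x))))\<^sup>2 + (g (snd (snd (snd x))))\<^sup>2))"
    proof (rule AE_I2)
      fix x assume "x \<in> space circle4"
      then have x: "x \<in> torus4" by (simp add: space_circle4)
      obtain w0 w1 w2 w3 where X: "x = (w0, w1, w2, w3)" by (cases x)
      have w: "norm w0 = 1" "norm w1 = 1" "norm w2 = 1" "norm w3 = 1" using x by (auto simp: X torus4_def)
      have k: "\<bar>kern x\<bar> \<le> 256" using kern_bounds[OF x] by simp
      have b: "\<bar>h w0 * (r * g v * (t * kern x))\<bar> \<le> 256 * (r / 2 * ((h w0)\<^sup>2 + (g v)\<^sup>2))"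
        if "r \<ge> 0" "\<bar>t\<bar> \<le> 1" for r t v
      proof -
        have "\<bar>h w0 * (r * g v * (t * kern x))\<bar> = r * \<bar>h w0 * g v\<bar> * (\<bar>t\<bar> * \<bar>kern x\<bar>)"
          using that by (simp add: abs_mult)
        also have "\<dots> \<le> r * \<bar>h w0 * g v\<bar> * (1 * 256)"
          using that k by (intro mult_left_mono mult_mono) auto
        also have "\<dots> \<le> 256 * (r / 2 * ((h w0)\<^sup>2 + (g v)\<^sup>2))"
          using mult_left_mono[OF abs_mult_le_squares[of "h w0" "g v"] that(1)] by simp
        finally show ?thesis .
      qed
      have d: "\<bar>w0 \<bullet> v\<bar> \<le> 1" if "norm v = 1" for v using Cauchy_Schwarz_ineq2[of w0 v] w that by simp
      have "?H x = h w0 * (2 * g w0 * (1 * kern x)) + h w0 * (6 * g w1 * ((w0 \<bullet> w1) * kern x))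
          + h w0 * (2 * g w2 * ((w0 \<bullet> w2) * kern x)) + h w0 * (2 * g w3 * ((w0 \<bullet> w3) * kern x))"
        by (simp add: X S_integrand_def algebra_simps)
      then have "\<bar>?H x\<bar> \<le> \<bar>h w0 * (2 * g w0 * (1 * kern x))\<bar> + \<bar>h w0 * (6 * g w1 * ((w0 \<bullet> w1) * kern x))\<bar>
          + \<bar>h w0 * (2 * g w2 * ((w0 \<bullet> w2) * kern x))\<bar> + \<bar>h w0 * (2 * g w3 * ((w0 \<bullet> w3) * kern x))\<bar>"
        by (simp only:)
      also have "\<dots> \<le> 256 * (2 / 2 * ((h w0)\<^sup>2 + (g w0)\<^sup>2)) + 256 * (6 / 2 * ((h w0)\<^sup>2 + (g w1)\<^sup>2))
          + 256 * (2 / 2 * ((h w0)\<^sup>2 + (g w2)\<^sup>2)) + 256 * (2 / 2 * ((h w0)\<^sup>2 + (g w3)\<^sup>2))"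
        by (intro add_mono b d w) auto
      also have "\<dots> = 256 * (6 * (h w0)\<^sup>2 + (g w0)\<^sup>2 + 3 * (g w1)\<^sup>2 + (g w2)\<^sup>2 + (g w3)\<^sup>2)"
        by (simp add: algebra_simps)
      finally show "norm (?H x) \<le> norm (256 * (6 * (h (fst x))\<^sup>2 + (g (fst x))\<^sup>2 + 3 * (g (fst (snd x)))\<^sup>2
        + (g (fst (snd (snd x))))\<^sup>2 + (g (snd (snd (snd x))))\<^sup>2))"
        by (simp add: X)
    qed
  qed
  have "(\<integral>x. h (coord 0 x) * (coord 0 x \<bullet> moment g x) * cutoff (\<lambda>i. coord i x) \<partial>delta6)
      = (\<Sum>i<6. \<integral>x. T i (\<lambda>i. coord i x) \<partial>delta6)"
    unfolding sumT by (rule Bochner_Integration.integral_sum) (use Ti in auto)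
  also have "\<dots> = (\<integral>x. \<Phi> x \<partial>delta6)"
  proof -
    have "(\<Sum>i<6. f i) = f 0 + f 1 + f 2 + f 3 + f 4 + f 5" for f :: "nat \<Rightarrow> real"
      by (simp add: eval_nat_numeral)
    then show ?thesis unfolding \<Phi>_def using Ti T1 by simp
  qed
  also have "\<dots> = (\<integral>x. (\<Phi> (lift1 x) + \<Phi> (lift2 x)) * pair_weight (neg_sum4 x) \<partial>circle4)"
    using integral_delta6[OF \<Phi>] unfolding sum_circle_pairs_real .
  also have "\<dots> = (\<integral>x. ?H x \<partial>circle4)"
    by (intro Bochner_Integration.integral_cong refl HP) (simp add: space_circle4)
  also have "\<dots> = (\<integral>w. \<integral>p. ?H (w, p) \<partial>C3 \<partial>circle_measure)"
    using HI unfolding circle4_C3 by (rule circle4.integral_fst'[symmetric])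
  also have "\<dots> = (\<integral>w. h w * (c_fun w * g w + S_op g w) \<partial>circle_measure)"
  proof (intro Bochner_Integration.integral_cong refl)
    fix w assume "w \<in> space circle_measure"
    then have w: "w \<in> sphere 0 1" by simp
    have "(\<integral>p. ?H (w, p) \<partial>C3) = (\<integral>p. h w * g w * (2 * kern (w, p)) + h w * S_integrand g w p \<partial>C3)"
      by (intro Bochner_Integration.integral_cong) (auto simp: mult_ac)
    also have "\<dots> = h w * g w * c_fun w + h w * S_op g w"
      unfolding c_fun_def S_op_def using kern_integrable[OF w] S_integrand_integrable(1)[OF g w] by simp
    finally show "(\<integral>p. ?H (w, p) \<partial>C3) = h w * (c_fun w * g w + S_op g w)" by (simp add: algebra_simps)
  qed
  finally show "(\<integral>x. h (coord 0 x) * (coord 0 x \<bullet> moment g x) * cutoff (\<lambda>i. coord i x) \<partial>delta6)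
    = (\<integral>w. h w * (c_fun w * g w + S_op g w) \<partial>circle_measure)" .
qed

lemma continuous_on_L2:
  fixes f :: "complex \<Rightarrow> real"
  assumes "continuous_on (sphere 0 1) f"
  shows "f \<in> L2_circle"
proof -
  have [measurable]: "f \<in> borel_measurable circle_measure"
    using borel_measurable_continuous_on_restrict[OF assms] by (simp cong: measurable_cong_sets)
  have "bounded (f ` sphere 0 1)"
    using compact_continuous_image[OF assms compact_sphere] compact_imp_bounded by blast
  then obtain B where B: "\<And>w. w \<in> sphere 0 1 \<Longrightarrow> \<bar>f w\<bar> \<le> B" unfolding bounded_iff by (metis image_eqI real_norm_def)
  have "integrable circle_measure (\<lambda>w. (f w)\<^sup>2)"
  proof (rule circle.integrable_const_bound[where B="B\<^sup>2"])
    show "AE w in circle_measure. norm ((f w)\<^sup>2) \<le> B\<^sup>2"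
    proof (rule AE_I2)
      fix w assume "w \<in> space circle_measure"
      then have "\<bar>f w\<bar>\<^sup>2 \<le> B\<^sup>2" using B by (intro power_mono) auto
      then show "norm ((f w)\<^sup>2) \<le> B\<^sup>2" by simp
    qed
  qed measurable
  then show ?thesis by (simp add: L2_circle_def)
qed

lemma L2_circle_add:
  assumes f: "f \<in> L2_circle" and g: "g \<in> L2_circle"
  shows "(\<lambda>w. f w + g w) \<in> L2_circle" "(\<lambda>w. k * f w) \<in> L2_circle"
proof -
  note D = L2_circleD[OF f] L2_circleD[OF g]
  note [measurable] = D(1,3)
  have "integrable circle_measure (\<lambda>w. (f w + g w)\<^sup>2)"
  proof (rule Bochner_Integration.integrable_bound)
    show "integrable circle_measure (\<lambda>w. 2 * (f w)\<^sup>2 + 2 * (g w)\<^sup>2)" using D by simp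
    have "(f w + g w)\<^sup>2 \<le> 2 * (f w)\<^sup>2 + 2 * (g w)\<^sup>2" for w
      using sum_squares_bound[of "f w" "g w"] by (simp add: power2_sum)
    then show "AE w in circle_measure. norm ((f w + g w)\<^sup>2) \<le> norm (2 * (f w)\<^sup>2 + 2 * (g w)\<^sup>2)"
      by (intro AE_I2) simp
  qed measurable
  then show "(\<lambda>w. f w + g w) \<in> L2_circle" by (simp add: L2_circle_def)
  show "(\<lambda>w. k * f w) \<in> L2_circle" using D by (simp add: L2_circle_def power_mult_distrib)
qed

lemma L2_circle_diff:
  "f \<in> L2_circle \<Longrightarrow> g \<in> L2_circle \<Longrightarrow> (\<lambda>w. f w - g w) \<in> L2_circle"
  using L2_circle_add(1)[of f "\<lambda>w. -1 * g w"] L2_circle_add(2)[of g g "-1"] by simp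

lemma L2_circle_bounded_mult:
  fixes c :: "complex \<Rightarrow> real"
  assumes f: "f \<in> L2_circle" and c: "continuous_on (sphere 0 1) c"
  shows "(\<lambda>w. c w * f w) \<in> L2_circle"
proof -
  note [measurable] = L2_circleD(1)[OF f] L2_circleD(1)[OF continuous_on_L2[OF c]]
  have "bounded (c ` sphere 0 1)"
    using compact_continuous_image[OF c compact_sphere] compact_imp_bounded by blast
  then obtain B where B: "\<And>w. w \<in> sphere 0 1 \<Longrightarrow> \<bar>c w\<bar> \<le> B" unfolding bounded_iff by (metis image_eqI real_norm_def)
  have "integrable circle_measure (\<lambda>w. (c w * f w)\<^sup>2)"
  proof (rule Bochner_Integration.integrable_bound)
    show "integrable circle_measure (\<lambda>w. B\<^sup>2 * (f w)\<^sup>2)" using L2_circleD[OF f] by simp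
    show "AE w in circle_measure. norm ((c w * f w)\<^sup>2) \<le> norm (B\<^sup>2 * (f w)\<^sup>2)"
    proof (rule AE_I2)
      fix w assume "w \<in> space circle_measure"
      then have "\<bar>c w\<bar>\<^sup>2 \<le> B\<^sup>2" using B by (intro power_mono) auto
      then show "norm ((c w * f w)\<^sup>2) \<le> norm (B\<^sup>2 * (f w)\<^sup>2)"
        by (simp add: power_mult_distrib mult_right_mono)
    qed
  qed measurable
  then show ?thesis by (simp add: L2_circle_def)
qed

lemma continuous_on_S_op:
  assumes g: "g \<in> L2_circle"
  shows "continuous_on (sphere 0 1) (S_op g)"
  unfolding continuous_on_iff
proof (intro ballI allI impI)
  fix w :: complex and e :: real assume w: "w \<in> sphere 0 1" and e: "e > 0"
  define M where "M = (\<integral>p. S_majorant g p \<partial>C3)"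
  have M: "M \<ge> 0" unfolding M_def S_majorant_def by (intro Bochner_Integration.integral_nonneg) auto
  have e': "e / (M + 1) > 0" using e M by simp
  obtain d where d: "d > 0" "\<And>g w v. g \<in> L2_circle \<Longrightarrow> w \<in> sphere 0 1 \<Longrightarrow> v \<in> sphere 0 1 \<Longrightarrow> dist w v < d \<Longrightarrow>
      \<bar>S_op g w - S_op g v\<bar> \<le> e / (M + 1) * (\<integral>p. S_majorant g p \<partial>C3)"
    by (rule S_op_modulus[OF e']) auto
  have "e / (M + 1) * M < e" using e M by (simp add: field_simps)
  then show "\<exists>d>0. \<forall>v\<in>sphere 0 1. dist v w < d \<longrightarrow> dist (S_op g v) (S_op g w) < e"
    using d(1) d(2)[OF g _ w] unfolding dist_real_def M_def[symmetric] by (meson le_less_trans)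
qed

text \<open>If the moment of g vanished, this would be 0 almost everywhere, and g would agree with
  the continuous function - S_op g / c_fun.\<close>

definition residual :: "(complex \<Rightarrow> real) \<Rightarrow> complex \<Rightarrow> real" where
  "residual g w = c_fun w * g w + S_op g w"

lemma residual_L2:
  assumes g: "g \<in> L2_circle"
  shows "residual g \<in> L2_circle"
  unfolding residual_def[abs_def]
  by (rule L2_circle_add(1)[OF L2_circle_bounded_mult[OF g continuous_on_c_fun]
      continuous_on_L2[OF continuous_on_S_op[OF g]]])

lemma residual_bound:
  assumes g: "g \<in> L2_circle"
  shows "(\<integral>w. (residual g w)\<^sup>2 \<partial>circle_measure) \<le> 655360 * pi ^ 3 * (\<integral>x. (norm (moment g x))\<^sup>2 \<partial>delta6)"
proof -
  let ?R = "residual g"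
  note R = residual_L2[OF g]
  \<comment> \<open>Young's inequality is applied to 64 times the product of residual and moment, 64
    being the bound of the cutoff. With this \<open>\<alpha>\<close>, the bound of
    \<open>integrable_coord\<close> makes the residual term exactly half of the left-hand side,
    which absorbs it.\<close>
  define \<alpha> where "\<alpha> = 1 / (320 * pi ^ 3)"
  have \<alpha>: "\<alpha> > 0" by (simp add: \<alpha>_def)
  have I1: "integrable delta6 (\<lambda>x. \<alpha> * (?R (coord 0 x))\<^sup>2)"
    using integrable_coord(1)[OF L2_circleD(2)[OF R], of 0] by simp
  have I2: "integrable delta6 (\<lambda>x. 1024 / \<alpha> * (norm (moment g x))\<^sup>2)"
    using integrable_moment_square(1)[OF g] by simp
  have "(\<integral>w. (?R w)\<^sup>2 \<partial>circle_measure) = (\<integral>x. ?R (coord 0 x) * (coord 0 x \<bullet> moment g x) * cutoff (\<lambda>i. coord i x) \<partial>delta6)"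
    unfolding averaging(1)[OF g R] by (simp add: power2_eq_square residual_def)
  also have "\<dots> \<le> (\<integral>x. \<alpha> * (?R (coord 0 x))\<^sup>2 + 1024 / \<alpha> * (norm (moment g x))\<^sup>2 \<partial>delta6)"
  proof (rule integral_mono_AE[OF averaging(2)[OF g R] Bochner_Integration.integrable_add[OF I1 I2]])
    show "AE x in delta6. ?R (coord 0 x) * (coord 0 x \<bullet> moment g x) * cutoff (\<lambda>i. coord i x)
        \<le> \<alpha> * (?R (coord 0 x))\<^sup>2 + 1024 / \<alpha> * (norm (moment g x))\<^sup>2"
      using AE_delta6_config
    proof eventually_elim
      case (elim x)
      let ?r = "\<bar>?R (coord 0 x)\<bar>" and ?m = "norm (moment g x)"
      have c: "\<bar>cutoff (\<lambda>i. coord i x)\<bar> \<le> 64" using cutoff_bounds[of "\<lambda>i. coord i x"] elim by auto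
      have d: "\<bar>coord 0 x \<bullet> moment g x\<bar> \<le> ?m" using Cauchy_Schwarz_ineq2[of "coord 0 x" "moment g x"] elim by simp
      have "?R (coord 0 x) * (coord 0 x \<bullet> moment g x) * cutoff (\<lambda>i. coord i x)
          \<le> ?r * \<bar>coord 0 x \<bullet> moment g x\<bar> * \<bar>cutoff (\<lambda>i. coord i x)\<bar>"
        by (metis abs_ge_self abs_mult)
      also have "\<dots> \<le> ?r * ?m * 64" using c d by (intro mult_mono) auto
      also have "\<dots> = 2 * ((sqrt \<alpha> * ?r) * (32 / sqrt \<alpha> * ?m))" using \<alpha> by simp
      also have "\<dots> \<le> (sqrt \<alpha> * ?r)\<^sup>2 + (32 / sqrt \<alpha> * ?m)\<^sup>2"
        using sum_squares_bound[of "sqrt \<alpha> * ?r" "32 / sqrt \<alpha> * ?m"] by (simp only: mult.assoc)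
      also have "\<dots> = \<alpha> * (?R (coord 0 x))\<^sup>2 + 1024 / \<alpha> * ?m\<^sup>2"
        using \<alpha> by (simp add: power_mult_distrib power_divide)
      finally show ?case .
    qed
  qed
  also have "\<dots> = \<alpha> * (\<integral>x. (?R (coord 0 x))\<^sup>2 \<partial>delta6) + 1024 / \<alpha> * (\<integral>x. (norm (moment g x))\<^sup>2 \<partial>delta6)"
    using I1 I2 by simp
  also have "\<dots> \<le> \<alpha> * (160 * pi ^ 3 * (\<integral>w. (?R w)\<^sup>2 \<partial>circle_measure)) + 1024 / \<alpha> * (\<integral>x. (norm (moment g x))\<^sup>2 \<partial>delta6)"
    using integrable_coord(2)[OF L2_circleD(2)[OF R], of 0] \<alpha> by (intro add_right_mono mult_left_mono) auto
  also have "\<alpha> * (160 * pi ^ 3 * (\<integral>w. (?R w)\<^sup>2 \<partial>circle_measure)) = (\<integral>w. (?R w)\<^sup>2 \<partial>circle_measure) / 2"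
    by (simp add: \<alpha>_def)
  also have "1024 / \<alpha> * (\<integral>x. (norm (moment g x))\<^sup>2 \<partial>delta6) = 327680 * pi ^ 3 * (\<integral>x. (norm (moment g x))\<^sup>2 \<partial>delta6)"
    by (simp add: \<alpha>_def)
  finally show ?thesis by simp
qed

lemma moment_scale: "moment (\<lambda>w. k * g w) x = k *\<^sub>R moment g x"
  by (simp add: moment_def scaleR_sum_right)

lemma moment_add: "moment (\<lambda>w. f w + g w) x = moment f x + moment g x"
  by (simp add: moment_def scaleR_add_left sum.distrib)

lemma square_add_le: "(norm (a + b))\<^sup>2 \<le> 2 * (norm a)\<^sup>2 + 2 * (norm (b::complex))\<^sup>2"
proof -
  have "(norm (a + b))\<^sup>2 \<le> (norm a + norm b)\<^sup>2" by (intro power_mono norm_triangle_ineq) auto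
  also have "\<dots> \<le> 2 * (norm a)\<^sup>2 + 2 * (norm b)\<^sup>2"
    using sum_squares_bound[of "norm a" "norm b"] by (simp add: power2_sum)
  finally show ?thesis .
qed

text \<open>In c_fun u = residual u - S_op u the residuals tend to 0 in L^2 by
  \<open>residual_bound\<close>, and the functions S_op u have a uniformly convergent subsequence.
  Division by c_fun, which is bounded below, gives an L^2 limit with a continuous representative.
  One good index for each \<open>e\<close> is all that is needed later.\<close>

lemma coercive_compactness:
  assumes u: "\<And>n. u n \<in> L2_circle" and one: "\<And>n. (\<integral>w. (u n w)\<^sup>2 \<partial>circle_measure) = 1"
    and E: "\<And>n. (\<integral>x. (norm (moment (u n) x))\<^sup>2 \<partial>delta6) \<le> 1 / real (Suc n)"
  obtains g where "continuous_on (sphere 0 1) g"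
    "\<And>e. e > 0 \<Longrightarrow> \<exists>n. (\<integral>w. (u n w - g w)\<^sup>2 \<partial>circle_measure) \<le> e \<and> (\<integral>x. (norm (moment (u n) x))\<^sup>2 \<partial>delta6) \<le> e"
proof -
  obtain c where c: "c > 0" "\<And>w. w \<in> sphere 0 1 \<Longrightarrow> c \<le> c_fun w" using c_fun_bounds by metis
  define M where "M = 40 * pi\<^sup>2 * (pi + 1 / 2)"
  have M0: "M > 0" unfolding M_def by (intro mult_pos_pos add_pos_pos) auto
  have maj: "(\<integral>p. S_majorant (u n) p \<partial>C3) \<le> M" for n
    unfolding S_majorant_integrable(2)[OF u] M_def
    using integrable_L2(3)[OF u[of n]] one[of n] by (intro mult_left_mono) auto
  obtain s k where s: "continuous_on (sphere 0 1) s" and k: "strict_mono (k :: nat \<Rightarrow> nat)"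
    and lim: "\<And>e. 0 < e \<Longrightarrow> \<exists>N. \<forall>n x. n \<ge> N \<and> x \<in> sphere 0 1 \<longrightarrow> norm (S_op (u (k n)) x - s x) < e"
  proof (rule Arzela_Ascoli[of "sphere 0 1" "\<lambda>n. S_op (u n)" "256 * M"])
    show "norm (S_op (u n) w) \<le> 256 * M" if "w \<in> sphere 0 1" for n w
      using S_integrand_integrable(2)[OF u[of n] that] maj[of n] by simp
    fix w :: complex and e :: real assume w: "w \<in> sphere 0 1" and e: "0 < e"
    have e': "e / (2 * M) > 0" using e M0 by simp
    obtain d where d: "d > 0" "\<And>g w v. g \<in> L2_circle \<Longrightarrow> w \<in> sphere 0 1 \<Longrightarrow> v \<in> sphere 0 1 \<Longrightarrow> dist w v < d \<Longrightarrow>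
        \<bar>S_op g w - S_op g v\<bar> \<le> e / (2 * M) * (\<integral>p. S_majorant g p \<partial>C3)"
      by (rule S_op_modulus[OF e']) auto
    have "norm (S_op (u n) w - S_op (u n) y) < e" if y: "y \<in> sphere 0 1" "norm (w - y) < d" for n y
    proof -
      have "\<bar>S_op (u n) w - S_op (u n) y\<bar> \<le> e / (2 * M) * (\<integral>p. S_majorant (u n) p \<partial>C3)"
        using y by (intro d(2) u w) (auto simp: dist_norm)
      also have "\<dots> \<le> e / (2 * M) * M" using e' by (intro mult_left_mono maj) auto
      also have "\<dots> < e" using e M0 by simp
      finally show ?thesis by simp
    qed
    then show "\<exists>d. 0 < d \<and> (\<forall>n y. y \<in> sphere 0 1 \<and> norm (w - y) < d \<longrightarrow> norm (S_op (u n) w - S_op (u n) y) < e)"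
      using d(1) by blast
  qed auto
  define g where "g w = - s w / c_fun w" for w
  have cont: "continuous_on (sphere 0 1) g"
    unfolding g_def using s continuous_on_c_fun c by (intro continuous_intros) force+
  note gL = continuous_on_L2[OF cont]
  show ?thesis
  proof (rule that[OF cont])
    fix e :: real assume e: "e > 0"
    define C where "C = 655360 * pi ^ 3"
    have C: "C > 0" unfolding C_def by simp
    \<comment> \<open>Chosen so that 2 t^2 / c^2, integrated over the circle of length 2 pi, is e /
      2.\<close>
    define t where "t = sqrt (e * c\<^sup>2 / (8 * pi))"
    have t: "t > 0" "4 * pi * t\<^sup>2 / c\<^sup>2 = e / 2" unfolding t_def using e c by auto
    obtain N where N: "\<And>n x. n \<ge> N \<Longrightarrow> x \<in> sphere 0 1 \<Longrightarrow> norm (S_op (u (k n)) x - s x) < t"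
      using lim[OF t(1)] by blast
    \<comment> \<open>The first summand brings the form below \<open>e\<close>, the second brings
      the residual contribution below e / 2.\<close>
    obtain n0 :: nat where n0: "1 / e + 4 * C / (c\<^sup>2 * e) < real n0" using reals_Archimedean2 by blast
    define n where "n = max N n0"
    have "real n0 \<le> real (Suc (k n))" using seq_suble[OF k, of n] unfolding n_def by simp
    then have kn: "1 / e + 4 * C / (c\<^sup>2 * e) < real (Suc (k n))" using n0 by simp
    have p: "0 < 1 / e" "0 \<le> 4 * C / (c\<^sup>2 * e)" using e C by auto
    let ?E = "\<integral>x. (norm (moment (u (k n)) x))\<^sup>2 \<partial>delta6"
    have E1: "?E \<le> e"
    proof -
      have "1 / e \<le> real (Suc (k n))" using kn p by linarith
      then have "1 / real (Suc (k n)) \<le> e" using e by (simp add: field_simps)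
      then show ?thesis using E[of "k n"] by linarith
    qed
    have E2: "2 * C / c\<^sup>2 * ?E \<le> e / 2"
    proof -
      have "4 * C / (c\<^sup>2 * e) \<le> real (Suc (k n))" using kn p by linarith
      then have "4 * C / (c\<^sup>2 * e) * (c\<^sup>2 * e) \<le> real (Suc (k n)) * (c\<^sup>2 * e)"
        using e by (intro mult_right_mono) auto
      then have "4 * C \<le> e * (c\<^sup>2 * real (Suc (k n)))" using e c by (simp add: mult_ac)
      then have "4 * C / (c\<^sup>2 * real (Suc (k n))) \<le> e"
        using c by (subst pos_divide_le_eq) auto
      then have "2 * C / c\<^sup>2 * (1 / real (Suc (k n))) \<le> e / 2" by simp
      moreover have "2 * C / c\<^sup>2 * ?E \<le> 2 * C / c\<^sup>2 * (1 / real (Suc (k n)))"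
        using E[of "k n"] C by (intro mult_left_mono) auto
      ultimately show ?thesis by linarith
    qed
    let ?R = "residual (u (k n))"
    have RI: "integrable circle_measure (\<lambda>w. 2 / c\<^sup>2 * (?R w)\<^sup>2 + 2 * t\<^sup>2 / c\<^sup>2)"
      using L2_circleD(2)[OF residual_L2[OF u]] by simp
    have DI: "integrable circle_measure (\<lambda>w. (u (k n) w - g w)\<^sup>2)"
      using L2_circleD(2)[OF L2_circle_diff[OF u gL]] .
    have "(\<integral>w. (u (k n) w - g w)\<^sup>2 \<partial>circle_measure) \<le> (\<integral>w. 2 / c\<^sup>2 * (?R w)\<^sup>2 + 2 * t\<^sup>2 / c\<^sup>2 \<partial>circle_measure)"
    proof (rule integral_mono[OF DI RI])
      fix w assume "w \<in> space circle_measure"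
      then have w: "w \<in> sphere 0 1" by simp
      define a where "a = ?R w"
      define b where "b = S_op (u (k n)) w - s w"
      have cw: "c \<le> c_fun w" "c_fun w > 0" using c(2)[OF w] c(1) by auto
      have b: "\<bar>b\<bar> \<le> t" using N[of n w] w by (simp add: b_def n_def less_imp_le)
      have "u (k n) w - g w = (a - b) / c_fun w"
        unfolding a_def b_def residual_def g_def using cw by (simp add: field_simps)
      then have "(u (k n) w - g w)\<^sup>2 = (a - b)\<^sup>2 / (c_fun w)\<^sup>2" by (simp add: power_divide)
      also have "\<dots> \<le> (a - b)\<^sup>2 / c\<^sup>2"
        using cw c by (intro divide_left_mono power_mono) auto
      also have "\<dots> \<le> (2 * a\<^sup>2 + 2 * t\<^sup>2) / c\<^sup>2"
      proof (rule divide_right_mono)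
        have "b\<^sup>2 \<le> t\<^sup>2" using power_mono[OF b, of 2] by simp
        then show "(a - b)\<^sup>2 \<le> 2 * a\<^sup>2 + 2 * t\<^sup>2"
          using sum_squares_bound[of a "- b"] by (simp add: power2_diff)
      qed simp
      also have "\<dots> = 2 / c\<^sup>2 * a\<^sup>2 + 2 * t\<^sup>2 / c\<^sup>2" by (simp add: add_divide_distrib)
      finally show "(u (k n) w - g w)\<^sup>2 \<le> 2 / c\<^sup>2 * (?R w)\<^sup>2 + 2 * t\<^sup>2 / c\<^sup>2" by (simp add: a_def)
    qed
    also have "\<dots> = 2 / c\<^sup>2 * (\<integral>w. (?R w)\<^sup>2 \<partial>circle_measure) + 4 * pi * t\<^sup>2 / c\<^sup>2"
      using L2_circleD(2)[OF residual_L2[OF u]] measure_circle by simp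
    also have "\<dots> \<le> 2 / c\<^sup>2 * (C * ?E) + e / 2"
      unfolding t(2) C_def by (intro add_right_mono mult_left_mono residual_bound u) simp
    also have "\<dots> \<le> e" using E2 by simp
    finally show "\<exists>n. (\<integral>w. (u n w - g w)\<^sup>2 \<partial>circle_measure) \<le> e \<and> (\<integral>x. (norm (moment (u n) x))\<^sup>2 \<partial>delta6) \<le> e"
      using E1 by blast
  qed
qed

text \<open>A normalised sequence violating the bound has an L^2 limit point with vanishing moment,
  which is therefore a constant c. Mean zero and norm one give a squared L^2 distance from c of 1 +
  2 pi c^2 >= 1, so constants cannot be approached.\<close>

lemma moment_coercive:
  obtains \<kappa> where "\<kappa> > 0"
    "\<And>g. g \<in> L2_circle \<Longrightarrow> (\<integral>w. g w \<partial>circle_measure) = 0 \<Longrightarrow>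
      \<kappa> * (\<integral>w. (g w)\<^sup>2 \<partial>circle_measure) \<le> (\<integral>x. (norm (moment g x))\<^sup>2 \<partial>delta6)"
proof (rule ccontr)
  assume no: "\<not> thesis"
  have "\<exists>u \<in> L2_circle. (\<integral>w. u w \<partial>circle_measure) = 0 \<and> (\<integral>w. (u w)\<^sup>2 \<partial>circle_measure) = 1
      \<and> (\<integral>x. (norm (moment u x))\<^sup>2 \<partial>delta6) \<le> 1 / real (Suc n)" for n
  proof -
    have "\<exists>g \<in> L2_circle. (\<integral>w. g w \<partial>circle_measure) = 0 \<and>
      (\<integral>x. (norm (moment g x))\<^sup>2 \<partial>delta6) < 1 / real (Suc n) * (\<integral>w. (g w)\<^sup>2 \<partial>circle_measure)"
      using that[of "1 / real (Suc n)"] no by (force simp: not_le)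
    then obtain g where g: "g \<in> L2_circle" "(\<integral>w. g w \<partial>circle_measure) = 0"
      "(\<integral>x. (norm (moment g x))\<^sup>2 \<partial>delta6) < 1 / real (Suc n) * (\<integral>w. (g w)\<^sup>2 \<partial>circle_measure)" by blast
    define A where "A = (\<integral>w. (g w)\<^sup>2 \<partial>circle_measure)"
    have "0 \<le> (\<integral>x. (norm (moment g x))\<^sup>2 \<partial>delta6)" by (intro Bochner_Integration.integral_nonneg) auto
    then have "0 < 1 / real (Suc n) * A" using g(3) unfolding A_def by linarith
    then have A: "A > 0" by (simp add: zero_less_divide_iff)
    let ?u = "\<lambda>w. 1 / sqrt A * g w"
    have "(\<integral>w. ?u w \<partial>circle_measure) = 0" using g(2) by simp
    moreover have "(\<integral>w. (?u w)\<^sup>2 \<partial>circle_measure) = 1"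
      using A by (simp add: power_mult_distrib power_divide A_def[symmetric])
    moreover have "(\<integral>x. (norm (moment ?u x))\<^sup>2 \<partial>delta6) \<le> 1 / real (Suc n)"
    proof -
      have "(\<integral>x. (norm (moment ?u x))\<^sup>2 \<partial>delta6) = 1 / A * (\<integral>x. (norm (moment g x))\<^sup>2 \<partial>delta6)"
        unfolding moment_scale using A by (simp add: power_mult_distrib power_divide)
      also have "\<dots> \<le> 1 / A * (1 / real (Suc n) * A)"
        using g(3) A unfolding A_def[symmetric] by (intro mult_left_mono) simp_all
      also have "\<dots> = 1 / real (Suc n)" using A by simp
      finally show ?thesis .
    qed
    ultimately show ?thesis
      using L2_circle_add(2)[OF g(1) g(1), of "1 / sqrt A"] by blast
  qed
  then obtain u where u: "\<And>n. u n \<in> L2_circle" "\<And>n. (\<integral>w. u n w \<partial>circle_measure) = 0"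
    "\<And>n. (\<integral>w. (u n w)\<^sup>2 \<partial>circle_measure) = 1" "\<And>n. (\<integral>x. (norm (moment (u n) x))\<^sup>2 \<partial>delta6) \<le> 1 / real (Suc n)"
    by metis
  obtain g where cont: "continuous_on (sphere 0 1) g"
    and app: "\<And>e. e > 0 \<Longrightarrow> \<exists>n. (\<integral>w. (u n w - g w)\<^sup>2 \<partial>circle_measure) \<le> e \<and> (\<integral>x. (norm (moment (u n) x))\<^sup>2 \<partial>delta6) \<le> e"
    by (rule coercive_compactness[OF u(1,3,4)]) (rule that)
  note gL = continuous_on_L2[OF cont]
  let ?E = "\<integral>x. (norm (moment g x))\<^sup>2 \<partial>delta6"
  have le: "?E \<le> (2 + 11520 * pi ^ 3) * e" if e: "e > 0" for e
  proof -
    obtain n where n: "(\<integral>w. (u n w - g w)\<^sup>2 \<partial>circle_measure) \<le> e" "(\<integral>x. (norm (moment (u n) x))\<^sup>2 \<partial>delta6) \<le> e"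
      using app[OF e] by blast
    let ?d = "\<lambda>w. g w - u n w"
    have dL: "?d \<in> L2_circle" by (rule L2_circle_diff[OF gL u(1)])
    have m: "moment g x = moment (u n) x + moment ?d x" for x
      using moment_add[of "u n" ?d x] by simp
    have "?E \<le> (\<integral>x. 2 * (norm (moment (u n) x))\<^sup>2 + 2 * (norm (moment ?d x))\<^sup>2 \<partial>delta6)"
    proof (rule integral_mono)
      show "integrable delta6 (\<lambda>x. 2 * (norm (moment (u n) x))\<^sup>2 + 2 * (norm (moment ?d x))\<^sup>2)"
        using integrable_moment_square(1)[OF u(1)[of n]] integrable_moment_square(1)[OF dL] by simp
      show "(norm (moment g x))\<^sup>2 \<le> 2 * (norm (moment (u n) x))\<^sup>2 + 2 * (norm (moment ?d x))\<^sup>2" for x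
        unfolding m by (rule square_add_le)
    qed (rule integrable_moment_square(1)[OF gL])
    also have "\<dots> = 2 * (\<integral>x. (norm (moment (u n) x))\<^sup>2 \<partial>delta6) + 2 * (\<integral>x. (norm (moment ?d x))\<^sup>2 \<partial>delta6)"
      using integrable_moment_square(1)[OF u(1)[of n]] integrable_moment_square(1)[OF dL] by simp
    also have "\<dots> \<le> 2 * e + 2 * (5760 * pi ^ 3 * e)"
    proof -
      have "(\<integral>w. (?d w)\<^sup>2 \<partial>circle_measure) \<le> e" using n(1) by (simp add: power2_commute)
      then have "5760 * pi ^ 3 * (\<integral>w. (?d w)\<^sup>2 \<partial>circle_measure) \<le> 5760 * pi ^ 3 * e"
        by (intro mult_left_mono) auto
      then show ?thesis using integrable_moment_square(2)[OF dL] n(2) by linarith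
    qed
    finally show ?thesis by (simp add: algebra_simps)
  qed
  have "?E \<le> 0"
  proof (rule ccontr)
    assume "\<not> ?E \<le> 0"
    define K where "K = 2 + 11520 * pi ^ 3"
    have K: "K > 0" unfolding K_def by (intro add_pos_pos) auto
    have "?E \<le> K * (?E / (2 * K))"
      unfolding K_def by (rule le) (use K \<open>\<not> ?E \<le> 0\<close> in \<open>simp add: K_def\<close>)
    then have "?E \<le> ?E / 2" using K by simp
    then show False using \<open>\<not> ?E \<le> 0\<close> by simp
  qed
  moreover have "?E \<ge> 0" by (intro Bochner_Integration.integral_nonneg) auto
  ultimately have "?E = 0" by simp
  then obtain c where c: "\<And>w. w \<in> sphere 0 1 \<Longrightarrow> g w = c"
    using moment_eq_0_imp_constant[OF cont gL] by blast
  obtain n where n: "(\<integral>w. (u n w - g w)\<^sup>2 \<partial>circle_measure) \<le> 1 / 2" using app[of "1 / 2"] by auto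
  have "(\<integral>w. (u n w - g w)\<^sup>2 \<partial>circle_measure) = (\<integral>w. (u n w)\<^sup>2 - 2 * c * u n w + c\<^sup>2 \<partial>circle_measure)"
    by (intro Bochner_Integration.integral_cong) (auto simp: c power2_diff)
  also have "\<dots> = 1 + 2 * pi * c\<^sup>2"
    using L2_circleD(2)[OF u(1)] integrable_L2(1)[OF u(1)] u(2,3) measure_circle by simp
  finally have "1 + 2 * pi * c\<^sup>2 \<le> 1 / 2" using n by simp
  moreover have "0 \<le> 2 * pi * c\<^sup>2" by simp
  ultimately show False by linarith
qed

subsection \<open>The nonlinear estimate\<close>

text \<open>Almost everywhere the weight can be read off either triple because the six points sum to
  0. For the triple (3, 4, 5) a permutation exchanging the triples leads back to
  \<open>nn_integral_triple_bound\<close>.\<close>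

lemma triple_product_bound:
  assumes a: "a \<in> L2_circle" and b: "b \<in> L2_circle" and c: "c \<in> L2_circle"
    and ijk: "(i, j, k) = (0, 1, 2) \<or> (i, j, k) = (3, 4, 5)"
  shows "integrable delta6 (\<lambda>x. (a (coord i x) * b (coord j x) * c (coord k x))\<^sup>2 * \<bar>weight x\<bar>)" (is ?I)
    and "(\<integral>x. (a (coord i x) * b (coord j x) * c (coord k x))\<^sup>2 * \<bar>weight x\<bar> \<partial>delta6)
      \<le> 32 * pi * ((\<integral>w. (a w)\<^sup>2 \<partial>circle_measure) * (\<integral>w. (b w)\<^sup>2 \<partial>circle_measure) * (\<integral>w. (c w)\<^sup>2 \<partial>circle_measure))"
      (is "_ \<le> ?B")
proof -
  note D = L2_circleD[OF a] L2_circleD[OF b] L2_circleD[OF c]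
  note [measurable] = D(1,3,5)
  let ?sq = "\<lambda>f w. ennreal ((f w)\<^sup>2)"
  define F where "F q = ?sq a (q 0) * ?sq b (q 1) * ?sq c (q 2) * ennreal \<bar>(norm (q 0 + q 1 + q 2))\<^sup>2 - 1\<bar>"
    for q :: "nat \<Rightarrow> complex"
  have Fm: "(\<lambda>x. F (\<lambda>i. coord i x)) \<in> borel_measurable circle6" unfolding F_def by measurable
  have sq: "(\<integral>\<^sup>+w. ?sq f w \<partial>circle_measure) = ennreal (\<integral>w. (f w)\<^sup>2 \<partial>circle_measure)"
    if "integrable circle_measure (\<lambda>w. (f w)\<^sup>2)" for f
    using that by (intro nn_integral_eq_integral) auto
  have "(\<integral>\<^sup>+x. F (\<lambda>i. coord i x) \<partial>delta6) \<le> ennreal (32 * pi) *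
      ((\<integral>\<^sup>+w. ?sq a w \<partial>circle_measure) * (\<integral>\<^sup>+w. ?sq b w \<partial>circle_measure) * (\<integral>\<^sup>+w. ?sq c w \<partial>circle_measure))"
    unfolding F_def by (rule nn_integral_triple_bound) measurable
  also have "\<dots> = ennreal ?B"
    unfolding sq[OF D(2)] sq[OF D(4)] sq[OF D(6)]
    by (simp add: ennreal_mult[symmetric])
  finally have F: "(\<integral>\<^sup>+x. F (\<lambda>i. coord i x) \<partial>delta6) \<le> ennreal ?B" .
  have G: "(\<integral>\<^sup>+x. ennreal ((a (coord i x) * b (coord j x) * c (coord k x))\<^sup>2 * \<bar>weight x\<bar>) \<partial>delta6)
      = (\<integral>\<^sup>+x. F (\<lambda>i. coord i x) \<partial>delta6)"
    using ijk
  proof (elim disjE)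
    assume e: "(i, j, k) = (0, 1, 2)"
    show ?thesis
    proof (rule nn_integral_cong_AE, use AE_weight in eventually_elim)
      fix x assume "weight x = triple_weight (\<lambda>i. coord i x) \<and> \<bar>weight x\<bar> \<le> 8"
      then have "weight x = (norm (coord 0 x + coord 1 x + coord 2 x))\<^sup>2 - 1"
        by (simp add: triple_weight_def)
      then show "ennreal ((a (coord i x) * b (coord j x) * c (coord k x))\<^sup>2 * \<bar>weight x\<bar>) = F (\<lambda>i. coord i x)"
        using e unfolding F_def by (simp add: ennreal_mult[symmetric] power_mult_distrib)
    qed
  next
    assume e: "(i, j, k) = (3, 4, 5)"
    define p where "p = Transposition.transpose 0 3 \<circ> (Transposition.transpose 1 4 \<circ> Transposition.transpose 2 (5::nat))"
    have p: "perm6 p" unfolding p_def by (intro perm6_comp perm6_transpose) auto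
    have pv: "p 0 = 3" "p 1 = 4" "p 2 = 5" by (simp_all add: p_def Transposition.transpose_def)
    have "(\<integral>\<^sup>+x. ennreal ((a (coord i x) * b (coord j x) * c (coord k x))\<^sup>2 * \<bar>weight x\<bar>) \<partial>delta6)
      = (\<integral>\<^sup>+x. F (\<lambda>i. coord (p i) x) \<partial>delta6)"
      unfolding F_def pv weight_def using e by (simp add: ennreal_mult[symmetric] power_mult_distrib)
    also have "\<dots> = (\<integral>\<^sup>+x. F (\<lambda>i. coord i x) \<partial>delta6)"
      by (rule nn_integral_perm6[OF p Fm]) (simp add: F_def)
    finally show ?thesis .
  qed
  have m: "(\<lambda>x. (a (coord i x) * b (coord j x) * c (coord k x))\<^sup>2 * \<bar>weight x\<bar>) \<in> borel_measurable delta6"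
    by measurable
  show I: ?I
  proof (rule integrableI_bounded[OF m])
    have "(\<integral>\<^sup>+x. ennreal (norm ((a (coord i x) * b (coord j x) * c (coord k x))\<^sup>2 * \<bar>weight x\<bar>)) \<partial>delta6) \<le> ennreal ?B"
      using F G by simp
    also have "\<dots> < \<infinity>" by simp
    finally show "(\<integral>\<^sup>+x. ennreal (norm ((a (coord i x) * b (coord j x) * c (coord k x))\<^sup>2 * \<bar>weight x\<bar>)) \<partial>delta6) < \<infinity>" .
  qed
  have "ennreal (\<integral>x. (a (coord i x) * b (coord j x) * c (coord k x))\<^sup>2 * \<bar>weight x\<bar> \<partial>delta6) \<le> ennreal ?B"
    using nn_integral_eq_integral[OF I] F G by simp
  then show "(\<integral>x. (a (coord i x) * b (coord j x) * c (coord k x))\<^sup>2 * \<bar>weight x\<bar> \<partial>delta6) \<le> ?B"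
    by (subst (asm) ennreal_le_iff) (auto intro!: mult_nonneg_nonneg)
qed

text \<open>The part of order at least two in g of the product of the three factors 1 + g.\<close>

definition higher :: "(complex \<Rightarrow> real) \<Rightarrow> nat \<Rightarrow> nat \<Rightarrow> nat \<Rightarrow> complex6 \<Rightarrow> real" where
  "higher g i j k x = g (coord i x) * g (coord j x) + g (coord i x) * g (coord k x) + g (coord j x) * g (coord k x)
     + g (coord i x) * g (coord j x) * g (coord k x)"

lemma square_sum4_le: "(a + b + c + d)\<^sup>2 \<le> 4 * (a\<^sup>2 + b\<^sup>2 + c\<^sup>2 + (d::real)\<^sup>2)"
proof -
  have "4 * (a\<^sup>2 + b\<^sup>2 + c\<^sup>2 + d\<^sup>2) - (a + b + c + d)\<^sup>2
      = (a - b)\<^sup>2 + (a - c)\<^sup>2 + (a - d)\<^sup>2 + (b - c)\<^sup>2 + (b - d)\<^sup>2 + (c - d)\<^sup>2"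
    by (simp add: power2_eq_square algebra_simps)
  moreover have "\<dots> \<ge> 0" by (intro add_nonneg_nonneg) auto
  ultimately show ?thesis by linarith
qed

text \<open>A product of two values of g is a triple product with a factor 1 of squared norm 2 pi,
  hence 64 pi^2 for each of the three quadratic terms. The cubic term is lowered to second order in
  the squared norm by \<open>s\<close>, and 896 = 4 (64 + 64 + 64 + 32).\<close>

lemma higher_bound:
  assumes g: "g \<in> L2_circle" and s: "(\<integral>w. (g w)\<^sup>2 \<partial>circle_measure) \<le> 1"
    and ijk: "(i, j, k) = (0, 1, 2) \<or> (i, j, k) = (3, 4, 5)"
  shows "integrable delta6 (\<lambda>x. (higher g i j k x)\<^sup>2 * \<bar>weight x\<bar>)"
    and "(\<integral>x. (higher g i j k x)\<^sup>2 * \<bar>weight x\<bar> \<partial>delta6) \<le> 896 * pi\<^sup>2 * (\<integral>w. (g w)\<^sup>2 \<partial>circle_measure)\<^sup>2"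
proof -
  note [measurable] = L2_circleD(1)[OF g]
  let ?s = "\<integral>w. (g w)\<^sup>2 \<partial>circle_measure"
  have s0: "?s \<ge> 0" by (intro Bochner_Integration.integral_nonneg) auto
  have one: "(\<lambda>_. 1) \<in> L2_circle" by (rule continuous_on_L2) auto
  let ?t = "\<lambda>a b c x. (a (coord i x) * b (coord j x) * c (coord k x))\<^sup>2 * \<bar>weight x\<bar>"
  note T1 = triple_product_bound[OF g g one ijk] and T2 = triple_product_bound[OF g one g ijk]
    and T3 = triple_product_bound[OF one g g ijk] and T4 = triple_product_bound[OF g g g ijk]
  let ?u = "\<lambda>x. 4 * (?t g g (\<lambda>_. 1) x + ?t g (\<lambda>_. 1) g x + ?t (\<lambda>_. 1) g g x + ?t g g g x)"
  have U: "integrable delta6 ?u" using T1(1) T2(1) T3(1) T4(1) by simp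
  have le: "(higher g i j k x)\<^sup>2 * \<bar>weight x\<bar> \<le> ?u x" for x
    using mult_right_mono[OF square_sum4_le[of "g (coord i x) * g (coord j x)" "g (coord i x) * g (coord k x)"
        "g (coord j x) * g (coord k x)" "g (coord i x) * g (coord j x) * g (coord k x)"], of "\<bar>weight x\<bar>"]
    by (simp add: higher_def algebra_simps)
  have m: "(\<lambda>x. (higher g i j k x)\<^sup>2 * \<bar>weight x\<bar>) \<in> borel_measurable delta6"
    unfolding higher_def by measurable
  show I: "integrable delta6 (\<lambda>x. (higher g i j k x)\<^sup>2 * \<bar>weight x\<bar>)"
  proof (rule Bochner_Integration.integrable_bound[OF U m], rule AE_I2)
    fix x
    show "norm ((higher g i j k x)\<^sup>2 * \<bar>weight x\<bar>) \<le> norm (?u x)"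
      using le[of x] by (smt (verit) mult_nonneg_nonneg real_norm_def zero_le_power2 abs_ge_zero)
  qed
  have "(\<integral>x. (higher g i j k x)\<^sup>2 * \<bar>weight x\<bar> \<partial>delta6) \<le> (\<integral>x. ?u x \<partial>delta6)"
    by (rule integral_mono[OF I U le])
  also have "\<dots> = 4 * ((\<integral>x. ?t g g (\<lambda>_. 1) x \<partial>delta6) + (\<integral>x. ?t g (\<lambda>_. 1) g x \<partial>delta6)
      + (\<integral>x. ?t (\<lambda>_. 1) g g x \<partial>delta6) + (\<integral>x. ?t g g g x \<partial>delta6))"
    using T1(1) T2(1) T3(1) T4(1) by simp
  also have "\<dots> \<le> 4 * (64 * pi\<^sup>2 * ?s\<^sup>2 + 64 * pi\<^sup>2 * ?s\<^sup>2 + 64 * pi\<^sup>2 * ?s\<^sup>2 + 32 * pi\<^sup>2 * ?s\<^sup>2)"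
  proof (intro mult_left_mono add_mono)
    have o: "(\<integral>w. 1\<^sup>2 \<partial>circle_measure) = 2 * pi" using measure_circle by simp
    show "(\<integral>x. ?t g g (\<lambda>_. 1) x \<partial>delta6) \<le> 64 * pi\<^sup>2 * ?s\<^sup>2" "(\<integral>x. ?t g (\<lambda>_. 1) g x \<partial>delta6) \<le> 64 * pi\<^sup>2 * ?s\<^sup>2"
      "(\<integral>x. ?t (\<lambda>_. 1) g g x \<partial>delta6) \<le> 64 * pi\<^sup>2 * ?s\<^sup>2"
      using T1(2) T2(2) T3(2) unfolding o by (simp_all add: power2_eq_square mult_ac)
    have "?s * ?s * ?s \<le> ?s * ?s * 1" using s s0 by (intro mult_left_mono) auto
    then have "32 * pi * (?s * ?s * ?s) \<le> 32 * pi * (?s * ?s)" by simp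
    also have "\<dots> \<le> 32 * (pi * pi) * (?s * ?s)"
    proof -
      have "pi * 1 \<le> pi * pi" using pi_gt3 by (intro mult_left_mono) auto
      then show ?thesis using s0 by (intro mult_right_mono) auto
    qed
    finally have "32 * pi * (?s * ?s * ?s) \<le> 32 * (pi * pi) * (?s * ?s)" .
    moreover have "32 * pi\<^sup>2 * ?s\<^sup>2 = 32 * (pi * pi) * (?s * ?s)" by (simp only: power2_eq_square)
    ultimately show "(\<integral>x. ?t g g g x \<partial>delta6) \<le> 32 * pi\<^sup>2 * ?s\<^sup>2" using T4(2) by linarith
  qed simp
  also have "\<dots> = 896 * pi\<^sup>2 * ?s\<^sup>2" by (simp add: algebra_simps)
  finally show "(\<integral>x. (higher g i j k x)\<^sup>2 * \<bar>weight x\<bar> \<partial>delta6) \<le> 896 * pi\<^sup>2 * ?s\<^sup>2" .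
qed

section \<open>Expansion of the functional at the constant function\<close>

definition cubic_diff :: "(complex \<Rightarrow> real) \<Rightarrow> complex6 \<Rightarrow> real" where
  "cubic_diff f x = f (coord 0 x) * f (coord 1 x) * f (coord 2 x) - f (coord 3 x) * f (coord 4 x) * f (coord 5 x)"

lemma Psi_eq: "Psi f = (\<integral>x. (cubic_diff f x)\<^sup>2 * weight x \<partial>delta6)"
  unfolding Psi_def cubic_diff_def weight_def
  by (intro Bochner_Integration.integral_cong refl) (auto simp: coord_def)

lemma Psi_scale: "Psi (\<lambda>w. m * f w) = m ^ 6 * Psi f"
proof -
  have e: "(cubic_diff (\<lambda>w. m * f w) x)\<^sup>2 * weight x = m ^ 6 * ((cubic_diff f x)\<^sup>2 * weight x)" for x
    by (simp add: cubic_diff_def power2_eq_square power_numeral_reduce algebra_simps)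
  show ?thesis unfolding Psi_eq e by simp
qed

text \<open>Since W has no sign, the cross term 2 L R W is estimated against |W| by Young's
  inequality. The parameter \<open>e\<close> keeps the loss in L^2 |W| below the coercive gain, at
  the price 1 / e on the higher-order term.\<close>

lemma perturbation_lower_bound:
  fixes L R W e :: real
  assumes e: "e > 0"
  shows "L\<^sup>2 * W - e * (L\<^sup>2 * \<bar>W\<bar>) - (1 + 1 / e) * (R\<^sup>2 * \<bar>W\<bar>) \<le> (L + R)\<^sup>2 * W"
proof -
  have "2 * \<bar>(sqrt e * L) * (R / sqrt e)\<bar> \<le> (sqrt e * L)\<^sup>2 + (R / sqrt e)\<^sup>2" by (rule abs_mult_le_squares)
  then have "2 * \<bar>L * R\<bar> \<le> e * L\<^sup>2 + 1 / e * R\<^sup>2" using e by (simp add: power_mult_distrib power_divide)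
  then have "(2 * \<bar>L * R\<bar> + R\<^sup>2) * \<bar>W\<bar> \<le> (e * L\<^sup>2 + 1 / e * R\<^sup>2 + R\<^sup>2) * \<bar>W\<bar>"
    by (intro mult_right_mono) auto
  moreover have "- ((2 * \<bar>L * R\<bar> + R\<^sup>2) * \<bar>W\<bar>) \<le> (2 * (L * R) + R\<^sup>2) * W"
  proof -
    have "\<bar>2 * (L * R) + R\<^sup>2\<bar> \<le> 2 * \<bar>L * R\<bar> + R\<^sup>2"
      using abs_triangle_ineq[of "2 * (L * R)" "R\<^sup>2"] by (simp add: abs_mult)
    then have "\<bar>(2 * (L * R) + R\<^sup>2) * W\<bar> \<le> (2 * \<bar>L * R\<bar> + R\<^sup>2) * \<bar>W\<bar>"
      unfolding abs_mult[of _ W] by (rule mult_right_mono) simp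
    then show ?thesis by (simp only: abs_le_iff) linarith
  qed
  ultimately have "- ((e * L\<^sup>2 + 1 / e * R\<^sup>2 + R\<^sup>2) * \<bar>W\<bar>) \<le> (2 * (L * R) + R\<^sup>2) * W" by linarith
  moreover have "(L + R)\<^sup>2 * W = L\<^sup>2 * W + (2 * (L * R) + R\<^sup>2) * W"
    by (simp add: power2_sum algebra_simps)
  moreover have "e * (L\<^sup>2 * \<bar>W\<bar>) + (1 + 1 / e) * (R\<^sup>2 * \<bar>W\<bar>) = (e * L\<^sup>2 + 1 / e * R\<^sup>2 + R\<^sup>2) * \<bar>W\<bar>"
    by (simp add: algebra_simps)
  ultimately show ?thesis by linarith
qed

lemma Psi_nonneg_near_1:
  obtains \<eta> where "\<eta> > 0" "\<And>g. g \<in> L2_circle \<Longrightarrow> (\<integral>w. g w \<partial>circle_measure) = 0 \<Longrightarrow>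
    (\<integral>w. (g w)\<^sup>2 \<partial>circle_measure) \<le> \<eta> \<Longrightarrow> 0 \<le> Psi (\<lambda>w. 1 + g w)"
proof -
  obtain \<kappa> where \<kappa>: "\<kappa> > 0" "\<And>g. g \<in> L2_circle \<Longrightarrow> (\<integral>w. g w \<partial>circle_measure) = 0 \<Longrightarrow>
      \<kappa> * (\<integral>w. (g w)\<^sup>2 \<partial>circle_measure) \<le> (\<integral>x. (norm (moment g x))\<^sup>2 \<partial>delta6)"
    by (rule moment_coercive) (rule that)
  \<comment> \<open>With the constant of \<open>quadratic_form(4)\<close>, this makes the loss in
    the linear part 2/5 \<kappa> s, half of the gain 4/5 \<kappa> s, where s is the squared norm of
    g.\<close>
  define e where "e = 2 / 5 * \<kappa> / (46080 * pi ^ 3)"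
  have e: "e > 0" using \<kappa>(1) by (simp add: e_def)
  define C where "C = (1 + 1 / e) * (3584 * pi\<^sup>2)"
  have C: "C > 0" unfolding C_def using e by (intro mult_pos_pos add_pos_pos) auto
  \<comment> \<open>The other half, 2/5 \<kappa> s, has to cover C s^2. The bound 1 is the smallness
    assumed in \<open>higher_bound\<close>.\<close>
  define \<eta> where "\<eta> = min 1 (2 / 5 * \<kappa> / C)"
  show ?thesis
  proof (rule that[of \<eta>])
    show "\<eta> > 0" using \<kappa>(1) C by (simp add: \<eta>_def)
    fix g assume g: "g \<in> L2_circle" "(\<integral>w. g w \<partial>circle_measure) = 0" and s: "(\<integral>w. (g w)\<^sup>2 \<partial>circle_measure) \<le> \<eta>"
    note [measurable] = L2_circleD(1)[OF g(1)]
    let ?s = "\<integral>w. (g w)\<^sup>2 \<partial>circle_measure"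
    have s0: "?s \<ge> 0" by (intro Bochner_Integration.integral_nonneg) auto
    have s1: "?s \<le> 1" "C * ?s \<le> 2 / 5 * \<kappa>"
      using s C by (auto simp: \<eta>_def pos_le_divide_eq mult.commute)
    define R where "R x = higher g 0 1 2 x - higher g 3 4 5 x" for x
    have H1: "integrable delta6 (\<lambda>x. (higher g 0 1 2 x)\<^sup>2 * \<bar>weight x\<bar>)"
      "(\<integral>x. (higher g 0 1 2 x)\<^sup>2 * \<bar>weight x\<bar> \<partial>delta6) \<le> 896 * pi\<^sup>2 * ?s\<^sup>2"
      by (rule higher_bound[OF g(1) s1(1)]; simp)+
    have H2: "integrable delta6 (\<lambda>x. (higher g 3 4 5 x)\<^sup>2 * \<bar>weight x\<bar>)"
      "(\<integral>x. (higher g 3 4 5 x)\<^sup>2 * \<bar>weight x\<bar> \<partial>delta6) \<le> 896 * pi\<^sup>2 * ?s\<^sup>2"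
      by (rule higher_bound[OF g(1) s1(1)]; simp)+
    have Rm: "(\<lambda>x. (R x)\<^sup>2 * \<bar>weight x\<bar>) \<in> borel_measurable delta6"
      unfolding R_def higher_def by measurable
    let ?u = "\<lambda>x. 2 * ((higher g 0 1 2 x)\<^sup>2 * \<bar>weight x\<bar>) + 2 * ((higher g 3 4 5 x)\<^sup>2 * \<bar>weight x\<bar>)"
    have uI: "integrable delta6 ?u" using H1 H2 by simp
    have Ru: "(R x)\<^sup>2 * \<bar>weight x\<bar> \<le> ?u x" for x
    proof -
      have "(R x)\<^sup>2 \<le> 2 * (higher g 0 1 2 x)\<^sup>2 + 2 * (higher g 3 4 5 x)\<^sup>2"
        unfolding R_def using sum_squares_bound[of "higher g 0 1 2 x" "- higher g 3 4 5 x"] by (simp add: power2_diff)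
      then have "(R x)\<^sup>2 * \<bar>weight x\<bar> \<le> (2 * (higher g 0 1 2 x)\<^sup>2 + 2 * (higher g 3 4 5 x)\<^sup>2) * \<bar>weight x\<bar>"
        by (rule mult_right_mono) simp
      then show ?thesis by (simp add: algebra_simps)
    qed
    have RI: "integrable delta6 (\<lambda>x. (R x)\<^sup>2 * \<bar>weight x\<bar>)"
    proof (rule Bochner_Integration.integrable_bound[OF uI Rm], rule AE_I2)
      fix x
      have "0 \<le> (R x)\<^sup>2 * \<bar>weight x\<bar>" by simp
      then show "norm ((R x)\<^sup>2 * \<bar>weight x\<bar>) \<le> norm (?u x)" using Ru[of x] by (simp only: real_norm_def abs_of_nonneg)
    qed
    have RB: "(\<integral>x. (R x)\<^sup>2 * \<bar>weight x\<bar> \<partial>delta6) \<le> 3584 * pi\<^sup>2 * ?s\<^sup>2"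
    proof -
      have "(\<integral>x. (R x)\<^sup>2 * \<bar>weight x\<bar> \<partial>delta6) \<le> (\<integral>x. ?u x \<partial>delta6)" by (rule integral_mono[OF RI uI Ru])
      also have "\<dots> = 2 * (\<integral>x. (higher g 0 1 2 x)\<^sup>2 * \<bar>weight x\<bar> \<partial>delta6)
      + 2 * (\<integral>x. (higher g 3 4 5 x)\<^sup>2 * \<bar>weight x\<bar> \<partial>delta6)"
        using H1 H2 by simp
      also have "\<dots> \<le> 2 * (896 * pi\<^sup>2 * ?s\<^sup>2) + 2 * (896 * pi\<^sup>2 * ?s\<^sup>2)"
        using H1(2) H2(2) by linarith
      finally show ?thesis by simp
    qed
    note Q = quadratic_form[OF g(1)]
    let ?f = "\<lambda>w. 1 + g w"
    have P: "cubic_diff ?f x = linear_diff g x + R x" for x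
      by (simp add: cubic_diff_def linear_diff_def R_def higher_def algebra_simps)
    show "0 \<le> Psi ?f"
    proof (cases "integrable delta6 (\<lambda>x. (cubic_diff ?f x)\<^sup>2 * weight x)")
      \<comment> \<open>The Bochner integral of a non-integrable function is 0 by
        convention.\<close>
      case False
      then show ?thesis by (simp add: Psi_eq not_integrable_integral_eq)
    next
      case True
      let ?l = "\<lambda>x. (linear_diff g x)\<^sup>2 * weight x - e * ((linear_diff g x)\<^sup>2 * \<bar>weight x\<bar>) - (1 + 1 / e) * ((R x)\<^sup>2 * \<bar>weight x\<bar>)"
      have "0 \<le> ?s * (2 / 5 * \<kappa> - C * ?s)" using s0 s1 by (intro mult_nonneg_nonneg) auto
      also have "\<dots> = 4 / 5 * (\<kappa> * ?s) - e * (46080 * pi ^ 3 * ?s) - (1 + 1 / e) * (3584 * pi\<^sup>2 * ?s\<^sup>2)"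
      proof -
        have "e * (46080 * pi ^ 3 * ?s) = 2 / 5 * \<kappa> * ?s" by (simp add: e_def)
        moreover have "(1 + 1 / e) * (3584 * pi\<^sup>2 * ?s\<^sup>2) = C * ?s * ?s" by (simp add: C_def power2_eq_square)
        ultimately show ?thesis by (simp only:) (simp add: algebra_simps)
      qed
      also have "\<dots> \<le> 4 / 5 * (\<integral>x. (norm (moment g x))\<^sup>2 \<partial>delta6)
          - e * (\<integral>x. (linear_diff g x)\<^sup>2 * \<bar>weight x\<bar> \<partial>delta6) - (1 + 1 / e) * (\<integral>x. (R x)\<^sup>2 * \<bar>weight x\<bar> \<partial>delta6)"
        using \<kappa>(2)[OF g] Q(4) RB e by (intro diff_mono mult_left_mono) auto
      also have "\<dots> = (\<integral>x. ?l x \<partial>delta6)"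
        using Q RI by simp
      also have "\<dots> \<le> (\<integral>x. (cubic_diff ?f x)\<^sup>2 * weight x \<partial>delta6)"
      proof (rule integral_mono[OF _ True])
        show "integrable delta6 ?l" using Q RI by simp
        show "?l x \<le> (cubic_diff ?f x)\<^sup>2 * weight x" for x
          unfolding P by (rule perturbation_lower_bound[OF e])
      qed
      finally show ?thesis by (simp add: Psi_eq)
    qed
  qed
qed

theorem theorem6:
  shows "\<exists>\<delta>>0. \<forall>f \<in> L2_circle. L2_circle_norm (\<lambda>w. f w - 1) < \<delta> \<longrightarrow> 0 \<le> Psi f"
proof -
  obtain \<eta> where \<eta>: "\<eta> > 0" "\<And>g. g \<in> L2_circle \<Longrightarrow> (\<integral>w. g w \<partial>circle_measure) = 0 \<Longrightarrow>
    (\<integral>w. (g w)\<^sup>2 \<partial>circle_measure) \<le> \<eta> \<Longrightarrow> 0 \<le> Psi (\<lambda>w. 1 + g w)"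
    by (rule Psi_nonneg_near_1) (rule that)
  \<comment> \<open>The bound 1 keeps the mean of f at least 1/2. Dividing by that mean can then
    multiply the squared norm by at most 4, which explains \<eta> / 4.\<close>
  define \<delta> where "\<delta> = min 1 (sqrt (\<eta> / 4))"
  have "\<delta> > 0" using \<eta>(1) by (simp add: \<delta>_def)
  moreover have "0 \<le> Psi f" if f: "f \<in> L2_circle" and near: "L2_circle_norm (\<lambda>w. f w - 1) < \<delta>" for f
  proof -
    have one: "(\<lambda>_. k) \<in> L2_circle" for k :: real by (rule continuous_on_L2) auto
    define h where "h w = f w - 1" for w
    have h: "h \<in> L2_circle" unfolding h_def by (rule L2_circle_diff[OF f one])
    define d where "d = (\<integral>w. (h w)\<^sup>2 \<partial>circle_measure)"
    have d0: "0 \<le> d" unfolding d_def by (intro Bochner_Integration.integral_nonneg) auto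
    have "sqrt d < \<delta>" using near by (simp add: L2_circle_norm_def d_def h_def)
    then have d: "d < 1" "d < \<eta> / 4" by (auto simp: \<delta>_def)
    note hI = L2_circleD(2)[OF h] integrable_L2(1)[OF h]
    define a where "a = (\<integral>w. h w \<partial>circle_measure) / (2 * pi)"
    \<comment> \<open>\<open>m\<close> is the mean of f, so that f = m (1 + g) with g of mean
      zero.\<close>
    define m where "m = 1 + a"
    have ha: "(\<integral>w. h w \<partial>circle_measure) = 2 * pi * a" by (simp add: a_def)
    have "\<bar>2 * pi * a\<bar> \<le> (\<integral>w. \<bar>h w\<bar> \<partial>circle_measure)"
      unfolding ha[symmetric] by (rule integral_abs_bound)
    \<comment> \<open>The constant 1/4 integrates to pi / 2, which together with d < 1 stays below
      pi and gives |a| <= 1/2.\<close>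
    also have "\<dots> \<le> (\<integral>w. 1 / 4 + (h w)\<^sup>2 \<partial>circle_measure)"
    proof (rule integral_mono)
      show "\<bar>h w\<bar> \<le> 1 / 4 + (h w)\<^sup>2" for w
        using sum_squares_bound[of "1 / 2" "\<bar>h w\<bar>"] by (simp add: power_divide)
    qed (use hI in auto)
    also have "\<dots> = pi / 2 + d" using hI measure_circle by (simp add: d_def)
    also have "\<dots> \<le> pi" using d pi_gt3 by simp
    finally have "2 * pi * \<bar>a\<bar> \<le> 2 * pi * (1 / 2)" by (simp add: abs_mult)
    then have "\<bar>a\<bar> \<le> 1 / 2" by (subst (asm) mult_le_cancel_left_pos) auto
    then have m: "1 / 2 \<le> m" by (simp add: m_def abs_le_iff)
    define g where "g w = 1 / m * (h w - a)" for w
    have hm: "(\<lambda>w. h w - a) \<in> L2_circle" by (rule L2_circle_diff[OF h one])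
    have gL: "g \<in> L2_circle" unfolding g_def by (rule L2_circle_add(2)[OF hm hm])
    have "(\<integral>w. g w \<partial>circle_measure) = 0"
      unfolding g_def using hI measure_circle by (simp add: ha)
    moreover have "(\<integral>w. (g w)\<^sup>2 \<partial>circle_measure) \<le> \<eta>"
    proof -
      have "(\<integral>w. (h w - a)\<^sup>2 \<partial>circle_measure) = (\<integral>w. (h w)\<^sup>2 - 2 * a * h w + a\<^sup>2 \<partial>circle_measure)"
        by (intro Bochner_Integration.integral_cong refl) (simp add: power2_diff)
      also have "\<dots> = d - 2 * pi * a\<^sup>2"
        using hI measure_circle by (simp add: ha d_def power2_eq_square algebra_simps)
      also have "\<dots> \<le> d" by simp
      finally have v: "(\<integral>w. (h w - a)\<^sup>2 \<partial>circle_measure) \<le> d" .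
      have m2: "1 / m\<^sup>2 \<le> 4"
      proof -
        have "(1 / 2)\<^sup>2 \<le> m\<^sup>2" using m by (intro power_mono) auto
        then show ?thesis using m by (simp add: pos_divide_le_eq power_divide)
      qed
      have "(\<integral>w. (g w)\<^sup>2 \<partial>circle_measure) = 1 / m\<^sup>2 * (\<integral>w. (h w - a)\<^sup>2 \<partial>circle_measure)"
        by (simp add: g_def power_mult_distrib power_divide)
      also have "\<dots> \<le> 4 * d" using m2 v by (intro mult_mono) auto
      finally show ?thesis using d by simp
    qed
    ultimately have "0 \<le> Psi (\<lambda>w. 1 + g w)" by (intro \<eta>(2) gL)
    moreover have "f = (\<lambda>w. m * (1 + g w))"
    proof
      fix w
      have "m * g w = h w - a" using m by (simp add: g_def)
      then show "f w = m * (1 + g w)" by (simp add: distrib_left) (simp add: m_def h_def)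
    qed
    ultimately show ?thesis
      using Psi_scale[of m "\<lambda>w. 1 + g w"] m by simp
  qed
  ultimately show ?thesis by blast
qed

end
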